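(* Let $\mathcal{L}$ be a Banach space and let $R_n$ ($n\ge1$) be bounded operators on $\mathcal{L}$ with $\|R_n\|\le r_n$ for a sequence $r_n$ such that $a_n=\sum_{k>n}r_k$ is summable. Write $R(z)=\sum_{n\ge1}R_nz^n$ for $z\in\overline{\mathbb{D}}$. Assume that $1$ is a simple isolated eigenvalue of $R(1)$ and that $I-R(z)$ is invertible for $z\in\overline{\mathbb{D}}\setminus\{1\}$. Let $P$ denote the spectral projection of $R(1)$ for the eigenvalue $1$, and assume that $PR'(1)P=\mu P$ for some $\mu>0$. Let $\alpha>0$ and, for each $n\geq 1$, let $R_n(t)$ be a bounded operator on $\mathcal{L}$ depending on $t\in[-\alpha,\alpha]$, continuous at $t=0$, with $R_n(0)=R_n$ and $\|R_n(t)\|\le Cr_n$ for all $t\in[-\alpha,\alpha]$, for some constant $C>0$. For $z\in\overline{\mathbb{D}}$ and $t\in[-\alpha,\alpha]$ write $R(z,t)=\sum_{n=1}^\infty z^nR_n(t)$. For $t$ small and $z$ close to $1$, $R(z,t)$ is close to $R(1)$ and hence admits a unique eigenvalue $\lambda(z,t)$ close to $1$. Assume that $\lambda(1,t)=1-(c+o(1))M(|t|)$ as $t\to0$, for some $c\in\mathbb{C}$ with $\mathrm{Re}(c)>0$ and some continuous function $M:\mathbb{R}_+\to\mathbb{R}_+$ vanishing only at $0$. Then: 1. There exists $\epsilon_0>0$ such that for all $|t|<\epsilon_0$, $I-R(z,t)$ is invertible for all $z\in\mathbb{D}$, and one can write $(I-R(z,t))^{-1}=\sum_nT_{n,t}z^n$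 on $\mathbb{D}$. 2. Furthermore, there exist functions $\epsilon(t)$ and $\delta(n)$ tending to $0$ when $t\to0$ and $n\to\infty$ respectively, such that for all $|t|<\epsilon_0$ and all $n\in\mathbb{N}^*$, $$\left\|T_{n,t}-\frac1\mu\left(1-\frac c\mu M(|t|)\right)^nP\right\|\le\epsilon(t)+\delta(n).$$
   Context: $\mathbb{D}=\{z\in\mathbb{C}:|z|<1\}$, $\overline{\mathbb{D}}=\{z\in\mathbb{C}:|z|\le1\}$, $\mathbb{N}^*=\{1,2,\dots\}$. $\mathcal{L}$ is a complex Banach space and $\|\cdot\|$ is the operator norm. $R'(1)=\sum_{n\ge1}nR_n$ (norm convergent), the limit of $\frac{R(z)-R(1)}{z-1}$ as $z\to1$ in $\overline{\mathbb{D}}$. A simple isolated eigenvalue is an isolated point of the spectrum whose spectral projection has rank one. *)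

theory Defs
  imports "HOL-Analysis.Analysis"
begin

class scaleC =
  fixes scaleC :: "complex \<Rightarrow> 'a \<Rightarrow> 'a" (infixr "*\<^sub>C" 75)

text \<open>A complex normed space is a real normed space whose scalar multiplication extends to the
  complex numbers and whose norm is homogeneous for complex scalars.\<close>

class complex_normed_vector = real_normed_vector + scaleC +
  assumes scaleC_add_right: "a *\<^sub>C (x + y) = a *\<^sub>C x + a *\<^sub>C y"
    and scaleC_add_left: "(a + b) *\<^sub>C x = a *\<^sub>C x + b *\<^sub>C x"
    and scaleC_scaleC: "a *\<^sub>C b *\<^sub>C x = (a * b) *\<^sub>C x"
    and scaleR_scaleC: "r *\<^sub>R x = complex_of_real r *\<^sub>C x"
    and norm_scaleC: "norm (a *\<^sub>C x) = cmod a * norm x"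

class complex_banach = complex_normed_vector + banach

instantiation complex :: complex_banach
begin

definition scaleC_complex :: "complex \<Rightarrow> complex \<Rightarrow> complex"
  where "scaleC_complex a x = a * x"

instance
  by standard (simp_all add: scaleC_complex_def algebra_simps norm_mult scaleR_conv_of_real)

end

lemma scaleC_scaleR_commute:
  fixes x :: "'a :: complex_normed_vector"
  shows "a *\<^sub>C (r *\<^sub>R x) = r *\<^sub>R (a *\<^sub>C x)"
  by (simp add: scaleR_scaleC scaleC_scaleC mult.commute)

lemma bounded_linear_scaleC:
  "bounded_linear (\<lambda>x :: 'a :: complex_normed_vector. a *\<^sub>C x)"
  by (rule bounded_linear_intro[where K = "cmod a"])
    (simp_all add: scaleC_add_right scaleC_scaleR_commute norm_scaleC mult.commute)

text \<open>The bounded complex-linear operators of a complex normed space into itself. The norm is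
  inherited from \<^typ>\<open>'a \<Rightarrow>\<^sub>L 'a\<close>, i.e. it is the operator norm.\<close>

typedef (overloaded) 'a cbop =
  "{T :: 'a :: complex_normed_vector \<Rightarrow>\<^sub>L 'a. \<forall>a x. T (a *\<^sub>C x) = a *\<^sub>C T x}"
  morphisms blinfun_of_cbop Abs_cbop
proof
  show "id_blinfun \<in> {T :: 'a \<Rightarrow>\<^sub>L 'a. \<forall>a x. T (a *\<^sub>C x) = a *\<^sub>C T x}" by simp
qed

setup_lifting type_definition_cbop

lift_definition cbop_apply :: "'a :: complex_normed_vector cbop \<Rightarrow> 'a \<Rightarrow> 'a"
  is blinfun_apply .

lemma scaleC_zero_right: "a *\<^sub>C (0 :: 'a :: complex_normed_vector) = 0"
  using scaleC_scaleR_commute[of a 0 "0 :: 'a"] by simp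

lemma scaleC_minus_right: "a *\<^sub>C (- x :: 'a :: complex_normed_vector) = - (a *\<^sub>C x)"
  using scaleC_scaleR_commute[of a "-1" x] by simp

lemma scaleC_diff_right: "a *\<^sub>C (x - y :: 'a :: complex_normed_vector) = a *\<^sub>C x - a *\<^sub>C y"
  using scaleC_add_right[of a x "- y"] by (simp add: scaleC_minus_right)

instantiation cbop :: (complex_normed_vector) complex_normed_vector
begin

lift_definition zero_cbop :: "'a cbop" is 0
  by (simp add: scaleC_zero_right)
lift_definition plus_cbop :: "'a cbop \<Rightarrow> 'a cbop \<Rightarrow> 'a cbop" is "(+)"
  by (simp add: blinfun.add_left scaleC_add_right)
lift_definition minus_cbop :: "'a cbop \<Rightarrow> 'a cbop \<Rightarrow> 'a cbop" is "(-)"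
  by (simp add: blinfun.diff_left scaleC_diff_right)
lift_definition uminus_cbop :: "'a cbop \<Rightarrow> 'a cbop" is uminus
  by (simp add: blinfun.minus_left scaleC_minus_right)
lift_definition scaleR_cbop :: "real \<Rightarrow> 'a cbop \<Rightarrow> 'a cbop" is scaleR
  by (simp add: blinfun.scaleR_left scaleC_scaleR_commute)
lift_definition scaleC_cbop :: "complex \<Rightarrow> 'a cbop \<Rightarrow> 'a cbop"
  is "\<lambda>a (T :: 'a \<Rightarrow>\<^sub>L 'a). Blinfun (\<lambda>x. a *\<^sub>C T x)"
  by (simp add: bounded_linear_Blinfun_apply bounded_linear_compose[OF bounded_linear_scaleC]
      blinfun.bounded_linear_right scaleC_scaleC mult.commute)
lift_definition norm_cbop :: "'a cbop \<Rightarrow> real" is norm .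
lift_definition dist_cbop :: "'a cbop \<Rightarrow> 'a cbop \<Rightarrow> real" is dist .

definition sgn_cbop :: "'a cbop \<Rightarrow> 'a cbop" where "sgn_cbop T = scaleR (inverse (norm T)) T"

definition [code del]:
  "(uniformity :: ('a cbop \<times> 'a cbop) filter) = (INF e\<in>{0 <..}. principal {(S, T). dist S T < e})"

definition open_cbop :: "'a cbop set \<Rightarrow> bool"
  where [code del]: "open_cbop S = (\<forall>x\<in>S. \<forall>\<^sub>F (x', y) in uniformity. x' = x \<longrightarrow> y \<in> S)"

lemma blinfun_scaleC_apply:
  fixes T :: "'a \<Rightarrow>\<^sub>L 'a"
  shows "blinfun_apply (Blinfun (\<lambda>x. a *\<^sub>C T x)) y = a *\<^sub>C T y"
  by (simp add: bounded_linear_Blinfun_apply bounded_linear_compose[OF bounded_linear_scaleC]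
      blinfun.bounded_linear_right)

lemma norm_blinfun_scaleC_le:
  fixes T :: "'a \<Rightarrow>\<^sub>L 'a"
  shows "norm (Blinfun (\<lambda>x. a *\<^sub>C T x)) \<le> cmod a * norm T"
  by (rule norm_blinfun_bound)
    (auto simp: blinfun_scaleC_apply norm_scaleC mult.assoc intro!: mult_left_mono norm_blinfun)

instance
proof
  fix S T U :: "'a cbop" and a b :: complex and r s :: real
  show "S + T + U = S + (T + U)" by transfer (simp add: add.assoc)
  show "S + T = T + S" by transfer (simp add: add.commute)
  show "0 + T = T" by transfer simp
  show "- T + T = 0" by transfer simp
  show "S - T = S + - T" by transfer simp
  show "r *\<^sub>R (S + T) = r *\<^sub>R S + r *\<^sub>R T" by transfer (simp add: scaleR_add_right)
  show "(r + s) *\<^sub>R T = r *\<^sub>R T + s *\<^sub>R T" by transfer (simp add: scaleR_add_left)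
  show "r *\<^sub>R s *\<^sub>R T = (r * s) *\<^sub>R T" by transfer simp
  show "1 *\<^sub>R T = T" by transfer simp
  show "dist S T = norm (S - T)" by transfer (simp add: dist_norm)
  show "sgn T = inverse (norm T) *\<^sub>R T" by (simp add: sgn_cbop_def)
  show "(uniformity :: ('a cbop \<times> 'a cbop) filter)
      = (INF e\<in>{0 <..}. principal {(S, T). dist S T < e})"
    by (simp add: uniformity_cbop_def)
  show "open X = (\<forall>x\<in>X. \<forall>\<^sub>F (x', y) in uniformity. x' = x \<longrightarrow> y \<in> X)" for X :: "'a cbop set"
    by (simp add: open_cbop_def)
  show "(norm T = 0) = (T = 0)" by transfer simp
  show "norm (S + T) \<le> norm S + norm T" by transfer (rule norm_triangle_ineq)
  show "norm (r *\<^sub>R T) = \<bar>r\<bar> * norm T" by transfer simp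
  show "a *\<^sub>C (S + T) = a *\<^sub>C S + a *\<^sub>C T"
    by (transfer, rule blinfun_eqI, subst blinfun_scaleC_apply,
        simp add: blinfun_scaleC_apply blinfun.add_left scaleC_add_right)
  show "(a + b) *\<^sub>C T = a *\<^sub>C T + b *\<^sub>C T"
    by (transfer, rule blinfun_eqI, simp only: blinfun_scaleC_apply blinfun.add_left,
        simp add: blinfun.add_left scaleC_add_left)
  show "a *\<^sub>C b *\<^sub>C T = (a * b) *\<^sub>C T"
    by (transfer, rule blinfun_eqI, simp add: blinfun_scaleC_apply scaleC_scaleC)
  show "r *\<^sub>R T = complex_of_real r *\<^sub>C T"
    by (transfer, rule blinfun_eqI, simp only: blinfun_scaleC_apply blinfun.scaleR_left scaleR_scaleC)
  show "norm (a *\<^sub>C T) = cmod a * norm T"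
  proof transfer
    fix a :: complex and T :: "'a \<Rightarrow>\<^sub>L 'a"
    let ?B = "\<lambda>a T. Blinfun (\<lambda>x. a *\<^sub>C blinfun_apply T x) :: 'a \<Rightarrow>\<^sub>L 'a"
    show "norm (?B a T) = cmod a * norm T"
    proof (rule antisym)
      show "norm (?B a T) \<le> cmod a * norm T" by (rule norm_blinfun_scaleC_le)
      show "cmod a * norm T \<le> norm (?B a T)"
      proof (cases "a = 0")
        case False
        have "?B (inverse a) (?B a T) = T"
          by (rule blinfun_eqI)
            (use False scaleR_scaleC[of 1, symmetric] in \<open>simp add: blinfun_scaleC_apply scaleC_scaleC\<close>)
        then have "norm T \<le> cmod (inverse a) * norm (?B a T)"
          using norm_blinfun_scaleC_le[of "inverse a" "?B a T"] by simp
        then show ?thesis using False by (simp add: norm_divide field_simps)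
      qed simp
    qed
  qed
qed

end

instance cbop :: (complex_banach) complex_banach
proof
  fix X :: "nat \<Rightarrow> 'a cbop"
  assume "Cauchy X"
  then have "Cauchy (\<lambda>n. blinfun_of_cbop (X n))"
    unfolding Cauchy_def by (simp add: dist_cbop.rep_eq)
  then obtain L where L: "(\<lambda>n. blinfun_of_cbop (X n)) \<longlonglongrightarrow> L"
    using Cauchy_convergent_iff convergent_def by blast
  have app: "(\<lambda>n. blinfun_apply (blinfun_of_cbop (X n)) x) \<longlonglongrightarrow> L x" for x
    by (rule blinfun.tendsto[OF L tendsto_const])
  have "L (a *\<^sub>C x) = a *\<^sub>C L x" for a x
  proof (rule LIMSEQ_unique[OF app])
    have "blinfun_apply (blinfun_of_cbop (X n)) (a *\<^sub>C x)
        = a *\<^sub>C blinfun_apply (blinfun_of_cbop (X n)) x" for n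
      using blinfun_of_cbop[of "X n"] by simp
    then show "(\<lambda>n. blinfun_apply (blinfun_of_cbop (X n)) (a *\<^sub>C x)) \<longlonglongrightarrow> a *\<^sub>C L x"
      using bounded_linear.tendsto[OF bounded_linear_scaleC app] by simp
  qed
  then have "blinfun_of_cbop (Abs_cbop L) = L" by (simp add: Abs_cbop_inverse)
  with L have "X \<longlonglongrightarrow> Abs_cbop L"
    unfolding tendsto_iff by (simp add: dist_cbop.rep_eq)
  then show "convergent X" by (auto simp: convergent_def)
qed

text \<open>Multiplication is composition and \<open>1\<close> is the identity. The axiom \<open>0 \<noteq> 1\<close> fails on the
  zero space, hence there is no instance of \<^class>\<open>ring_1\<close>.\<close>

instantiation cbop :: (complex_normed_vector) real_normed_algebra
begin

lift_definition times_cbop :: "'a cbop \<Rightarrow> 'a cbop \<Rightarrow> 'a cbop" is "(o\<^sub>L)"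
  by simp

instance
proof
  fix S T U :: "'a cbop" and r :: real
  show "S * T * U = S * (T * U)" by transfer (auto intro!: blinfun_eqI)
  show "(S + T) * U = S * U + T * U"
    by transfer (auto intro!: blinfun_eqI simp: blinfun.add_left)
  show "S * (T + U) = S * T + S * U"
    by transfer (auto intro!: blinfun_eqI simp: blinfun.add_left blinfun.add_right)
  show "(r *\<^sub>R S) * T = r *\<^sub>R (S * T)"
    by transfer (auto intro!: blinfun_eqI simp: blinfun.scaleR_left)
  show "S * (r *\<^sub>R T) = r *\<^sub>R (S * T)"
    by transfer (auto intro!: blinfun_eqI simp: blinfun.scaleR_left blinfun.scaleR_right)
  show "norm (S * T) \<le> norm S * norm T"
    by transfer (rule norm_blinfun_compose)
qed

end

instantiation cbop :: (complex_normed_vector) monoid_mult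
begin

lift_definition one_cbop :: "'a cbop" is id_blinfun
  by simp

instance
  by standard (transfer, auto intro!: blinfun_eqI)+

end

lemma cbop_apply_simps:
  "cbop_apply 0 x = 0" "cbop_apply 1 x = x"
  "cbop_apply (S + T) x = cbop_apply S x + cbop_apply T x"
  "cbop_apply (S - T) x = cbop_apply S x - cbop_apply T x"
  "cbop_apply (S * T) x = cbop_apply S (cbop_apply T x)"
  "cbop_apply (a *\<^sub>C T) x = a *\<^sub>C cbop_apply T x"
  by (transfer, simp add: blinfun.add_left blinfun.diff_left blinfun_scaleC_apply)+

definition cbop_invertible :: "'a :: complex_normed_vector cbop \<Rightarrow> bool"
  where "cbop_invertible A \<longleftrightarrow> (\<exists>B. A * B = 1 \<and> B * A = 1)"

definition cbop_inv :: "'a :: complex_normed_vector cbop \<Rightarrow> 'a cbop"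
  where "cbop_inv A = (THE B. A * B = 1 \<and> B * A = 1)"

definition spectrum :: "'a :: complex_normed_vector cbop \<Rightarrow> complex set"
  where "spectrum T = {l. \<not> cbop_invertible (l *\<^sub>C 1 - T)}"

definition eigenvalue :: "'a :: complex_normed_vector cbop \<Rightarrow> complex \<Rightarrow> bool"
  where "eigenvalue T l \<longleftrightarrow> (\<exists>x. x \<noteq> 0 \<and> cbop_apply T x = l *\<^sub>C x)"

text \<open>\<open>P\<close> is the Riesz projection \<open>1/(2\<pi>i) \<integral> (z I - T)\<^sup>-\<^sup>1 dz\<close> over a circle
  \<open>z = l + r e\<^sup>i\<^sup>\<theta>\<close> enclosing no point of the spectrum other than \<open>l\<close>; the factor \<open>i\<close> of
  \<open>dz = i r e\<^sup>i\<^sup>\<theta> d\<theta>\<close> cancels.\<close>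

definition spectral_projection ::
    "'a :: complex_normed_vector cbop \<Rightarrow> complex \<Rightarrow> 'a cbop \<Rightarrow> bool"
  where "spectral_projection T l P \<longleftrightarrow>
    (\<exists>r>0. spectrum T \<inter> cball l r = {l} \<and>
      ((\<lambda>\<theta>. (complex_of_real (r / (2 * pi)) * cis \<theta>) *\<^sub>C
              cbop_inv ((l + complex_of_real r * cis \<theta>) *\<^sub>C 1 - T)) has_integral P) {0..2 * pi})"

definition rank_one :: "'a :: complex_normed_vector cbop \<Rightarrow> bool"
  where "rank_one P \<longleftrightarrow> (\<exists>v. v \<noteq> 0 \<and> range (cbop_apply P) = range (\<lambda>a. a *\<^sub>C v))"

definition simple_isolated_eigenvalue :: "'a :: complex_normed_vector cbop \<Rightarrow> complex \<Rightarrow> bool"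
  where "simple_isolated_eigenvalue T l \<longleftrightarrow>
    l isolated_in spectrum T \<and> (\<exists>P. spectral_projection T l P \<and> rank_one P)"

text \<open>Sequences of operators are indexed from \<open>1\<close>; the entry at \<open>0\<close> is never used.\<close>

definition op_series :: "(nat \<Rightarrow> 'a :: complex_banach cbop) \<Rightarrow> complex \<Rightarrow> 'a cbop"
  where "op_series R z = (\<Sum>n. z ^ Suc n *\<^sub>C R (Suc n))"

definition op_series_deriv_1 :: "(nat \<Rightarrow> 'a :: complex_banach cbop) \<Rightarrow> 'a cbop"
  where "op_series_deriv_1 R = (\<Sum>n. real (Suc n) *\<^sub>R R (Suc n))"

text \<open>The eigenvalue of \<open>T\<close> at distance less than \<open>\<eta>\<close> from \<open>l\<close>, meaningful only if there is
  exactly one.\<close>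

definition eigenvalue_near :: "real \<Rightarrow> complex \<Rightarrow> 'a :: complex_normed_vector cbop \<Rightarrow> complex"
  where "eigenvalue_near \<eta> l T = (THE w. eigenvalue T w \<and> dist w l < \<eta>)"

text \<open>\<open>\<Lambda> z t\<close> is the eigenvalue of \<open>F z t\<close> close to \<open>1\<close>, for \<open>z\<close> close to \<open>1\<close> in the closed unit
  disc and \<open>t\<close> close to \<open>0\<close>. For every small enough neighbourhood of \<open>1\<close>, it is the eigenvalue in
  this neighbourhood as soon as \<open>(z, t)\<close> is close enough to \<open>(1, 0)\<close>. That there is exactly one
  such eigenvalue is not part of the definition.\<close>

definition perturbed_eigenvalue ::
    "(complex \<Rightarrow> real \<Rightarrow> 'a :: complex_normed_vector cbop) \<Rightarrow> (complex \<Rightarrow> real \<Rightarrow> complex) \<Rightarrow> bool"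
  where "perturbed_eigenvalue F \<Lambda> \<longleftrightarrow>
    (\<exists>\<eta>\<^sub>0>0. \<forall>\<eta>. 0 < \<eta> \<and> \<eta> < \<eta>\<^sub>0 \<longrightarrow>
      (\<exists>d>0. \<forall>z t. cmod z \<le> 1 \<and> cmod (z - 1) < d \<and> \<bar>t\<bar> < d \<longrightarrow>
        \<Lambda> z t = eigenvalue_near \<eta> 1 (F z t)))"

end

theory Submission
  imports Defs "HOL-Computational_Algebra.Polynomial_FPS"
begin

text \<open>
  Write \<open>A\<^sub>t = I - R(z, t)\<close> as a power series in \<open>z\<close>; its formal inverse has the coefficients \<open>T\<^sub>n\<^sub>,\<^sub>t\<close>. With
  \<open>q = 1 - c M(\<bar>t\<bar>) / \<mu>\<close> the claim follows once the series \<open>D\<^sub>t = (1 - q z) A\<^sub>t\<^sup>-\<^sup>1\<close> is known to converge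
  to \<open>D\<^sub>0\<close>, as \<open>t \<rightarrow> 0\<close>, in the norm of absolutely summable coefficients: then
  \<open>T\<^sub>n\<^sub>,\<^sub>t = \<Sum>\<^sub>k\<^sub>\<le>\<^sub>n q\<^sup>n\<^sup>-\<^sup>k D\<^sub>t\<^sub>,\<^sub>k\<close> is close to \<open>q\<^sup>n D\<^sub>0(1) = q\<^sup>n P / \<mu>\<close> (lemma \<open>geometric_convolution_asymptotics\<close>).

  To invert \<open>A\<^sub>t\<close> up to the factor \<open>1 - q z\<close>, let \<open>E\<^sub>t\<close> be an operator close to \<open>P\<close> that maps into the eigenspace of
  \<open>R(1, t)\<close> for \<open>\<lambda>(1, t)\<close>, let \<open>Q = I - P\<close>, let \<open>S\<close> be the inverse of \<open>I - R(1)\<close> on the range of \<open>Q\<close>, and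
  \<open>Y = S R'(1)\<close>. The factor \<open>J\<^sub>t = (1 - q z) Q + (1 - (1 - z) Y) E\<^sub>t\<close> satisfies \<open>A\<^sub>t J\<^sub>t = (1 - q z) B\<^sub>t\<close> with a
  summable series \<open>B\<^sub>t\<close> (lemma \<open>renewal_factorization\<close>). The correction by \<open>Y\<close> is what makes \<open>B\<^sub>t \<rightarrow> B\<^sub>0\<close> in norm:
  it removes the part \<open>Q R'(1) P\<close> of the value at \<open>1\<close>, which otherwise would be multiplied by
  \<open>(1 - z) / (1 - q z)\<close>, a bounded family that does not converge in norm (lemma \<open>geometric_quotient_tendsto\<close>).

  The values of \<open>B\<^sub>0\<close> are invertible on the closed disc, at \<open>z = 1\<close> because \<open>P R'(1) P = \<mu> P\<close> with
  \<open>\<mu> > 0\<close>. By the operator-valued form of Wiener's lemma, \<open>B\<^sub>0\<close> has a summable inverse \<open>g\<close>; hence \<open>J\<^sub>t g\<close>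
  approximates \<open>D\<^sub>t\<close> (lemma \<open>approximate_factor_inverse\<close>), and \<open>D\<^sub>0 = J\<^sub>0 g\<close>.

  Wiener's lemma is proved through a lower bound \<open>c \<parallel>g\<parallel> \<le> \<parallel>f g\<parallel>\<close>: every cyclic subspace of the shift contains
  approximate eigenvectors, and on such a vector \<open>f\<close> acts nearly as one of its values, which is invertible.
\<close>

section \<open>Complex scalars in the algebra of bounded operators\<close>

lemma cbop_eqI: "(\<And>x. cbop_apply S x = cbop_apply T x) \<Longrightarrow> S = T"
  by transfer (rule blinfun_eqI)

lemma cbop_apply_scaleC_right: "cbop_apply T (a *\<^sub>C x) = a *\<^sub>C cbop_apply T x"
  by transfer simp

lemma cbop_apply_zero_right: "cbop_apply T 0 = 0"
  by transfer (simp add: blinfun.zero_right)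

lemma scaleC_zero_left [simp]: "0 *\<^sub>C (x :: 'a :: complex_normed_vector) = 0"
  using scaleR_scaleC[of 0 x] by simp

lemma scaleC_one [simp]: "1 *\<^sub>C (x :: 'a :: complex_normed_vector) = x"
  using scaleR_scaleC[of 1 x] by simp

lemma scaleC_minus_left: "(- a) *\<^sub>C (x :: 'a :: complex_normed_vector) = - (a *\<^sub>C x)"
  using scaleC_add_left[of a "- a" x] by (simp add: add_eq_0_iff)

lemma scaleC_diff_left: "(a - b) *\<^sub>C (x :: 'a :: complex_normed_vector) = a *\<^sub>C x - b *\<^sub>C x"
  using scaleC_add_left[of a "- b" x] by (simp add: scaleC_minus_left)

lemma scaleC_eq_0_iff [simp]: "a *\<^sub>C (x :: 'a :: complex_normed_vector) = 0 \<longleftrightarrow> a = 0 \<or> x = 0"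
  using norm_scaleC[of a x] by (metis mult_eq_0_iff norm_eq_zero)

lemma scaleC_sum_right:
  "a *\<^sub>C (\<Sum>i\<in>I. f i) = (\<Sum>i\<in>I. a *\<^sub>C (f i :: 'a :: complex_normed_vector))"
  by (rule linear_sum[OF bounded_linear.linear[OF bounded_linear_scaleC]])

lemma scaleC_sum_left:
  "(\<Sum>i\<in>I. f i) *\<^sub>C (x :: 'a :: complex_normed_vector) = (\<Sum>i\<in>I. f i *\<^sub>C x)"
  by (induction I rule: infinite_finite_induct) (simp_all add: scaleC_add_left)

lemma scaleC_mult_left:
  "(a *\<^sub>C S) * T = a *\<^sub>C (S * (T :: 'a :: complex_normed_vector cbop))"
  by (rule cbop_eqI) (simp add: cbop_apply_simps)

lemma scaleC_mult_right:
  "S * (a *\<^sub>C T) = a *\<^sub>C (S * (T :: 'a :: complex_normed_vector cbop))"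
  by (rule cbop_eqI) (simp add: cbop_apply_simps cbop_apply_scaleC_right)

lemma norm_one_cbop_le: "norm (1 :: 'a :: complex_normed_vector cbop) \<le> 1"
  by transfer (rule norm_blinfun_id_le)

lemma bounded_bilinear_scaleC:
  "bounded_bilinear (\<lambda>(a :: complex) (x :: 'a :: complex_normed_vector). a *\<^sub>C x)"
proof
  show "\<exists>K. \<forall>a (b :: 'a). norm (a *\<^sub>C b) \<le> norm a * norm b * K"
    by (rule exI[of _ 1]) (simp add: norm_scaleC)
  show "(r *\<^sub>R a) *\<^sub>C b = r *\<^sub>R (a *\<^sub>C b)" for r a and b :: 'a
    by (simp only: scaleR_scaleC[of r "a *\<^sub>C b"] scaleC_scaleC scaleR_conv_of_real)
qed (simp_all add: scaleC_add_left scaleC_add_right scaleC_scaleR_commute)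

lemmas tendsto_scaleC = bounded_bilinear.tendsto[OF bounded_bilinear_scaleC]
  and continuous_on_scaleC = bounded_bilinear.continuous_on[OF bounded_bilinear_scaleC]

section \<open>Invertible operators\<close>

lemma cbop_inv_eqI: "A * B = 1 \<Longrightarrow> B * A = 1 \<Longrightarrow> cbop_inv A = B"
  unfolding cbop_inv_def by (rule the_equality) (auto, metis mult.assoc mult_1 mult_1_right)

lemma cbop_invertibleI: "A * B = 1 \<Longrightarrow> B * A = 1 \<Longrightarrow> cbop_invertible A"
  unfolding cbop_invertible_def by blast

lemma cbop_inv_right: "cbop_invertible A \<Longrightarrow> A * cbop_inv A = 1"
  and cbop_inv_left: "cbop_invertible A \<Longrightarrow> cbop_inv A * A = 1"
  unfolding cbop_invertible_def using cbop_inv_eqI by metis+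

lemma cbop_invertible_mult:
  assumes "cbop_invertible A" "cbop_invertible B"
  shows "cbop_invertible (A * B)"
proof (rule cbop_invertibleI)
  have "A * B * (cbop_inv B * cbop_inv A) = A * (B * cbop_inv B) * cbop_inv A"
    by (simp only: mult.assoc)
  then show "A * B * (cbop_inv B * cbop_inv A) = 1" using assms by (simp add: cbop_inv_right)
  have "cbop_inv B * cbop_inv A * (A * B) = cbop_inv B * (cbop_inv A * A) * B"
    by (simp only: mult.assoc)
  then show "cbop_inv B * cbop_inv A * (A * B) = 1" using assms by (simp add: cbop_inv_left)
qed

lemma cbop_invertible_scaleC:
  assumes "cbop_invertible A" "a \<noteq> 0"
  shows "cbop_invertible (a *\<^sub>C A)"
  by (rule cbop_invertibleI[of _ "inverse a *\<^sub>C cbop_inv A"])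
    (use assms in \<open>simp_all add: scaleC_mult_left scaleC_mult_right scaleC_scaleC cbop_inv_left
      cbop_inv_right\<close>)

lemma Neumann_series:
  fixes X :: "'a :: complex_banach cbop"
  assumes X: "norm X \<le> 1 / 2"
  shows "cbop_invertible (1 - X)"
proof -
  have le: "norm (X ^ n) \<le> (1 / 2) ^ n" for n
  proof (induction n)
    case (Suc n)
    have "norm (X * X ^ n) \<le> norm X * norm (X ^ n)" by (rule norm_mult_ineq)
    also have "\<dots> \<le> 1 / 2 * (1 / 2) ^ n" using X Suc by (intro mult_mono) auto
    finally show ?case by simp
  qed (simp add: norm_one_cbop_le)
  have summ: "summable (\<lambda>n. X ^ n)"
    by (rule summable_comparison_test'[of "\<lambda>n. (1 / 2 :: real) ^ n"]) (use le in auto)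
  let ?S = "\<Sum>n. X ^ n"
  have split: "?S = 1 + (\<Sum>n. X ^ Suc n)" using suminf_split_head[OF summ] by simp
  have 1: "(\<Sum>n. X ^ Suc n) = X * ?S"
    using bounded_linear.suminf[OF bounded_linear_mult_right summ, of X] by simp
  have 2: "(\<Sum>n. X ^ Suc n) = ?S * X"
    using bounded_linear.suminf[OF bounded_linear_mult_left summ, of X] by (simp add: power_commutes)
  have "(1 - X) * ?S = ?S - X * ?S" "?S * (1 - X) = ?S - ?S * X"
    by (simp_all add: left_diff_distrib right_diff_distrib)
  then show ?thesis
    using split 1 2 by (intro cbop_invertibleI[of _ ?S]) (metis add_diff_cancel_right')+
qed

text \<open>Inverses of two invertible elements differ by \<open>A\<^sup>-\<^sup>1 (A - A') A'\<^sup>-\<^sup>1\<close>; estimating this identity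
  in terms of \<open>A\<^sup>-\<^sup>1\<close> alone gives both bounds.\<close>

lemma cbop_invertible_perturb:
  fixes A A' B :: "'a :: complex_banach cbop"
  assumes AB: "A * B = 1" and BA: "B * A = 1" and small: "norm (A' - A) * norm B \<le> 1 / 2"
  shows "cbop_invertible A'"
    and "norm (cbop_inv A') \<le> 2 * norm B"
    and "norm (cbop_inv A' - B) \<le> 2 * (norm B)\<^sup>2 * norm (A' - A)"
proof -
  have "norm (B * (A - A')) \<le> norm B * norm (A - A')" by (rule norm_mult_ineq)
  also have "\<dots> \<le> 1 / 2" using small by (simp add: norm_minus_commute mult.commute)
  finally have "cbop_invertible (1 - B * (A - A'))" by (rule Neumann_series)
  then have "cbop_invertible (A * (1 - B * (A - A')))"
    by (rule cbop_invertible_mult[OF cbop_invertibleI[OF AB BA]])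
  moreover have "A * (1 - B * (A - A')) = A'"
  proof -
    have "A * (1 - B * (A - A')) = A - (A * B) * (A - A')" by (simp add: algebra_simps)
    then show ?thesis by (simp add: AB)
  qed
  ultimately show inv: "cbop_invertible A'" by simp
  let ?I = "cbop_inv A'"
  have diff: "?I - B = B * (A - A') * ?I"
  proof -
    have "B * (A - A') * ?I = (B * A) * ?I - B * (A' * ?I)" by (simp add: algebra_simps)
    then show ?thesis by (simp add: BA cbop_inv_right[OF inv])
  qed
  have le: "norm (?I - B) \<le> norm B * norm (A' - A) * norm ?I"
    unfolding diff by (intro order.trans[OF norm_mult_ineq] mult_right_mono)
      (auto intro!: order.trans[OF norm_mult_ineq] simp: norm_minus_commute)
  also have "\<dots> \<le> 1 / 2 * norm ?I"
    using small by (intro mult_right_mono) (simp_all add: mult.commute)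
  finally show le2: "norm ?I \<le> 2 * norm B"
    using norm_triangle_ineq2[of ?I B] by simp
  have "norm B * norm (A' - A) * norm ?I \<le> norm B * norm (A' - A) * (2 * norm B)"
    using le2 by (intro mult_left_mono) auto
  with le show "norm (?I - B) \<le> 2 * (norm B)\<^sup>2 * norm (A' - A)"
    by (simp add: power2_eq_square mult_ac)
qed

lemma tendsto_cbop_inv:
  fixes f :: "'b \<Rightarrow> 'a :: complex_banach cbop"
  assumes f: "(f \<longlongrightarrow> A) F" and A: "cbop_invertible A"
  shows "((\<lambda>x. cbop_inv (f x)) \<longlongrightarrow> cbop_inv A) F"
proof -
  let ?B = "cbop_inv A"
  have n: "((\<lambda>x. norm (f x - A)) \<longlongrightarrow> 0) F" using f by (simp add: LIM_zero tendsto_norm_zero)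
  then have "((\<lambda>x. norm (f x - A) * norm ?B) \<longlongrightarrow> 0) F"
    by (rule tendsto_mult_left_zero)
  then have ev: "\<forall>\<^sub>F x in F. norm (f x - A) * norm ?B < 1 / 2" by (rule order_tendstoD) simp
  have "((\<lambda>x. cbop_inv (f x) - ?B) \<longlongrightarrow> 0) F"
  proof (rule Lim_null_comparison)
    show "\<forall>\<^sub>F x in F. norm (cbop_inv (f x) - ?B) \<le> 2 * (norm ?B)\<^sup>2 * norm (f x - A)"
      using ev by eventually_elim
        (intro cbop_invertible_perturb(3)[OF cbop_inv_right[OF A] cbop_inv_left[OF A]], simp)
    show "((\<lambda>x. 2 * (norm ?B)\<^sup>2 * norm (f x - A)) \<longlongrightarrow> 0) F"
      using tendsto_mult_right_zero[OF n, of "2 * (norm ?B)\<^sup>2"] by simp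
  qed
  then show ?thesis by (rule LIM_zero_cancel)
qed

lemma continuous_on_cbop_inv:
  fixes f :: "'b :: topological_space \<Rightarrow> 'a :: complex_banach cbop"
  assumes "continuous_on S f" "\<And>x. x \<in> S \<Longrightarrow> cbop_invertible (f x)"
  shows "continuous_on S (\<lambda>x. cbop_inv (f x))"
  using assms unfolding continuous_on_def by (auto intro: tendsto_cbop_inv)

section \<open>The spectral projection of a simple isolated eigenvalue\<close>

lemma not_in_spectrum_iff: "z \<notin> spectrum T \<longleftrightarrow> cbop_invertible (z *\<^sub>C 1 - T)"
  by (simp add: spectrum_def)

abbreviation resolvent :: "'a :: complex_normed_vector cbop \<Rightarrow> complex \<Rightarrow> 'a cbop"
  where "resolvent T z \<equiv> cbop_inv (z *\<^sub>C 1 - T)"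

lemma continuous_on_resolvent:
  fixes T :: "'a :: complex_banach cbop"
  assumes "S \<inter> spectrum T = {}"
  shows "continuous_on S (resolvent T)"
  by (intro continuous_on_cbop_inv continuous_on_diff continuous_on_scaleC continuous_intros)
    (use assms in \<open>auto simp flip: not_in_spectrum_iff\<close>)

lemma resolvent_diff:
  assumes "cbop_invertible (z *\<^sub>C 1 - T)" "cbop_invertible (w *\<^sub>C 1 - T)"
  shows "resolvent T w - resolvent T z = (z - w) *\<^sub>C (resolvent T w * resolvent T z)"
proof -
  let ?z = "resolvent T z" and ?w = "resolvent T w"
  have "(z - w) *\<^sub>C (?w * ?z) = ?w * ((z *\<^sub>C 1 - T) - (w *\<^sub>C 1 - T)) * ?z"
    by (simp add: left_diff_distrib right_diff_distrib scaleC_mult_left scaleC_mult_right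
        scaleC_diff_left)
  also have "\<dots> = ?w * ((z *\<^sub>C 1 - T) * ?z) - (?w * (w *\<^sub>C 1 - T)) * ?z"
    by (simp only: left_diff_distrib right_diff_distrib mult.assoc)
  also have "\<dots> = ?w - ?z"
    by (simp only: cbop_inv_left[OF assms(2)] cbop_inv_right[OF assms(1)]) simp
  finally show ?thesis by simp
qed

lemma resolvent_has_derivative:
  fixes T :: "'a :: complex_banach cbop"
  assumes z: "z \<notin> spectrum T"
  shows "(resolvent T has_derivative (\<lambda>k. k *\<^sub>C (- (resolvent T z * resolvent T z)))) (at z)"
  unfolding has_derivative_at
proof
  show "bounded_linear (\<lambda>k. k *\<^sub>C (- (resolvent T z * resolvent T z)))"
    by (rule bounded_bilinear.bounded_linear_left[OF bounded_bilinear_scaleC])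
  let ?R = "resolvent T"
  have inv: "cbop_invertible (z *\<^sub>C 1 - T)" using z by (simp add: not_in_spectrum_iff)
  have lim: "((\<lambda>k. (z + k) *\<^sub>C 1 - T) \<longlongrightarrow> z *\<^sub>C 1 - T) (at 0)"
    by (rule tendsto_eq_intros tendsto_scaleC refl | simp)+
  then have Rlim: "((\<lambda>k. ?R (z + k)) \<longlongrightarrow> ?R z) (at 0)" by (rule tendsto_cbop_inv[OF _ inv])
  have "((\<lambda>k. norm ((z + k) *\<^sub>C 1 - T - (z *\<^sub>C 1 - T)) * norm (?R z)) \<longlongrightarrow> 0) (at 0)"
    using lim by (intro tendsto_mult_left_zero tendsto_norm_zero LIM_zero)
  then have "\<forall>\<^sub>F k in at 0. norm ((z + k) *\<^sub>C 1 - T - (z *\<^sub>C 1 - T)) * norm (?R z) < 1 / 2"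
    by (rule order_tendstoD) simp
  then have evinv: "\<forall>\<^sub>F k in at 0. cbop_invertible ((z + k) *\<^sub>C 1 - T)"
    by eventually_elim
      (intro cbop_invertible_perturb(1)[OF cbop_inv_right[OF inv] cbop_inv_left[OF inv]], simp)
  show "(\<lambda>k. norm (?R (z + k) - ?R z - k *\<^sub>C - (?R z * ?R z)) / norm k) \<midarrow>0\<rightarrow> 0"
  proof (rule Lim_null_comparison)
    show "\<forall>\<^sub>F k in at 0. norm (norm (?R (z + k) - ?R z - k *\<^sub>C - (?R z * ?R z)) / norm k)
        \<le> norm (?R (z + k) - ?R z) * norm (?R z)"
      using evinv eventually_at_ball'[of 1 0 UNIV, simplified]
    proof eventually_elim
      case (elim k)
      have "?R (z + k) - ?R z = (- k) *\<^sub>C (?R (z + k) * ?R z)"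
        using resolvent_diff[OF inv elim(1)] by simp
      then have "?R (z + k) - ?R z - k *\<^sub>C - (?R z * ?R z)
          = (- k) *\<^sub>C (?R (z + k) * ?R z) + k *\<^sub>C (?R z * ?R z)"
        by (simp only: scaleC_minus_right diff_minus_eq_add)
      also have "\<dots> = (- k) *\<^sub>C ((?R (z + k) - ?R z) * ?R z)"
        by (simp add: left_diff_distrib[of _ _ "?R z"] scaleC_diff_right scaleC_minus_left)
      finally have "?R (z + k) - ?R z - k *\<^sub>C - (?R z * ?R z)
          = (- k) *\<^sub>C ((?R (z + k) - ?R z) * ?R z)" .
      then show ?case
        using norm_mult_ineq[of "?R (z + k) - ?R z" "?R z"] elim(2)
        by (simp add: norm_scaleC)
    qed
    show "((\<lambda>k. norm (?R (z + k) - ?R z) * norm (?R z)) \<longlongrightarrow> 0) (at 0)"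
      using Rlim by (intro tendsto_mult_left_zero tendsto_norm_zero LIM_zero)
  qed
qed

lemma has_vector_derivative_compose_scaleC:
  fixes F :: "complex \<Rightarrow> 'a :: complex_banach"
  assumes F: "(F has_derivative (\<lambda>k. k *\<^sub>C D)) (at (g s))"
    and g: "(g has_vector_derivative v) (at s within U)"
  shows "((\<lambda>s. F (g s)) has_vector_derivative v *\<^sub>C D) (at s within U)"
proof -
  have "((\<lambda>s. F (g s)) has_derivative (\<lambda>h. (h *\<^sub>R v) *\<^sub>C D)) (at s within U)"
    using has_derivative_compose[OF g[unfolded has_vector_derivative_def] F] .
  then show ?thesis
    unfolding has_vector_derivative_def
    by (simp add: bounded_bilinear.scaleR_left[OF bounded_bilinear_scaleC])
qed

text \<open>With \<open>\<Psi> u = u (l + u - T)\<^sup>-\<^sup>1\<close>, the spectral projection is the mean of \<open>\<Psi>\<close> over the circle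
  \<open>\<bar>u\<bar> = s\<close>. The radial and angular derivatives of the complex differentiable \<open>\<Psi>\<close> satisfy
  \<open>\<partial>\<^sub>\<theta> = i s \<partial>\<^sub>s\<close>, and the integral of \<open>\<partial>\<^sub>\<theta> \<Psi>\<close> over a full turn vanishes. So the mean does not
  depend on \<open>s\<close>.\<close>

lemma resolvent_mean_constant:
  fixes T :: "'a :: complex_banach cbop" and l :: complex
  defines "f \<equiv> \<lambda>s \<theta>. (of_real s * cis \<theta>) *\<^sub>C resolvent T (l + of_real s * cis \<theta>)"
  assumes ab: "0 < a" "a \<le> b" and spec: "spectrum T \<inter> cball l b \<subseteq> {l}"
  shows "integral {0..2 * pi} (f a) = integral {0..2 * pi} (f b)"
proof -
  let ?R = "\<lambda>u. resolvent T (l + u)"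
  define \<Psi> where "\<Psi> u = u *\<^sub>C ?R u" for u
  define \<Psi>' where "\<Psi>' u = ?R u - u *\<^sub>C (?R u * ?R u)" for u
  let ?g = "\<lambda>s \<theta>. of_real s * cis \<theta>"
  let ?U = "cball 0 b - {0 :: complex}"
  have gU: "?g s \<theta> \<in> ?U" if "s \<in> {a..b}" for s \<theta>
    using that ab by (simp add: norm_mult)
  have notin: "l + u \<notin> spectrum T" if "u \<in> ?U" for u
    using spec that by (auto simp: dist_norm)
  have "(\<lambda>u. l + u) ` ?U \<inter> spectrum T = {}" using notin by blast
  then have contR: "continuous_on ?U ?R"
    by (intro continuous_on_compose2[OF continuous_on_resolvent] continuous_intros) auto
  have d\<Psi>: "(\<Psi> has_derivative (\<lambda>k. k *\<^sub>C \<Psi>' u)) (at u)" if "u \<in> ?U" for u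
  proof -
    have "(?R has_derivative (\<lambda>k. k *\<^sub>C (- (?R u * ?R u)))) (at u)"
      by (rule has_derivative_compose[where f = "\<lambda>u. l + u" and g = "resolvent T" and f' = "\<lambda>k. k"])
        (auto intro!: derivative_eq_intros resolvent_has_derivative[OF notin[OF that]])
    from bounded_bilinear.FDERIV[OF bounded_bilinear_scaleC has_derivative_ident this]
    show ?thesis
      unfolding \<Psi>_def \<Psi>'_def
      by (simp add: scaleC_diff_right scaleC_scaleC scaleC_minus_right mult.commute)
  qed
  have ds: "((\<lambda>s. f s \<theta>) has_vector_derivative cis \<theta> *\<^sub>C \<Psi>' (?g s \<theta>)) (at s within {a..b})"
    if "s \<in> {a..b}" for s \<theta>
    unfolding f_def \<Psi>_def[symmetric]
  proof (rule has_vector_derivative_compose_scaleC[where F = \<Psi> and g = "\<lambda>s. ?g s \<theta>"])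
    show "(\<Psi> has_derivative (\<lambda>k. k *\<^sub>C \<Psi>' (?g s \<theta>))) (at (?g s \<theta>))"
      by (rule d\<Psi>[OF gU[OF that]])
    show "((\<lambda>s. ?g s \<theta>) has_vector_derivative cis \<theta>) (at s within {a..b})"
      unfolding has_vector_derivative_def
      by (auto intro!: derivative_eq_intros simp: scaleR_conv_of_real)
  qed
  have d\<theta>: "(f s has_vector_derivative (\<i> * ?g s \<theta>) *\<^sub>C \<Psi>' (?g s \<theta>)) (at \<theta> within {0..2 * pi})"
    if "s \<in> {a..b}" for s \<theta>
    unfolding f_def \<Psi>_def[symmetric]
  proof (rule has_vector_derivative_compose_scaleC[where F = \<Psi> and g = "\<lambda>\<theta>. ?g s \<theta>"])
    show "(\<Psi> has_derivative (\<lambda>k. k *\<^sub>C \<Psi>' (?g s \<theta>))) (at (?g s \<theta>))"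
      by (rule d\<Psi>[OF gU[OF that]])
    show "((\<lambda>\<theta>. ?g s \<theta>) has_vector_derivative \<i> * ?g s \<theta>) (at \<theta> within {0..2 * pi})"
      unfolding has_vector_derivative_def
      by (auto intro!: derivative_eq_intros simp: scaleR_conv_of_real)
  qed
  have contf: "continuous_on {0..2 * pi} (f s)" if "s \<in> {a..b}" for s
    using d\<theta>[OF that] by (meson continuous_on_eq_continuous_within has_vector_derivative_continuous)
  have "((\<lambda>s. integral (cbox 0 (2 * pi)) (f s)) has_derivative (\<lambda>h. 0)) (at s within {a..b})"
    if s: "s \<in> {a..b}" for s
  proof -
    have "continuous_on ({a..b} \<times> cbox 0 (2 * pi)) (\<lambda>x. cis (snd x) *\<^sub>C \<Psi>' (?g (fst x) (snd x)))"
    proof -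
      have g: "continuous_on ({a..b} \<times> cbox 0 (2 * pi)) (\<lambda>x. ?g (fst x) (snd x))"
        by (intro continuous_intros)
      have "continuous_on ({a..b} \<times> cbox 0 (2 * pi)) (\<lambda>x. ?R (?g (fst x) (snd x)))"
        by (rule continuous_on_compose2[OF contR g]) (use gU in auto)
      then show ?thesis
        unfolding \<Psi>'_def
        by (intro continuous_on_scaleC continuous_on_diff continuous_on_mult g) (intro continuous_intros)+
    qed
    then have leib: "((\<lambda>s. integral (cbox 0 (2 * pi)) (f s)) has_vector_derivative
        integral (cbox 0 (2 * pi)) (\<lambda>\<theta>. cis \<theta> *\<^sub>C \<Psi>' (?g s \<theta>))) (at s within {a..b})"
      using s ds contf
      by (intro leibniz_rule_vector_derivative)
        (auto simp: split_beta intro!: integrable_continuous_real)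
    have "((\<lambda>\<theta>. (\<i> * ?g s \<theta>) *\<^sub>C \<Psi>' (?g s \<theta>)) has_integral (f s (2 * pi) - f s 0)) {0..2 * pi}"
      by (intro fundamental_theorem_of_calculus d\<theta> s) auto
    then have "((\<lambda>\<theta>. (\<i> * ?g s \<theta>) *\<^sub>C \<Psi>' (?g s \<theta>)) has_integral 0) {0..2 * pi}"
      by (simp add: f_def)
    from has_integral_linear[OF this bounded_linear_scaleC[of "inverse (\<i> * of_real s)"]]
    have "((\<lambda>\<theta>. cis \<theta> *\<^sub>C \<Psi>' (?g s \<theta>)) has_integral 0) {0..2 * pi}"
      using s ab by (simp add: o_def scaleC_scaleC scaleC_zero_right field_simps)
    then have "integral (cbox 0 (2 * pi)) (\<lambda>\<theta>. cis \<theta> *\<^sub>C \<Psi>' (?g s \<theta>)) = 0"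
      by (simp add: integral_unique)
    then show ?thesis using leib by (simp add: has_vector_derivative_def)
  qed
  then obtain k where "\<And>s. s \<in> {a..b} \<Longrightarrow> integral (cbox 0 (2 * pi)) (f s) = k"
    using has_derivative_zero_constant[of "{a..b}" "\<lambda>s. integral (cbox 0 (2 * pi)) (f s)"] by auto
  then show ?thesis using ab by (metis atLeastAtMost_iff box_real(2) order_refl)
qed

lemma spectral_projection_unique:
  fixes T :: "'a :: complex_banach cbop"
  assumes "spectral_projection T l P" "spectral_projection T l P'"
  shows "P = P'"
proof -
  let ?f = "\<lambda>s \<theta>. (of_real s * cis \<theta>) *\<^sub>C resolvent T (l + of_real s * cis \<theta>)"
  have *: "\<exists>s>0. spectrum T \<inter> cball l s = {l} \<and> P = (1 / (2 * pi)) *\<^sub>R integral {0..2 * pi} (?f s)"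
    if P: "spectral_projection T l P" for P
  proof -
    obtain s where s: "s > 0" "spectrum T \<inter> cball l s = {l}"
      and i: "((\<lambda>\<theta>. (of_real (s / (2 * pi)) * cis \<theta>) *\<^sub>C
              resolvent T (l + of_real s * cis \<theta>)) has_integral P) {0..2 * pi}"
      using P unfolding spectral_projection_def by blast
    have "(of_real (s / (2 * pi)) * cis \<theta>) *\<^sub>C X
        = (1 / (2 * pi)) *\<^sub>R ((of_real s * cis \<theta>) *\<^sub>C X)" for \<theta> and X :: "'a cbop"
      unfolding scaleR_scaleC[of _ "_ *\<^sub>C X"] scaleC_scaleC by simp
    then have "((\<lambda>\<theta>. (1 / (2 * pi)) *\<^sub>R ?f s \<theta>) has_integral P) {0..2 * pi}"
      using i by simp
    then have "integral {0..2 * pi} (\<lambda>\<theta>. (1 / (2 * pi)) *\<^sub>R ?f s \<theta>) = P"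
      by (rule integral_unique)
    then have "P = (1 / (2 * pi)) *\<^sub>R integral {0..2 * pi} (?f s)"
      by (simp only: integral_cmul)
    with s show ?thesis by blast
  qed
  obtain a b where a: "a > 0" "spectrum T \<inter> cball l a = {l}"
      "P = (1 / (2 * pi)) *\<^sub>R integral {0..2 * pi} (?f a)"
    and b: "b > 0" "spectrum T \<inter> cball l b = {l}"
      "P' = (1 / (2 * pi)) *\<^sub>R integral {0..2 * pi} (?f b)"
    using *[OF assms(1)] *[OF assms(2)] by blast
  show ?thesis
  proof (cases "a \<le> b")
    case True
    then have "integral {0..2 * pi} (?f a) = integral {0..2 * pi} (?f b)"
      using a b by (intro resolvent_mean_constant) auto
    then show ?thesis using a(3) b(3) by metis
  next
    case False
    then have "integral {0..2 * pi} (?f b) = integral {0..2 * pi} (?f a)"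
      using a b by (intro resolvent_mean_constant) auto
    then show ?thesis using a(3) b(3) by metis
  qed
qed

text \<open>The reduced resolvent is the mean of the resolvent itself over the circle: since
  \<open>A (u + A)\<^sup>-\<^sup>1 = 1 - u (u + A)\<^sup>-\<^sup>1\<close> for \<open>A = l - T\<close>, its product with \<open>A\<close> is \<open>1 - P\<close>.\<close>

lemma reduced_resolvent_exists:
  fixes T :: "'a :: complex_banach cbop"
  assumes P: "spectral_projection T l P"
  shows "\<exists>S. (l *\<^sub>C 1 - T) * S = 1 - P \<and> S * (l *\<^sub>C 1 - T) = 1 - P"
proof -
  let ?A = "l *\<^sub>C 1 - T"
  obtain s where s: "s > 0" "spectrum T \<inter> cball l s = {l}"
    and i: "((\<lambda>\<theta>. (of_real (s / (2 * pi)) * cis \<theta>) *\<^sub>C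
            resolvent T (l + of_real s * cis \<theta>)) has_integral P) {0..2 * pi}"
    using P unfolding spectral_projection_def by blast
  let ?u = "\<lambda>\<theta>. of_real s * cis \<theta>" and ?R = "\<lambda>\<theta>. resolvent T (l + of_real s * cis \<theta>)"
  have notin: "l + ?u \<theta> \<notin> spectrum T" for \<theta>
  proof
    assume "l + ?u \<theta> \<in> spectrum T"
    moreover have "l + ?u \<theta> \<in> cball l s" using s by (simp add: dist_norm norm_mult)
    ultimately have "l + ?u \<theta> = l" using s by blast
    then show False using s by simp
  qed
  then have inv: "cbop_invertible ((l + ?u \<theta>) *\<^sub>C 1 - T)" for \<theta>
    by (simp flip: not_in_spectrum_iff)
  let ?G = "\<lambda>\<theta>. (1 / (2 * pi)) *\<^sub>R ?R \<theta>"
  have "range (\<lambda>\<theta>. l + ?u \<theta>) \<inter> spectrum T = {}" using notin by blast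
  then have "continuous_on {0..2 * pi} ?R"
    by (intro continuous_on_compose2[OF continuous_on_resolvent] continuous_intros) auto
  then have "continuous_on {0..2 * pi} ?G" by (intro continuous_intros)
  then obtain S where S: "(?G has_integral S) {0..2 * pi}"
    using integrable_continuous_real by blast
  have A_eq: "?A = ((l + ?u \<theta>) *\<^sub>C 1 - T) - ?u \<theta> *\<^sub>C 1" for \<theta>
    by (simp add: scaleC_add_left)
  have AR: "?A * ?R \<theta> = 1 - ?u \<theta> *\<^sub>C ?R \<theta>" for \<theta>
    unfolding A_eq[of \<theta>]
    by (subst left_diff_distrib, subst cbop_inv_right[OF inv[of \<theta>]]) (simp add: scaleC_mult_left)
  have RA: "?R \<theta> * ?A = 1 - ?u \<theta> *\<^sub>C ?R \<theta>" for \<theta>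
    unfolding A_eq[of \<theta>]
    by (subst right_diff_distrib, subst cbop_inv_left[OF inv[of \<theta>]]) (simp add: scaleC_mult_right)
  have "((\<lambda>\<theta>. (1 / (2 * pi)) *\<^sub>R (1 :: 'a cbop)) has_integral 1) {0..2 * pi}"
    using has_integral_const_real[of "(1 / (2 * pi)) *\<^sub>R (1 :: 'a cbop)" 0 "2 * pi"] by simp
  from has_integral_diff[OF this i]
  have "((\<lambda>\<theta>. (1 / (2 * pi)) *\<^sub>R (1 - ?u \<theta> *\<^sub>C ?R \<theta>)) has_integral 1 - P) {0..2 * pi}"
    unfolding scaleR_diff_right scaleR_scaleC[of _ "_ *\<^sub>C _"] scaleC_scaleC by simp
  note lim = this
  have "((\<lambda>\<theta>. ?A * ?G \<theta>) has_integral ?A * S) {0..2 * pi}"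
    using has_integral_linear[OF S bounded_linear_mult_right[of ?A]] by (simp only: o_def)
  then have "((\<lambda>\<theta>. (1 / (2 * pi)) *\<^sub>R (1 - ?u \<theta> *\<^sub>C ?R \<theta>)) has_integral ?A * S) {0..2 * pi}"
    by (simp only: mult_scaleR_right AR)
  then have 1: "?A * S = 1 - P" by (rule has_integral_unique[OF _ lim])
  have "((\<lambda>\<theta>. ?G \<theta> * ?A) has_integral S * ?A) {0..2 * pi}"
    using has_integral_linear[OF S bounded_linear_mult_left[of ?A]] by (simp only: o_def)
  then have "((\<lambda>\<theta>. (1 / (2 * pi)) *\<^sub>R (1 - ?u \<theta> *\<^sub>C ?R \<theta>)) has_integral S * ?A) {0..2 * pi}"
    by (simp only: mult_scaleR_left RA)
  then have 2: "S * ?A = 1 - P" by (rule has_integral_unique[OF _ lim])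
  from 1 2 show ?thesis by blast
qed

lemma rank_one_compression:
  assumes "rank_one P"
  shows "\<exists>a. P * X * P = a *\<^sub>C P"
proof -
  obtain v where v: "range (cbop_apply P) = range (\<lambda>a. a *\<^sub>C v)"
    using assms unfolding rank_one_def by blast
  obtain a where a: "cbop_apply P (cbop_apply X v) = a *\<^sub>C v" using v by blast
  have "cbop_apply (P * X * P) x = cbop_apply (a *\<^sub>C P) x" for x
  proof -
    obtain b where "cbop_apply P x = b *\<^sub>C v" using v by blast
    then show ?thesis
      by (simp add: cbop_apply_simps cbop_apply_scaleC_right a scaleC_scaleC mult.commute)
  qed
  then show ?thesis by (intro exI cbop_eqI)
qed

lemma rank_one_commuting:
  assumes "rank_one P" "X * P = P * X"
  shows "\<exists>b. X * P = b *\<^sub>C P"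
proof -
  obtain v where v0: "range (cbop_apply P) = range (\<lambda>a. a *\<^sub>C v)"
    using assms unfolding rank_one_def by blast
  have "1 *\<^sub>C v \<in> range (cbop_apply P)" using v0 by blast
  then obtain y where y: "v = cbop_apply P y" by auto
  have "cbop_apply X v = cbop_apply (P * X) y"
    unfolding assms(2)[symmetric] by (simp add: cbop_apply_simps y)
  then have "cbop_apply X v \<in> range (cbop_apply P)" by (simp add: cbop_apply_simps)
  then obtain b where b: "cbop_apply X v = b *\<^sub>C v" using v0 by auto
  have "cbop_apply (X * P) x = cbop_apply (b *\<^sub>C P) x" for x
  proof -
    obtain c where "cbop_apply P x = c *\<^sub>C v" using v0 by blast
    then show ?thesis
      by (simp add: cbop_apply_simps cbop_apply_scaleC_right b scaleC_scaleC mult.commute)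
  qed
  then show ?thesis by (intro exI cbop_eqI)
qed

text \<open>Since \<open>A = l - T\<close> is invertible modulo \<open>P\<close> and \<open>P\<close> has rank one, \<open>P P = k P\<close> with \<open>k \<noteq> 1\<close> would make
  \<open>1 - P\<close>, and \<open>A P = b P\<close> with \<open>b \<noteq> 0\<close> would make \<open>A\<close> invertible, although \<open>l\<close> is in the spectrum.
  The rank is known for some spectral projection, and \<open>P\<close> is the same one by uniqueness.\<close>

lemma simple_isolated_eigenvalue_decomposition:
  fixes T :: "'a :: complex_banach cbop"
  assumes simple: "simple_isolated_eigenvalue T l" and P: "spectral_projection T l P"
  obtains S where "P \<noteq> 0" "P * P = P" "(l *\<^sub>C 1 - T) * P = 0" "P * (l *\<^sub>C 1 - T) = 0"
    "(l *\<^sub>C 1 - T) * S = 1 - P" "S * (l *\<^sub>C 1 - T) = 1 - P" "P * S = 0" "S * P = 0"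
    "\<And>X. \<exists>a. P * X * P = a *\<^sub>C P"
proof -
  let ?A = "l *\<^sub>C 1 - T"
  have rank: "rank_one P"
    using simple P spectral_projection_unique unfolding simple_isolated_eigenvalue_def by blast
  have noninv: "\<not> cbop_invertible ?A"
    using P unfolding spectral_projection_def spectrum_def by blast
  obtain S0 where S0: "?A * S0 = 1 - P" "S0 * ?A = 1 - P"
    using reduced_resolvent_exists[OF P] by blast
  have "?A * P = ?A * (1 - S0 * ?A)" "P * ?A = (1 - ?A * S0) * ?A"
    by (simp_all only: S0) simp_all
  then have AP: "?A * P = P * ?A"
    by (simp only: right_diff_distrib[of ?A 1] left_diff_distrib[of 1 _ ?A] mult.assoc
        mult_1 mult_1_right)
  have P0: "P \<noteq> 0"
  proof
    assume "P = 0"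
    then show False using S0 noninv cbop_invertibleI[of ?A S0] by simp
  qed
  obtain k where k: "P * P = k *\<^sub>C P" using rank_one_compression[OF rank, of 1] by auto
  have k1: "k = 1"
  proof (rule ccontr)
    assume "k \<noteq> 1"
    define Z where "Z = 1 + (1 / (1 - k)) *\<^sub>C P"
    have "P = (1 / (1 - k)) *\<^sub>C P - (1 / (1 - k)) *\<^sub>C k *\<^sub>C P"
      using \<open>k \<noteq> 1\<close> by (simp add: scaleC_scaleC flip: scaleC_diff_left diff_divide_distrib)
    then have "(1 - P) * Z = 1" "Z * (1 - P) = 1"
      unfolding Z_def
      by (simp_all add: distrib_left distrib_right left_diff_distrib right_diff_distrib
          scaleC_mult_left scaleC_mult_right scaleC_diff_right k algebra_simps)
    then have "?A * (S0 * Z) = 1" "(Z * S0) * ?A = 1"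
      using S0 by (simp_all only: mult.assoc[symmetric] S0) (simp only: mult.assoc S0)
    moreover from this have "S0 * Z = Z * S0" by (metis mult.assoc mult_1 mult_1_right)
    ultimately show False using noninv cbop_invertibleI by metis
  qed
  obtain b where b: "?A * P = b *\<^sub>C P" using rank_one_commuting[OF rank AP] by blast
  have b0: "b = 0"
  proof (rule ccontr)
    assume "b \<noteq> 0"
    then have "?A * (S0 + (1 / b) *\<^sub>C P) = 1" "(S0 + (1 / b) *\<^sub>C P) * ?A = 1"
      using S0 b AP by (simp_all add: distrib_left distrib_right scaleC_mult_left scaleC_mult_right
          scaleC_scaleC)
    then show False using noninv cbop_invertibleI by metis
  qed
  have PP: "P * P = P" using k k1 by simp
  have AP0: "?A * P = 0" "P * ?A = 0" using b b0 AP by simp_all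
  define S where "S = (1 - P) * S0 * (1 - P)"
  have QQ: "(1 - P) * (1 - P) = 1 - P" using PP by (simp add: left_diff_distrib right_diff_distrib)
  have AQ: "?A * (1 - P) = ?A" "(1 - P) * ?A = ?A"
    using AP0 by (simp_all add: right_diff_distrib[of ?A] left_diff_distrib[of _ _ ?A])
  have "?A * S = (1 - P) * (1 - P)" unfolding S_def by (simp only: mult.assoc[symmetric] AQ S0)
  moreover have "S * ?A = (1 - P) * (1 - P)" unfolding S_def by (simp only: mult.assoc AQ S0)
  moreover have "P * (1 - P) = 0" "(1 - P) * P = 0"
    using PP by (simp_all add: left_diff_distrib right_diff_distrib)
  then have "P * S = 0" "S * P = 0" unfolding S_def
    by (simp_all only: mult.assoc[symmetric] mult_zero_left) (simp_all add: mult.assoc)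
  ultimately show thesis
    using that P0 PP AP0 QQ rank_one_compression[OF rank] by simp
qed

section \<open>Perturbation of a simple eigenvalue\<close>

text \<open>Bordering with \<open>P\<close> makes \<open>w - T + P\<close> invertible for \<open>(w, T)\<close> close to \<open>(l, T0)\<close>; let \<open>K\<close> be its
  inverse. The equation \<open>T x = w x\<close> becomes \<open>x = K P x\<close>, and as \<open>P\<close> has rank one, \<open>w\<close> is an
  eigenvalue iff the number \<open>f\<close> with \<open>P K P = f P\<close> is \<open>1\<close>. For \<open>T = T0\<close> this number is
  \<open>1 / (w - l + 1)\<close>, so \<open>w \<mapsto> w + f - 1\<close> is a contraction near \<open>l\<close>, whose only fixed point is the
  perturbed eigenvalue. Then \<open>K P\<close> consists of eigenvectors and is close to \<open>P\<close>.\<close>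

lemma simple_eigenvalue_perturbation:
  fixes T0 P S :: "'a :: complex_banach cbop" and l :: complex
  defines "A \<equiv> l *\<^sub>C 1 - T0"
  assumes P0: "P \<noteq> 0" and PP: "P * P = P" and AP: "A * P = 0" and PA: "P * A = 0"
    and AS: "A * S = 1 - P" and SA: "S * A = 1 - P" and PS: "P * S = 0" and SP: "S * P = 0"
    and compr: "\<And>X. \<exists>a. P * X * P = a *\<^sub>C P"
  obtains \<eta>\<^sub>1 \<delta>\<^sub>1 L :: real where "\<eta>\<^sub>1 > 0" "\<delta>\<^sub>1 > 0" "L \<ge> 0"
    "\<And>T w. norm (T - T0) < \<delta>\<^sub>1 \<Longrightarrow> dist w l < \<eta>\<^sub>1 \<Longrightarrow> eigenvalue T w \<Longrightarrow>
      \<exists>E. T * E = w *\<^sub>C E \<and> norm (E - P) \<le> L * (norm (T - T0) + dist w l)"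
    "\<And>\<eta>. 0 < \<eta> \<Longrightarrow> \<eta> < \<eta>\<^sub>1 \<Longrightarrow>
      \<exists>\<delta>>0. \<forall>T. norm (T - T0) < \<delta> \<longrightarrow> (\<exists>!w. eigenvalue T w \<and> dist w l < \<eta>)"
proof -
  define K0 where "K0 = S + P"
  define k where "k = norm K0"
  define p where "p = norm P"
  have p0: "p > 0" using P0 by (simp add: p_def)
  have k0: "k \<ge> 0" by (simp add: k_def)
  have K0: "(A + P) * K0 = 1" "K0 * (A + P) = 1"
    by (simp_all add: K0_def distrib_left distrib_right AP PA AS SA PS SP PP)
  have K0P: "K0 * P = P" "P * K0 = P"
    by (simp_all add: K0_def distrib_left distrib_right PS SP PP)
  \<comment> \<open>Within this distance the Neumann series for \<open>K\<close> converges and the contraction factor is \<open>1/2\<close>.\<close>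
  define e0 where "e0 = 1 / (2 * (k + 6 * k ^ 3 * p + 1))"
  have den: "k + 6 * k ^ 3 * p + 1 > 0" "k ^ 3 * p \<ge> 0" using k0 p0 by (simp_all add: add_nonneg_pos)
  then have e0: "e0 > 0" by (simp add: e0_def)
  have e0k: "e0 * k \<le> 1 / 2" "6 * k ^ 3 * p * e0 \<le> 1 / 2"
    unfolding e0_def using den k0 by (auto simp: field_simps)
  define f where "f X = (SOME a. P * X * P = a *\<^sub>C P)" for X
  have f: "P * X * P = f X *\<^sub>C P" for X unfolding f_def by (rule someI_ex[OF compr])
  have fI: "f X = a" if "P * X * P = a *\<^sub>C P" for X a
  proof -
    have "(f X - a) *\<^sub>C P = 0" using that f[of X] by (simp add: scaleC_diff_left)
    then show ?thesis using P0 by simp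
  qed
  have f_diff: "f (X - Y) = f X - f Y" for X Y
    by (rule fI) (simp add: left_diff_distrib right_diff_distrib f scaleC_diff_left)
  have f_scale: "f (a *\<^sub>C X) = a * f X" for a X
    by (rule fI) (simp add: scaleC_mult_left scaleC_mult_right f scaleC_scaleC)
  have f_le: "cmod (f X) \<le> p * norm X" for X
  proof -
    have "cmod (f X) * p = norm (P * X * P)" by (simp add: f norm_scaleC p_def)
    also have "\<dots> \<le> (p * norm X) * p"
      unfolding p_def
      by (intro order.trans[OF norm_mult_ineq] mult_right_mono norm_mult_ineq norm_ge_zero)
    finally show ?thesis using p0 by (simp add: mult.commute)
  qed
  have fK0: "f K0 = 1" "f (K0 * K0) = 1"
    by (rule fI, simp add: K0P PP) (rule fI, simp add: K0P PP mult.assoc)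
  define N where "N w T = w *\<^sub>C 1 - T + P" for w T
  define K where "K w T = cbop_inv (N w T)" for w T
  have N_diff: "norm (N w T - (A + P)) \<le> norm (T - T0) + dist w l" for w T
  proof -
    have "N w T - (A + P) = (w - l) *\<^sub>C 1 - (T - T0)"
      by (simp add: N_def A_def scaleC_diff_left)
    then have "norm (N w T - (A + P)) \<le> cmod (w - l) * norm (1 :: 'a cbop) + norm (T - T0)"
      using norm_triangle_ineq4[of "(w - l) *\<^sub>C (1 :: 'a cbop)" "T - T0"] by (simp add: norm_scaleC)
    also have "\<dots> \<le> dist w l * 1 + norm (T - T0)"
      using norm_one_cbop_le[where 'a = 'a] by (intro add_mono mult_mono) (auto simp: dist_norm)
    finally show ?thesis by simp
  qed
  have inv: "cbop_invertible (N w T)" "norm (K w T) \<le> 2 * k"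
    "norm (K w T - K0) \<le> 2 * k\<^sup>2 * (norm (T - T0) + dist w l)"
    if "norm (T - T0) + dist w l \<le> e0" for w T
  proof -
    have "norm (N w T - (A + P)) * norm K0 \<le> e0 * k"
      unfolding k_def using N_diff[of w T] that by (intro mult_right_mono) auto
    then have small: "norm (N w T - (A + P)) * norm K0 \<le> 1 / 2" using e0k by simp
    from cbop_invertible_perturb[OF K0 small]
    show "cbop_invertible (N w T)" "norm (K w T) \<le> 2 * k"
      and le: "norm (K w T - K0) \<le> 2 * k\<^sup>2 * (norm (T - T0) + dist w l)"
      unfolding K_def k_def
      using mult_left_mono[OF N_diff[of w T], of "2 * (norm K0)\<^sup>2"] by (auto intro: order.trans)
  qed
  note NK = cbop_inv_right[OF inv(1), folded K_def] and KN = cbop_inv_left[OF inv(1), folded K_def]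
  have KP: "T * (K w T * P) = w *\<^sub>C (K w T * P)"
    if good: "norm (T - T0) + dist w l \<le> e0" and 1: "f (K w T) = 1" for w T
  proof -
    have "P = N w T * K w T * P" using NK[OF good] by simp
    also have "\<dots> = w *\<^sub>C (K w T * P) - T * (K w T * P) + P * K w T * P"
      unfolding N_def by (simp add: distrib_right left_diff_distrib scaleC_mult_left mult.assoc)
    also have "P * K w T * P = P" using f 1 by simp
    finally show ?thesis by simp
  qed
  have eig: "eigenvalue T w \<longleftrightarrow> f (K w T) = 1" if good: "norm (T - T0) + dist w l \<le> e0" for w T
  proof
    assume "eigenvalue T w"
    then obtain x where x: "x \<noteq> 0" "cbop_apply T x = w *\<^sub>C x" unfolding eigenvalue_def by blast
    have "x = cbop_apply (K w T * N w T) x" by (simp add: KN[OF good] cbop_apply_simps)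
    also have "\<dots> = cbop_apply (K w T) (cbop_apply P x)"
      by (simp add: N_def cbop_apply_simps x)
    finally have xK: "x = cbop_apply (K w T) (cbop_apply P x)" .
    then have "cbop_apply P x = cbop_apply (P * K w T * P) x"
      using PP by (metis cbop_apply_simps(5))
    then have "(f (K w T) - 1) *\<^sub>C cbop_apply P x = 0"
      by (simp add: f cbop_apply_simps scaleC_diff_left)
    moreover have "cbop_apply P x \<noteq> 0"
      using xK x(1) by (metis cbop_apply_zero_right)
    ultimately show "f (K w T) = 1" by simp
  next
    assume 1: "f (K w T) = 1"
    have "K w T * P \<noteq> 0"
    proof
      assume "K w T * P = 0"
      then have "P * K w T * P = 0" by (simp add: mult.assoc)
      then show False using f[of "K w T"] 1 P0 by simp
    qed
    then obtain y where "cbop_apply (K w T * P) y \<noteq> 0"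
      using cbop_eqI[of "K w T * P" 0] by (auto simp: cbop_apply_simps)
    moreover have "cbop_apply T (cbop_apply (K w T * P) y) = w *\<^sub>C cbop_apply (K w T * P) y"
      using KP[OF good 1] by (metis cbop_apply_simps(5) cbop_apply_simps(6))
    ultimately show "eigenvalue T w" unfolding eigenvalue_def by blast
  qed
  define \<Phi> where "\<Phi> T w = w + f (K w T) - 1" for T w
  have contr: "dist (\<Phi> T w) (\<Phi> T w') \<le> 1 / 2 * dist w w'"
    if w: "norm (T - T0) + dist w l \<le> e0" and w': "norm (T - T0) + dist w' l \<le> e0" for T w w'
  proof -
    let ?K = "K w T" and ?K' = "K w' T"
    have "(w' - w) *\<^sub>C (?K * ?K') = ?K * (N w' T - N w T) * ?K'"
      by (simp add: N_def left_diff_distrib right_diff_distrib scaleC_mult_left scaleC_mult_right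
          scaleC_diff_left)
    also have "\<dots> = ?K * (N w' T * ?K') - (?K * N w T) * ?K'"
      by (simp only: left_diff_distrib right_diff_distrib mult.assoc)
    also have "\<dots> = ?K - ?K'" by (simp add: NK[OF w'] KN[OF w])
    finally have "f ?K - f ?K' = (w' - w) * f (?K * ?K')" by (metis f_diff f_scale)
    then have "\<Phi> T w - \<Phi> T w' = (w - w') * f (K0 * K0 - ?K * ?K')"
      unfolding \<Phi>_def f_diff fK0 by (simp add: algebra_simps)
    then have *: "dist (\<Phi> T w) (\<Phi> T w') \<le> dist w w' * (p * norm (K0 * K0 - ?K * ?K'))"
      using f_le by (simp add: dist_norm norm_mult mult_left_mono)
    have "K0 * K0 - ?K * ?K' = (K0 - ?K) * K0 + ?K * (K0 - ?K')" by (simp add: algebra_simps)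
    then have "norm (K0 * K0 - ?K * ?K') \<le> norm (K0 - ?K) * norm K0 + norm ?K * norm (K0 - ?K')"
      by (metis add_mono norm_mult_ineq norm_triangle_le)
    also have "\<dots> \<le> (2 * k\<^sup>2 * e0) * k + (2 * k) * (2 * k\<^sup>2 * e0)"
    proof (intro add_mono mult_mono)
      have "2 * k\<^sup>2 * (norm (T - T0) + dist w l) \<le> 2 * k\<^sup>2 * e0"
        "2 * k\<^sup>2 * (norm (T - T0) + dist w' l) \<le> 2 * k\<^sup>2 * e0"
        using w w' by (intro mult_left_mono; simp)+
      then show "norm (K0 - ?K) \<le> 2 * k\<^sup>2 * e0" "norm (K0 - ?K') \<le> 2 * k\<^sup>2 * e0"
        using inv(3)[OF w] inv(3)[OF w'] by (simp_all add: norm_minus_commute)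
    qed (use inv(2)[OF w] k0 e0 in \<open>auto simp: k_def\<close>)
    also have "\<dots> = 6 * k ^ 3 * e0" by (simp add: power3_eq_cube power2_eq_square)
    finally have "p * norm (K0 * K0 - ?K * ?K') \<le> p * (6 * k ^ 3 * e0)"
      using p0 by (intro mult_left_mono) auto
    also have "\<dots> \<le> 1 / 2" using e0k(2) by (simp add: mult_ac)
    finally have "dist w w' * (p * norm (K0 * K0 - ?K * ?K')) \<le> dist w w' * (1 / 2)"
      by (intro mult_left_mono) auto
    with * show ?thesis by simp
  qed
  show thesis
  proof (rule that[of "e0 / 2" "e0 / 2" "2 * k\<^sup>2 * p"])
    show "e0 / 2 > 0" "e0 / 2 > 0" "2 * k\<^sup>2 * p \<ge> 0" using e0 p0 by auto
  next
    fix T w assume "norm (T - T0) < e0 / 2" "dist w l < e0 / 2" and ev: "eigenvalue T w"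
    then have good: "norm (T - T0) + dist w l \<le> e0" by simp
    have "norm (K w T * P - P) = norm ((K w T - K0) * P)"
      by (simp add: left_diff_distrib K0P)
    also have "\<dots> \<le> norm (K w T - K0) * p" unfolding p_def by (rule norm_mult_ineq)
    also have "\<dots> \<le> (2 * k\<^sup>2 * (norm (T - T0) + dist w l)) * p"
      using inv(3)[OF good] p0 by (intro mult_right_mono) auto
    finally have "norm (K w T * P - P) \<le> 2 * k\<^sup>2 * p * (norm (T - T0) + dist w l)"
      by (simp add: mult_ac)
    with KP[OF good] eig[OF good] ev
    show "\<exists>E. T * E = w *\<^sub>C E \<and> norm (E - P) \<le> 2 * k\<^sup>2 * p * (norm (T - T0) + dist w l)"
      by blast
  next
    fix \<eta> assume \<eta>: "0 < \<eta>" "\<eta> < e0 / 2"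
    define \<delta> where "\<delta> = min (e0 / 2) (\<eta> / (8 * k\<^sup>2 * p + 1))"
    have kp: "k\<^sup>2 * p \<ge> 0" using p0 by simp
    have \<delta>: "\<delta> > 0" using e0 \<eta> kp by (simp add: \<delta>_def add_nonneg_pos)
    have "\<exists>!w. eigenvalue T w \<and> dist w l < \<eta>" if T: "norm (T - T0) < \<delta>" for T
    proof -
      have good: "norm (T - T0) + dist w l \<le> e0" if "dist w l \<le> \<eta>" for w
        using that T \<eta> by (simp add: \<delta>_def)
      have ev: "eigenvalue T w \<longleftrightarrow> \<Phi> T w = w" if "dist w l \<le> \<eta>" for w
        using eig[OF good[OF that]] by (auto simp: \<Phi>_def algebra_simps)
      have c: "dist (\<Phi> T w) (\<Phi> T w') \<le> 1 / 2 * dist w w'" if "dist w l \<le> \<eta>" "dist w' l \<le> \<eta>" for w w'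
        by (rule contr[OF good[OF that(1)] good[OF that(2)]])
      have \<Phi>l: "dist (\<Phi> T l) l \<le> \<eta> / 4"
      proof -
        have g: "norm (T - T0) + dist l l \<le> e0" using \<eta> by (intro good) simp
        have "\<Phi> T l - l = f (K l T - K0)" by (simp add: \<Phi>_def f_diff fK0)
        then have "dist (\<Phi> T l) l \<le> p * norm (K l T - K0)" using f_le by (simp add: dist_norm)
        also have "\<dots> \<le> p * (2 * k\<^sup>2 * norm (T - T0))"
          using inv(3)[OF g] p0 by (intro mult_left_mono) auto
        also have "\<dots> = 2 * (k\<^sup>2 * p) * norm (T - T0)" by simp
        also have "\<dots> \<le> 2 * (k\<^sup>2 * p) * (\<eta> / (8 * k\<^sup>2 * p + 1))"
          using T kp by (intro mult_left_mono) (auto simp: \<delta>_def)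
        also have "\<dots> \<le> \<eta> / 4" using kp \<eta> by (simp add: field_simps)
        finally show ?thesis .
      qed
      have "\<exists>!w\<in>cball l (\<eta> / 2). \<Phi> T w = w"
      proof (rule Banach_fix[where c = "1 / 2"])
        show "\<Phi> T ` cball l (\<eta> / 2) \<subseteq> cball l (\<eta> / 2)"
        proof (rule image_subsetI)
          fix w assume w: "w \<in> cball l (\<eta> / 2)"
          then have "dist (\<Phi> T w) (\<Phi> T l) \<le> 1 / 2 * dist w l"
            using \<eta> by (intro c) (auto simp: dist_commute)
          then have "dist (\<Phi> T w) l \<le> \<eta> / 4 + \<eta> / 4"
            using w \<Phi>l dist_triangle[of "\<Phi> T w" l "\<Phi> T l"] by (simp add: dist_commute)
          then show "\<Phi> T w \<in> cball l (\<eta> / 2)" by (simp add: dist_commute)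
        qed
        show "dist (\<Phi> T w) (\<Phi> T w') \<le> 1 / 2 * dist w w'"
          if "w \<in> cball l (\<eta> / 2)" "w' \<in> cball l (\<eta> / 2)" for w w'
          using \<eta> that by (intro c) (auto simp: dist_commute)
      qed (use \<eta> in \<open>auto simp: complete_eq_closed\<close>)
      then obtain w where w: "dist w l \<le> \<eta> / 2" "\<Phi> T w = w" by (auto simp: dist_commute)
      show ?thesis
      proof (rule ex1I[of _ w])
        show "eigenvalue T w \<and> dist w l < \<eta>" using w ev[of w] \<eta> by auto
        fix w' assume w': "eigenvalue T w' \<and> dist w' l < \<eta>"
        then have "\<Phi> T w' = w'" using ev[of w'] by auto
        then have "dist w' w \<le> 1 / 2 * dist w' w" using c[of w' w] w w' \<eta> by auto
        then show "w' = w" by simp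
      qed
    qed
    with \<delta> show "\<exists>\<delta>>0. \<forall>T. norm (T - T0) < \<delta> \<longrightarrow> (\<exists>!w. eigenvalue T w \<and> dist w l < \<eta>)" by blast
  qed
qed

section \<open>Absolutely summable formal power series\<close>

text \<open>The truncated norms are submultiplicative on all formal series. An identity \<open>x = a + b x\<close> with
  \<open>\<parallel>b\<parallel> \<le> 1/2\<close> therefore bounds them for \<open>x\<close> before \<open>x\<close> is known to be summable.\<close>

definition l1norm_upto :: "nat \<Rightarrow> 'b :: real_normed_vector fps \<Rightarrow> real"
  where "l1norm_upto n f = (\<Sum>k\<le>n. norm (fps_nth f k))"

definition l1_fps :: "'b :: real_normed_vector fps \<Rightarrow> bool"
  where "l1_fps f \<longleftrightarrow> summable (\<lambda>k. norm (fps_nth f k))"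

definition l1norm :: "'b :: real_normed_vector fps \<Rightarrow> real"
  where "l1norm f = (\<Sum>k. norm (fps_nth f k))"

lemma l1norm_upto_nonneg: "l1norm_upto n f \<ge> 0"
  by (simp add: l1norm_upto_def sum_nonneg)

lemma l1norm_upto_le: "l1_fps f \<Longrightarrow> l1norm_upto n f \<le> l1norm f"
  unfolding l1norm_upto_def l1norm_def l1_fps_def by (rule sum_le_suminf) auto

lemma l1norm_nonneg: "l1_fps f \<Longrightarrow> l1norm f \<ge> 0"
  unfolding l1norm_def l1_fps_def by (rule suminf_nonneg) auto

lemma l1_boundedI:
  assumes "\<And>n. l1norm_upto n f \<le> K"
  shows "l1_fps f" "l1norm f \<le> K"
proof -
  show l1: "l1_fps f" unfolding l1_fps_def
    by (rule bounded_imp_summable[of _ K]) (use assms in \<open>auto simp: l1norm_upto_def\<close>)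
  show "l1norm f \<le> K" unfolding l1norm_def
  proof (rule suminf_le_const)
    show "(\<Sum>k<n. norm (fps_nth f k)) \<le> K" for n
      using assms[of n] sum_mono2[of "{..n}" "{..<n}" "\<lambda>k. norm (fps_nth f k)"]
      by (force simp: l1norm_upto_def)
  qed (use l1 in \<open>simp add: l1_fps_def\<close>)
qed

lemma l1norm_upto_add: "l1norm_upto n (f + g) \<le> l1norm_upto n f + l1norm_upto n g"
  unfolding l1norm_upto_def sum.distrib[symmetric]
  by (intro sum_mono) (simp add: norm_triangle_ineq)

lemma l1norm_upto_mult:
  fixes f g :: "'b :: real_normed_algebra fps"
  shows "l1norm_upto n (f * g) \<le> l1norm_upto n f * l1norm_upto n g"
proof -
  let ?h = "\<lambda>i j. norm (fps_nth f i) * norm (fps_nth g j)"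
  have "norm (fps_nth (f * g) k) \<le> (\<Sum>i\<le>k. ?h i (k - i))" for k
    unfolding fps_mult_nth atLeast0AtMost
    by (rule order.trans[OF norm_sum sum_mono]) (rule norm_mult_ineq)
  then have "l1norm_upto n (f * g) \<le> (\<Sum>k\<le>n. \<Sum>i\<le>k. ?h i (k - i))"
    unfolding l1norm_upto_def by (intro sum_mono)
  also have "\<dots> = (\<Sum>(i, j)\<in>{(i, j). i + j \<le> n}. ?h i j)"
    by (rule sum.triangle_reindex_eq[symmetric])
  also have "\<dots> \<le> (\<Sum>(i, j)\<in>{..n} \<times> {..n}. ?h i j)"
    by (rule sum_mono2) auto
  also have "\<dots> = l1norm_upto n f * l1norm_upto n g"
    by (simp add: l1norm_upto_def sum_product sum.cartesian_product)
  finally show ?thesis .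
qed

lemma l1_add:
  assumes "l1_fps f" "l1_fps g"
  shows "l1_fps (f + g)" "l1norm (f + g) \<le> l1norm f + l1norm g"
  by (rule l1_boundedI, rule order.trans[OF l1norm_upto_add], rule add_mono;
      rule l1norm_upto_le, fact)+

lemma l1_minus: "l1_fps (- f) \<longleftrightarrow> l1_fps f" "l1norm (- f) = l1norm f"
  by (simp_all add: l1_fps_def l1norm_def)

lemma l1_diff:
  assumes "l1_fps f" "l1_fps g"
  shows "l1_fps (f - g)" "l1norm (f - g) \<le> l1norm f + l1norm g"
  using l1_add[of f "- g"] assms by (simp_all add: l1_minus)

lemma l1_mult:
  fixes f g :: "'b :: real_normed_algebra fps"
  assumes "l1_fps f" "l1_fps g"
  shows "l1_fps (f * g)" "l1norm (f * g) \<le> l1norm f * l1norm g"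
proof -
  have "l1norm_upto n (f * g) \<le> l1norm f * l1norm g" for n
    by (rule order.trans[OF l1norm_upto_mult], rule mult_mono)
      (use assms in \<open>auto intro: l1norm_upto_le l1norm_nonneg l1norm_upto_nonneg\<close>)
  then show "l1_fps (f * g)" "l1norm (f * g) \<le> l1norm f * l1norm g"
    by (rule l1_boundedI)+
qed

lemma l1_sum:
  assumes "finite I" "\<And>i. i \<in> I \<Longrightarrow> l1_fps (f i)"
  shows "l1_fps (\<Sum>i\<in>I. f i)" "l1norm (\<Sum>i\<in>I. f i) \<le> (\<Sum>i\<in>I. l1norm (f i))"
proof -
  have "l1_fps (\<Sum>i\<in>I. f i) \<and> l1norm (\<Sum>i\<in>I. f i) \<le> (\<Sum>i\<in>I. l1norm (f i))"
    using assms
  proof (induction I rule: finite_induct)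
    case (insert i I)
    then show ?case using l1_add[of "f i" "\<Sum>i\<in>I. f i"] by auto
  qed (simp add: l1_fps_def l1norm_def)
  then show "l1_fps (\<Sum>i\<in>I. f i)" "l1norm (\<Sum>i\<in>I. f i) \<le> (\<Sum>i\<in>I. l1norm (f i))" by auto
qed

lemma l1_const [simp]: "l1_fps (fps_const c)" "l1norm (fps_const c) = norm c"
proof -
  have "(\<lambda>k. norm (fps_nth (fps_const c) k)) sums (\<Sum>k\<in>{0}. norm (fps_nth (fps_const c) k))"
    by (rule sums_finite) auto
  then show "l1_fps (fps_const c)" "l1norm (fps_const c) = norm c"
    unfolding l1_fps_def l1norm_def by (auto simp: sums_iff)
qed

lemma l1_const_mult:
  fixes h :: "'b :: real_normed_algebra fps"
  assumes "l1_fps h"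
  shows "l1_fps (fps_const c * h)" "l1norm (fps_const c * h) \<le> norm c * l1norm h"
  using l1_mult[OF l1_const(1) assms, of c] by simp_all

lemma l1_one [simp]: "l1_fps (1 :: 'b :: {real_normed_vector, one} fps)"
  and l1norm_one: "l1norm (1 :: 'b :: {real_normed_vector, one} fps) = norm (1 :: 'b)"
  using l1_const[of "1 :: 'b"] by (simp_all del: l1_const)

lemma l1_X_mult:
  fixes f :: "'b :: {real_normed_algebra, monoid_mult} fps"
  assumes "l1_fps f"
  shows "l1_fps (fps_X * f)" "l1norm (fps_X * f) = l1norm f"
proof -
  let ?F = "\<lambda>n. norm (fps_nth (fps_X * f) n)"
  have eq: "(\<lambda>n. ?F (Suc n)) = (\<lambda>n. norm (fps_nth f n))" by (simp add: fun_eq_iff)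
  show *: "l1_fps (fps_X * f)"
    using assms unfolding l1_fps_def by (subst summable_Suc_iff[symmetric]) (simp only: eq)
  show "l1norm (fps_X * f) = l1norm f"
    using suminf_split_head[OF *[unfolded l1_fps_def]] by (simp add: l1norm_def eq)
qed

text \<open>Scalar series, as operator-valued ones, commute with all series.\<close>

definition scalar :: "complex fps \<Rightarrow> 'a :: complex_normed_vector cbop fps"
  where "scalar p = Abs_fps (\<lambda>n. fps_nth p n *\<^sub>C 1)"

lemma scalar_nth [simp]: "fps_nth (scalar p) n = fps_nth p n *\<^sub>C 1"
  by (simp add: scalar_def)

lemma scalar_add: "scalar (p + q) = scalar p + scalar q"
  and scalar_diff: "scalar (p - q) = scalar p - scalar q"
  and scalar_one: "scalar 1 = 1"
  and scalar_zero: "scalar 0 = 0"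
  and scalar_X: "scalar fps_X = fps_X"
  and scalar_const: "scalar (fps_const a) = fps_const (a *\<^sub>C 1)"
  by (simp_all add: fps_eq_iff scaleC_add_left scaleC_diff_left fps_const_def)

lemma scalar_mult: "scalar (p * q) = scalar p * scalar q"
  by (simp add: fps_eq_iff fps_mult_nth scaleC_sum_left scaleC_mult_left scaleC_mult_right
      scaleC_scaleC mult.commute)

lemma scalar_mult_nth:
  "fps_nth (scalar p * f) n = (\<Sum>i=0..n. fps_nth p i *\<^sub>C fps_nth f (n - i))"
  by (simp add: fps_mult_nth scaleC_mult_left)

lemma scalar_commute: "scalar p * f = f * scalar p"
proof (rule fps_ext)
  fix n
  have "(\<Sum>i=0..n. fps_nth p i *\<^sub>C fps_nth f (n - i)) = (\<Sum>i=0..n. fps_nth p (n - i) *\<^sub>C fps_nth f i)"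
    by (rule sum.reindex_bij_witness[of _ "\<lambda>i. n - i" "\<lambda>i. n - i"]) auto
  then show "fps_nth (scalar p * f) n = fps_nth (f * scalar p) n"
    by (simp add: fps_mult_nth scaleC_mult_left scaleC_mult_right)
qed

lemma scalar_sum: "scalar (\<Sum>i\<in>I. p i) = (\<Sum>i\<in>I. scalar (p i))"
  by (induction I rule: infinite_finite_induct) (simp_all add: scalar_add scalar_zero)

lemma l1_scalar_mult:
  fixes f :: "'a :: complex_normed_vector cbop fps"
  assumes "l1_fps p" "l1_fps f"
  shows "l1_fps (scalar p * f)" "l1norm (scalar p * f) \<le> l1norm p * l1norm f"
proof -
  have le: "norm (fps_nth (scalar p :: 'a cbop fps) n) \<le> norm (fps_nth p n)" for n
    using mult_left_mono[OF norm_one_cbop_le[where 'a = 'a], of "norm (fps_nth p n)"]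
    by (simp add: norm_scaleC)
  have s: "l1_fps (scalar p :: 'a cbop fps)"
    using assms(1) unfolding l1_fps_def
    by (rule summable_comparison_test'[where N = 0]) (use le in auto)
  then have "l1norm (scalar p :: 'a cbop fps) \<le> l1norm p"
    using assms(1) unfolding l1norm_def l1_fps_def by (intro suminf_le le)
  then show "l1norm (scalar p * f) \<le> l1norm p * l1norm f"
    using l1_mult(2)[OF s assms(2)] l1norm_nonneg[OF assms(2)] mult_right_mono by force
  show "l1_fps (scalar p * f)" by (rule l1_mult[OF s assms(2)])
qed

lemma l1_X_power_mult:
  fixes f :: "'a :: complex_normed_vector cbop fps"
  assumes "l1_fps f"
  shows "l1_fps (scalar (fps_X ^ n) * f)" "l1norm (scalar (fps_X ^ n) * f) = l1norm f"
proof -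
  have "l1_fps (scalar (fps_X ^ n) * f) \<and> l1norm (scalar (fps_X ^ n) * f) = l1norm f"
  proof (induction n)
    case 0
    then show ?case using assms by (simp add: scalar_one fps_one_mult)
  next
    case (Suc n)
    then show ?case
      using l1_X_mult[of "scalar (fps_X ^ n) * f"]
      by (simp add: scalar_mult scalar_X mult.assoc)
  qed
  then show "l1_fps (scalar (fps_X ^ n) * f)" "l1norm (scalar (fps_X ^ n) * f) = l1norm f"
    by auto
qed

lemma l1_fps_X [simp]: "l1_fps (fps_X :: 'b :: {real_normed_algebra, monoid_mult} fps)"
  using l1_X_mult(1)[of "1 :: 'b fps"] by (simp add: fps_one_mult)

lemma scaleC_one_mult: "(a *\<^sub>C 1) * (T :: 'a :: complex_normed_vector cbop) = a *\<^sub>C T"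
  by (simp add: scaleC_mult_left)

lemma l1_scaleC_const_mult:
  fixes f :: "'a :: complex_normed_vector cbop fps"
  assumes "l1_fps f"
  shows "l1norm (fps_const (a *\<^sub>C 1) * f) = cmod a * l1norm f"
  using suminf_mult[OF assms[unfolded l1_fps_def], of "cmod a"]
  by (simp add: l1norm_def scaleC_one_mult norm_scaleC)

section \<open>Values of summable series in the unit disc\<close>

definition fps_value :: "'a :: complex_normed_vector cbop fps \<Rightarrow> complex \<Rightarrow> 'a cbop"
  where "fps_value f z = (\<Sum>n. z ^ n *\<^sub>C fps_nth f n)"

definition abs_conv :: "complex \<Rightarrow> 'a :: complex_normed_vector cbop fps \<Rightarrow> bool"
  where "abs_conv z f \<longleftrightarrow> summable (\<lambda>n. norm (z ^ n *\<^sub>C fps_nth f n))"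

lemma l1_imp_abs_conv: "l1_fps f \<Longrightarrow> cmod z \<le> 1 \<Longrightarrow> abs_conv z f"
  unfolding l1_fps_def abs_conv_def
  by (rule summable_comparison_test'[where N = 0])
    (auto simp: norm_scaleC norm_power intro!: mult_left_le_one_le power_le_one)

lemma norm_fps_value_le:
  fixes f :: "'a :: complex_banach cbop fps"
  assumes "l1_fps f" "cmod z \<le> 1"
  shows "norm (fps_value f z) \<le> l1norm f"
proof -
  have s: "summable (\<lambda>n. norm (z ^ n *\<^sub>C fps_nth f n))"
    using l1_imp_abs_conv[OF assms] by (simp add: abs_conv_def)
  then have "norm (fps_value f z) \<le> (\<Sum>n. norm (z ^ n *\<^sub>C fps_nth f n))"
    unfolding fps_value_def by (rule summable_norm)
  also have "\<dots> \<le> l1norm f"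
    unfolding l1norm_def using assms s
    by (intro suminf_le) (auto simp: norm_scaleC norm_power l1_fps_def intro!: mult_left_le_one_le power_le_one)
  finally show ?thesis .
qed

lemma fps_value_add:
  fixes f g :: "'a :: complex_banach cbop fps"
  assumes "abs_conv z f" "abs_conv z g"
  shows "fps_value (f + g) z = fps_value f z + fps_value g z"
  using suminf_add[OF assms[unfolded abs_conv_def, THEN summable_norm_cancel]]
  by (simp add: fps_value_def scaleC_add_right)

lemma fps_value_diff:
  fixes f g :: "'a :: complex_banach cbop fps"
  assumes "abs_conv z f" "abs_conv z g"
  shows "fps_value (f - g) z = fps_value f z - fps_value g z"
  using suminf_diff[OF assms[unfolded abs_conv_def, THEN summable_norm_cancel]]
  by (simp add: fps_value_def scaleC_diff_right)

lemma fps_value_mult: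
  fixes f g :: "'a :: complex_banach cbop fps"
  assumes "abs_conv z f" "abs_conv z g"
  shows "fps_value (f * g) z = fps_value f z * fps_value g z"
proof -
  have "(\<Sum>i\<le>n. (z ^ i *\<^sub>C fps_nth f i) * (z ^ (n - i) *\<^sub>C fps_nth g (n - i)))
      = z ^ n *\<^sub>C fps_nth (f * g) n" for n
    by (simp add: fps_mult_nth scaleC_sum_right atLeast0AtMost scaleC_mult_left scaleC_mult_right
        scaleC_scaleC flip: power_add)
  then show ?thesis
    using Cauchy_product[OF assms[unfolded abs_conv_def]] by (simp add: fps_value_def)
qed

lemma fps_value_const [simp]: "fps_value (fps_const c) z = c"
  using suminf_finite[of "{0}" "\<lambda>n. z ^ n *\<^sub>C fps_nth (fps_const c) n"]
  by (simp add: fps_value_def scaleC_zero_right)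

lemma fps_value_one [simp]: "fps_value 1 z = 1"
  using fps_value_const[of 1 z] by (simp del: fps_value_const)

lemma fps_value_X [simp]: "fps_value fps_X z = z *\<^sub>C (1 :: 'a :: complex_normed_vector cbop)"
  using suminf_finite[of "{1}" "\<lambda>n. z ^ n *\<^sub>C fps_nth (fps_X :: 'a cbop fps) n"]
  by (simp add: fps_value_def scaleC_zero_right)

lemma continuous_on_fps_value:
  fixes f :: "'a :: complex_banach cbop fps"
  assumes "l1_fps f"
  shows "continuous_on (cball 0 1) (fps_value f)"
proof -
  have "uniform_limit (cball 0 1) (\<lambda>n z. \<Sum>i<n. z ^ i *\<^sub>C fps_nth f i)
      (\<lambda>z. \<Sum>i. z ^ i *\<^sub>C fps_nth f i) sequentially"
    using assms unfolding l1_fps_def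
    by (intro Weierstrass_m_test)
      (auto simp: norm_scaleC norm_power intro!: mult_left_le_one_le power_le_one)
  then show ?thesis
    unfolding fps_value_def
    by (rule uniform_limit_theorem[rotated])
      (auto intro!: always_eventually continuous_intros continuous_on_scaleC)
qed

section \<open>Dilation and formal inverse\<close>

definition fps_dilate :: "complex \<Rightarrow> 'a :: complex_normed_vector cbop fps \<Rightarrow> 'a cbop fps"
  where "fps_dilate a f = Abs_fps (\<lambda>n. a ^ n *\<^sub>C fps_nth f n)"

lemma fps_dilate_nth [simp]: "fps_nth (fps_dilate a f) n = a ^ n *\<^sub>C fps_nth f n"
  by (simp add: fps_dilate_def)

lemma fps_dilate_mult: "fps_dilate a (f * g) = fps_dilate a f * fps_dilate a g"
  by (simp add: fps_eq_iff fps_mult_nth scaleC_sum_right scaleC_mult_left scaleC_mult_right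
      scaleC_scaleC flip: power_add)

lemma fps_dilate_unit [simp]: "fps_dilate a 1 = 1" "fps_dilate 1 f = f"
  by (auto simp: fps_eq_iff scaleC_zero_right)

lemma l1_dilate:
  assumes "l1_fps f" "cmod a \<le> 1"
  shows "l1_fps (fps_dilate a f)" "l1norm (fps_dilate a f) \<le> l1norm f"
proof -
  have "norm (a ^ n *\<^sub>C fps_nth f n) \<le> norm (fps_nth f n)" for n
    using assms(2) by (simp add: norm_scaleC norm_power mult_left_le_one_le power_le_one)
  then have "l1norm_upto n (fps_dilate a f) \<le> l1norm f" for n
    by (intro order.trans[OF _ l1norm_upto_le[OF assms(1), of n]])
      (auto simp: l1norm_upto_def intro!: sum_mono)
  then show "l1_fps (fps_dilate a f)" "l1norm (fps_dilate a f) \<le> l1norm f"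
    by (rule l1_boundedI)+
qed

fun formal_right_inverse_nth :: "'b :: {ring, monoid_mult} fps \<Rightarrow> 'b \<Rightarrow> nat \<Rightarrow> 'b"
  where "formal_right_inverse_nth f b n = (if n = 0 then b
    else - b * (\<Sum>i<n. fps_nth f (n - i) * formal_right_inverse_nth f b i))"

declare formal_right_inverse_nth.simps [simp del]

lemma formal_right_inverse:
  fixes f :: "'b :: {ring, monoid_mult} fps"
  assumes "fps_nth f 0 * b = 1"
  shows "\<exists>g. fps_nth g 0 = b \<and> f * g = 1"
proof -
  let ?g = "formal_right_inverse_nth f b"
  have "fps_nth (f * Abs_fps ?g) n = fps_nth 1 n" for n
  proof (cases "n = 0")
    case True
    then show ?thesis using assms by (simp add: formal_right_inverse_nth.simps)
  next
    case False
    have "fps_nth (f * Abs_fps ?g) n = (\<Sum>i\<le>n. fps_nth f (n - i) * ?g i)"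
      unfolding fps_mult_nth
      by (rule sum.reindex_bij_witness[of _ "\<lambda>i. n - i" "\<lambda>i. n - i"]) auto
    also have "\<dots> = (\<Sum>i<n. fps_nth f (n - i) * ?g i) + fps_nth f 0 * ?g n"
      by (simp add: lessThan_Suc_atMost[symmetric])
    also have "?g n = - b * (\<Sum>i<n. fps_nth f (n - i) * ?g i)"
      using False by (subst formal_right_inverse_nth.simps) simp
    also have "fps_nth f 0 * (- b * (\<Sum>i<n. fps_nth f (n - i) * ?g i))
        = - ((fps_nth f 0 * b) * (\<Sum>i<n. fps_nth f (n - i) * ?g i))"
      by (simp add: mult.assoc)
    finally show ?thesis using False assms by simp
  qed
  then show ?thesis
    by (intro exI[of _ "Abs_fps ?g"] conjI fps_ext)
      (auto simp: formal_right_inverse_nth.simps)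
qed

text \<open>A right inverse of the right inverse of \<open>f\<close> is \<open>f\<close> itself, so right inverses suffice.\<close>

lemma formal_inverse:
  fixes f :: "'b :: {real_normed_algebra, monoid_mult} fps"
  assumes "fps_nth f 0 * b = 1" "b * fps_nth f 0 = 1"
  shows "\<exists>g. f * g = 1 \<and> g * f = 1"
proof -
  obtain g where g: "fps_nth g 0 = b" "f * g = 1" using formal_right_inverse[OF assms(1)] by blast
  obtain k where k: "g * k = 1" using formal_right_inverse[of g "fps_nth f 0"] assms(2) g(1) by blast
  have "f = f * (g * k)" using k by (simp add: fps_one_mult)
  also have "\<dots> = k" by (simp add: mult.assoc[symmetric] g(2) fps_one_mult)
  finally show ?thesis using g k by blast
qed

section \<open>Wiener's lemma for operator-valued power series\<close>

text \<open>On a series \<open>h\<close> that is almost an eigenvector of the shift for the eigenvalue \<open>\<omega>\<close>, a summable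
  series acts almost like its value at \<open>\<omega>\<close>: this holds for monomials because \<open>X - \<omega>\<close> divides
  \<open>X\<^sup>n - \<omega>\<^sup>n\<close>, and the tail of the series is small.\<close>

lemma l1_X_power_minus_const:
  fixes h :: "'a :: complex_normed_vector cbop fps"
  assumes h: "l1_fps h" and \<omega>: "cmod \<omega> \<le> 1"
  shows "l1norm (scalar (fps_X ^ n - fps_const (\<omega> ^ n)) * h)
    \<le> real n * l1norm (scalar (fps_X - fps_const \<omega>) * h)"
proof (induction n)
  case 0
  then show ?case by (simp add: scalar_zero l1norm_def)
next
  case (Suc n)
  let ?D = "\<lambda>n. scalar (fps_X ^ n - fps_const (\<omega> ^ n)) * h"
  have l1: "l1_fps (?D n)" for n
    by (intro l1_scalar_mult l1_diff h l1_const) (induction n; simp add: l1_X_mult)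
  have "fps_X ^ Suc n - fps_const (\<omega> ^ Suc n)
      = fps_X * (fps_X ^ n - fps_const (\<omega> ^ n)) + fps_const (\<omega> ^ n) * (fps_X - fps_const \<omega>)"
    by (simp add: algebra_simps)
  then have eq: "?D (Suc n) = fps_X * ?D n + fps_const (\<omega> ^ n *\<^sub>C 1) * ?D 1"
    by (simp only: scalar_add scalar_mult scalar_X scalar_const distrib_right mult.assoc
        power_one_right)
  have "l1norm (?D (Suc n)) \<le> l1norm (?D n) + cmod (\<omega> ^ n) * l1norm (?D 1)"
    unfolding eq
    using l1_add(2)[OF l1_X_mult(1)[OF l1[of n]] l1_const_mult(1)[OF l1[of 1], of "\<omega> ^ n *\<^sub>C 1"]]
    by (simp only: l1_X_mult(2)[OF l1[of n]] l1_scaleC_const_mult[OF l1[of 1]])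
  also have "cmod (\<omega> ^ n) * l1norm (?D 1) \<le> l1norm (?D 1)"
    using \<omega> l1norm_nonneg[OF l1[of 1]]
    by (intro mult_left_le_one_le) (simp_all add: norm_power power_le_one)
  finally show ?case using Suc.IH by (simp add: distrib_right)
qed

lemma l1_action_near_value:
  fixes f :: "'a :: complex_banach cbop fps"
  assumes f: "l1_fps f" and \<epsilon>: "\<epsilon> > 0"
  obtains K where "K \<ge> 0"
    "\<And>\<rho> \<omega> h. \<lbrakk>cmod \<rho> \<le> 1; cmod \<omega> \<le> 1; l1_fps h\<rbrakk> \<Longrightarrow>
      l1norm (fps_dilate \<rho> f * h - fps_const (fps_value f (\<rho> * \<omega>)) * h)
        \<le> K * l1norm (scalar (fps_X - fps_const \<omega>) * h) + \<epsilon> * l1norm h"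
proof -
  obtain N where "\<forall>n\<ge>N. norm (\<Sum>i. norm (fps_nth f (i + n))) < \<epsilon> / 2"
    using suminf_exist_split[of "\<epsilon> / 2", OF _ f[unfolded l1_fps_def]] \<epsilon> by auto
  then have N: "(\<Sum>n. norm (fps_nth f (n + N))) < \<epsilon> / 2" by (auto dest!: spec[of _ N])
  define tail where "tail = Abs_fps (\<lambda>n. if n < N then 0 else fps_nth f n)"
  define head where "head = Abs_fps (\<lambda>n. if n < N then fps_nth f n else 0)"
  have f_eq: "f = head + tail" by (simp add: fps_eq_iff head_def tail_def)
  have l1h: "l1_fps head" and l1t: "l1_fps tail"
    unfolding l1_fps_def head_def tail_def
    by (rule summable_comparison_test'[OF f[unfolded l1_fps_def], of 0], simp)+
  have nt: "l1norm tail \<le> \<epsilon> / 2"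
  proof -
    have "l1norm tail = (\<Sum>n. norm (fps_nth tail (n + N))) + (\<Sum>n<N. norm (fps_nth tail n))"
      unfolding l1norm_def using l1t unfolding l1_fps_def by (rule suminf_split_initial_segment)
    then show ?thesis using N by (simp add: tail_def)
  qed
  define K where "K = (\<Sum>n<N. norm (fps_nth f n) * real n)"
  show thesis
  proof (rule that[of K])
    show "K \<ge> 0" by (simp add: K_def sum_nonneg)
  next
    fix \<rho> \<omega> :: complex and h :: "'a cbop fps"
    assume \<rho>: "cmod \<rho> \<le> 1" and \<omega>: "cmod \<omega> \<le> 1" and h: "l1_fps h"
    have \<rho>\<omega>: "cmod (\<rho> * \<omega>) \<le> 1" using \<rho> \<omega> by (simp add: norm_mult mult_le_one)
    let ?a = "\<lambda>n. fps_const (\<rho> ^ n *\<^sub>C fps_nth f n)"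
    let ?D = "\<lambda>n. scalar (fps_X ^ n - fps_const (\<omega> ^ n)) * h"
    let ?t = "fps_dilate \<rho> tail * h - fps_const (fps_value tail (\<rho> * \<omega>)) * h"
    have value_head: "fps_value head (\<rho> * \<omega>) = (\<Sum>n<N. (\<rho> * \<omega>) ^ n *\<^sub>C fps_nth f n)"
      using suminf_finite[of "{..<N}" "\<lambda>n. (\<rho> * \<omega>) ^ n *\<^sub>C fps_nth head n"]
      by (simp add: fps_value_def head_def scaleC_zero_right)
    have "fps_nth (fps_dilate \<rho> head) m = fps_nth (\<Sum>n<N. ?a n * scalar (fps_X ^ n)) m" for m
    proof -
      have "fps_nth (\<Sum>n<N. ?a n * scalar (fps_X ^ n)) m
          = (\<Sum>n<N. if n = m then \<rho> ^ n *\<^sub>C fps_nth f n else 0)"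
        unfolding fps_sum_nth
        by (rule sum.cong) (auto simp: scaleC_zero_right scaleC_mult_left)
      then show ?thesis by (simp add: head_def scaleC_zero_right)
    qed
    then have head: "fps_dilate \<rho> head = (\<Sum>n<N. ?a n * scalar (fps_X ^ n))" by (rule fps_ext)
    have value_head': "fps_const (fps_value head (\<rho> * \<omega>))
        = (\<Sum>n<N. ?a n * scalar (fps_const (\<omega> ^ n)))"
      unfolding value_head
      by (simp add: fps_eq_iff fps_sum_nth scalar_const scaleC_mult_right scaleC_scaleC
          power_mult_distrib mult.commute)
    have 1: "fps_dilate \<rho> head * h - fps_const (fps_value head (\<rho> * \<omega>)) * h = (\<Sum>n<N. ?a n * ?D n)"
      unfolding head value_head' sum_distrib_right sum_subtractf[symmetric] scalar_diff
      by (rule sum.cong) (simp_all only: left_diff_distrib right_diff_distrib mult.assoc)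
    have 2: "fps_value f (\<rho> * \<omega>) = fps_value head (\<rho> * \<omega>) + fps_value tail (\<rho> * \<omega>)"
      by (subst f_eq, rule fps_value_add) (auto intro: l1_imp_abs_conv l1h l1t \<rho>\<omega>)
    have 3: "fps_dilate \<rho> f = fps_dilate \<rho> head + fps_dilate \<rho> tail"
      by (subst f_eq) (simp add: fps_eq_iff scaleC_add_right)
    have eq: "fps_dilate \<rho> f * h - fps_const (fps_value f (\<rho> * \<omega>)) * h
        = (\<Sum>n<N. ?a n * ?D n) + ?t"
      by (simp only: 1[symmetric] 2 3 fps_const_add[symmetric] distrib_right add_diff_add)
    have lD: "l1_fps (?D n)" for n
      by (intro l1_scalar_mult l1_diff h l1_const) (induction n; simp add: l1_X_mult)
    have lt: "l1_fps ?t" by (intro l1_diff l1_mult l1_dilate l1t \<rho> h l1_const)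
    have "l1norm ((\<Sum>n<N. ?a n * ?D n) + ?t)
        \<le> l1norm (\<Sum>n<N. ?a n * ?D n) + l1norm ?t"
      by (intro l1_add l1_sum lt l1_mult l1_const lD) simp
    moreover have "l1norm (\<Sum>n<N. ?a n * ?D n) \<le> K * l1norm (?D 1)"
    proof -
      have "l1norm (\<Sum>n<N. ?a n * ?D n) \<le> (\<Sum>n<N. l1norm (?a n * ?D n))"
        by (intro l1_sum l1_mult l1_const lD) simp
      also have "\<dots> \<le> (\<Sum>n<N. norm (fps_nth f n) * (real n * l1norm (?D 1)))"
      proof (rule sum_mono)
        fix n
        have "l1norm (?a n * ?D n) \<le> norm (\<rho> ^ n *\<^sub>C fps_nth f n) * l1norm (?D n)"
          using l1_mult(2)[OF l1_const(1) lD] by simp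
        also have "\<dots> \<le> norm (fps_nth f n) * (real n * l1norm (?D 1))"
          using l1_X_power_minus_const[OF h \<omega>, of n] \<rho> l1norm_nonneg[OF lD]
          by (intro mult_mono) (auto simp: norm_scaleC norm_power power_le_one mult_left_le_one_le)
        finally show "l1norm (?a n * ?D n) \<le> norm (fps_nth f n) * (real n * l1norm (?D 1))" .
      qed
      finally show ?thesis by (simp add: K_def sum_distrib_right mult.assoc)
    qed
    moreover have "l1norm ?t \<le> \<epsilon> * l1norm h"
    proof -
      have "l1norm ?t \<le> l1norm (fps_dilate \<rho> tail) * l1norm h
          + norm (fps_value tail (\<rho> * \<omega>)) * l1norm h"
        by (rule order.trans[OF l1_diff(2)[OF l1_mult(1)[OF l1_dilate(1)[OF l1t \<rho>] h]
              l1_const_mult(1)[OF h]] add_mono])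
          (intro l1_mult l1_const_mult l1_dilate l1t h \<rho>)+
      also have "\<dots> \<le> \<epsilon> / 2 * l1norm h + \<epsilon> / 2 * l1norm h"
        using nt norm_fps_value_le[OF l1t \<rho>\<omega>] l1_dilate(2)[OF l1t \<rho>] l1norm_nonneg[OF h]
        by (intro add_mono mult_right_mono) auto
      finally show ?thesis by (simp add: algebra_simps)
    qed
    ultimately show "l1norm (fps_dilate \<rho> f * h - fps_const (fps_value f (\<rho> * \<omega>)) * h)
        \<le> K * l1norm (scalar (fps_X - fps_const \<omega>) * h) + \<epsilon> * l1norm h"
      unfolding eq by simp
  qed
qed

lemma sum_roots_of_unity:
  assumes "n < M" "j < M"
  shows "(\<Sum>k<M. (cis (2 * pi * real n / real M) / cis (2 * pi * real j / real M)) ^ k)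
    = (if n = j then of_nat M else 0)"
proof (cases "n = j")
  case False
  let ?z = "cis (2 * pi * real n / real M) / cis (2 * pi * real j / real M)"
  have "cis (2 * pi * real i / real M) ^ M = 1" for i
  proof -
    have "real M * (2 * pi * real i / real M) = 2 * pi * real i" using assms by simp
    then show ?thesis
      unfolding Complex.DeMoivre using cis_multiple_2pi[of "real i"] by (metis Ints_of_nat)
  qed
  then have "?z ^ M = 1" by (simp only: power_divide) simp
  moreover have "?z \<noteq> 1"
  proof
    assume "?z = 1"
    then have "exp (2 * of_real pi * \<i> * of_nat n / of_nat M) = exp (2 * of_real pi * \<i> * of_nat j / of_nat M)"
      by (simp add: cis_conv_exp mult_ac)
    then show False using complex_root_unity_eq[of M n j] assms False by simp
  qed
  ultimately show ?thesis using False by (simp add: geometric_sum)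
qed simp

text \<open>A weighted mean of the series \<open>p(u X) g\<close> over the roots of unity \<open>u\<close> is \<open>p\<^sub>j X\<^sup>j g\<close>, of norm
  \<open>\<bar>p\<^sub>j\<bar> \<parallel>g\<parallel>\<close> because the shift is isometric. The coefficients of \<open>p\<close> add up to \<open>1\<close>, so one of them has
  modulus at least \<open>1 / (d + 1)\<close>.\<close>

lemma exists_rotation_large:
  fixes g :: "'a :: complex_normed_vector cbop fps" and p :: "complex poly"
  assumes g: "l1_fps g" and deg: "degree p \<le> d" and p1: "poly p 1 = 1"
  shows "\<exists>u. cmod u = 1 \<and> l1norm g / real (Suc d)
    \<le> l1norm (scalar (fps_of_poly p oo (fps_const u * fps_X)) * g)"
proof -
  let ?M = "Suc d"
  have "1 \<le> (\<Sum>j\<le>d. cmod (coeff p j))"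
  proof -
    have "poly p 1 = (\<Sum>j\<le>d. coeff p j)"
      unfolding poly_altdef using deg
      by (simp, intro sum.mono_neutral_left) (auto simp: coeff_eq_0)
    then show ?thesis using p1 norm_sum[of "coeff p" "{..d}"] by simp
  qed
  moreover have "(\<Sum>j\<le>d. cmod (coeff p j)) < (\<Sum>j\<le>d. 1 / real ?M)" if "\<forall>j\<le>d. cmod (coeff p j) < 1 / real ?M"
    using that by (intro sum_strict_mono) auto
  ultimately obtain j where j: "j \<le> d" "1 / real ?M \<le> cmod (coeff p j)"
    by (force simp: not_less)
  define u where "u k = cis (2 * pi * real k / real ?M)" for k
  define q where "q k = scalar (fps_of_poly p oo (fps_const (u k) * fps_X)) * g" for k
  have l1p: "l1_fps (fps_of_poly p oo (fps_const v * fps_X))" for v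
    unfolding l1_fps_def fps_compose_linear
    by (rule summable_finite[of "{..d}"]) (use deg in \<open>auto simp: coeff_eq_0 not_le\<close>)
  have l1q: "l1_fps (q k)" for k
    unfolding q_def by (intro l1_scalar_mult l1p g)
  let ?w = "\<lambda>k. inverse (u j) ^ k"
  have "(\<Sum>k<?M. fps_const (?w k) * (fps_of_poly p oo (fps_const (u k) * fps_X)))
      = fps_const (of_nat ?M * coeff p j) * fps_X ^ j"
  proof (rule fps_ext)
    fix n
    have swap: "u k ^ n = u n ^ k" for k n unfolding u_def Complex.DeMoivre by (simp add: mult_ac)
    have "fps_nth (\<Sum>k<?M. fps_const (?w k) * (fps_of_poly p oo (fps_const (u k) * fps_X))) n
        = (\<Sum>k<?M. (u n / u j) ^ k) * coeff p n"
      unfolding fps_sum_nth fps_compose_linear sum_distrib_right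
      by (rule sum.cong) (auto simp: swap power_divide field_simps)
    also have "\<dots> = (if n = j then of_nat ?M * coeff p j else 0)"
    proof (cases "n \<le> d")
      case True
      then show ?thesis using sum_roots_of_unity[of n ?M j] j by (simp add: u_def del: sum.lessThan_Suc of_nat_Suc)
    next
      case False
      then show ?thesis using j deg by (simp add: coeff_eq_0)
    qed
    finally show "fps_nth (\<Sum>k<?M. fps_const (?w k) * (fps_of_poly p oo (fps_const (u k) * fps_X))) n
        = fps_nth (fps_const (of_nat ?M * coeff p j) * fps_X ^ j) n" by simp
  qed
  then have "(\<Sum>k<?M. fps_const (?w k *\<^sub>C 1) * q k)
      = fps_const ((of_nat ?M * coeff p j) *\<^sub>C 1) * (scalar (fps_X ^ j) * g)"
    unfolding q_def mult.assoc[symmetric] scalar_const[symmetric] scalar_mult[symmetric]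
      sum_distrib_right[symmetric] scalar_sum[symmetric] by simp
  then have "real ?M * cmod (coeff p j) * l1norm g = l1norm (\<Sum>k<?M. fps_const (?w k *\<^sub>C 1) * q k)"
    using g by (simp add: l1_scaleC_const_mult l1_X_power_mult norm_mult del: sum.lessThan_Suc of_nat_Suc)
  also have "\<dots> \<le> (\<Sum>k<?M. l1norm (fps_const (?w k *\<^sub>C 1) * q k))"
    by (intro l1_sum l1_mult l1q l1_const) simp
  also have "\<dots> = (\<Sum>k<?M. l1norm (q k))"
    by (intro sum.cong refl) (simp add: l1_scaleC_const_mult l1q norm_power norm_inverse u_def)
  finally have sum: "real ?M * cmod (coeff p j) * l1norm g \<le> (\<Sum>k<?M. l1norm (q k))" .
  have "\<exists>k<?M. l1norm g / real ?M \<le> l1norm (q k)"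
  proof (rule ccontr)
    assume "\<not> ?thesis"
    then have "(\<Sum>k<?M. l1norm (q k)) < (\<Sum>k<?M. l1norm g / real ?M)"
      by (intro sum_strict_mono) auto
    then have "real ?M * cmod (coeff p j) * l1norm g < l1norm g" using sum by simp
    moreover have "1 * l1norm g \<le> real ?M * cmod (coeff p j) * l1norm g"
      using j(2) l1norm_nonneg[OF g] by (intro mult_right_mono) (auto simp: field_simps)
    ultimately show False by simp
  qed
  then show ?thesis unfolding q_def u_def by (metis norm_cis)
qed

text \<open>The shift of \<open>l1\<close> has approximate eigenvectors in every cyclic subspace, uniformly: with
  \<open>a = (1 + u X + \<dots> + (u X)\<^sup>N\<^sup>-\<^sup>1) / N\<close> we have \<open>(1 - u X) a = (1 - (u X)\<^sup>N) / N\<close>, so \<open>a\<^sup>k\<^sup>+\<^sup>1 g\<close>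
  is one unless its norm is less than half that of \<open>a\<^sup>k g\<close>. If that happened for all
  \<open>k < m\<close>, then \<open>a\<^sup>m g\<close> would have norm at most \<open>2\<^sup>-\<^sup>m\<close> times that of \<open>g\<close>. But for a suitable \<open>u\<close> of
  modulus one it is at least \<open>1 / (N m + 1)\<close> times that norm, and \<open>m\<close> is chosen with \<open>N m + 1 < 2\<^sup>m\<close>.\<close>

lemma shift_approximate_eigenvector:
  assumes N: "N \<ge> (1 :: nat)"
  obtains \<kappa> :: real where "\<kappa> > 0"
    "\<And>g :: 'a :: complex_normed_vector cbop fps. l1_fps g \<Longrightarrow> \<exists>\<omega> p. cmod \<omega> = 1 \<and> l1_fps p \<and> l1norm p \<le> 1 \<and>
      \<kappa> * l1norm g \<le> l1norm (scalar p * g) \<and>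
      l1norm (scalar (fps_X - fps_const \<omega>) * (scalar p * g))
        \<le> 4 / real N * l1norm (scalar p * g)"
proof -
  have "(\<lambda>m. (real N * real m + 1) / 2 ^ m) \<longlonglongrightarrow> 0"
  proof -
    have "(\<lambda>m. real N * (real m * (1 / 2) ^ m) + (1 / 2) ^ m) \<longlonglongrightarrow> real N * 0 + 0"
      by (intro tendsto_intros powser_times_n_limit_0 LIMSEQ_power_zero) auto
    then show ?thesis by (simp add: add_divide_distrib power_one_over)
  qed
  then have "\<forall>\<^sub>F m in sequentially. (real N * real m + 1) / 2 ^ m < 1" by (rule order_tendstoD) simp
  then obtain m where "(real N * real m + 1) / 2 ^ m < 1"
    using eventually_happens'[OF sequentially_bot] by blast
  then have m: "real (Suc (N * m)) < 2 ^ m" by (simp add: field_simps)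
  define b where "b = (\<Sum>j<N. monom (1 / of_nat N :: complex) j)"
  have degb: "degree b \<le> N"
    unfolding b_def by (rule degree_sum_le) (auto intro: order.trans[OF degree_monom_le])
  have "degree (b ^ m) \<le> N * m"
    by (rule order.trans[OF degree_power_le]) (use degb in auto)
  moreover have "poly (b ^ m) 1 = 1" using N by (simp add: b_def poly_sum poly_monom)
  ultimately have rot: "\<exists>u. cmod u = 1 \<and> l1norm g / real (Suc (N * m))
      \<le> l1norm (scalar (fps_of_poly (b ^ m) oo (fps_const u * fps_X)) * g)"
    if "l1_fps g" for g :: "'a cbop fps"
    using exists_rotation_large[OF that] by blast
  show thesis
  proof (rule that[of "1 / real (Suc (N * m))"])
    show "1 / real (Suc (N * m)) > 0" by (simp del: of_nat_Suc)
  next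
    fix g :: "'a cbop fps" assume g: "l1_fps g"
    obtain u where u: "cmod u = 1"
      and large: "l1norm g / real (Suc (N * m))
        \<le> l1norm (scalar (fps_of_poly (b ^ m) oo (fps_const u * fps_X)) * g)"
      using rot[OF g] by blast
    define y where "y = fps_const u * fps_X"
    define a where "a = fps_of_poly b oo y"
    have a_power: "fps_of_poly (b ^ k) oo y = a ^ k" for k
      unfolding a_def y_def by (simp add: fps_of_poly_power fps_compose_power)
    have y_power: "y ^ k = fps_const (u ^ k) * fps_X ^ k" for k
      by (simp add: y_def power_mult_distrib)
    have a_eq: "a = fps_const (1 / of_nat N) * (\<Sum>j<N. y ^ j)"
    proof (rule fps_ext)
      fix n
      show "fps_nth a n = fps_nth (fps_const (1 / of_nat N) * (\<Sum>j<N. y ^ j)) n"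
        unfolding a_def y_power
        by (simp add: y_def fps_compose_linear b_def coeff_sum fps_sum_nth if_distrib cong: if_cong)
    qed
    have l1Xk: "l1_fps (fps_X ^ k :: complex fps)" "l1norm (fps_X ^ k :: complex fps) \<le> 1" for k
      by (induction k) (simp_all add: l1_X_mult l1norm_one)
    have l1yk: "l1_fps (y ^ k)" "l1norm (y ^ k) \<le> 1" for k
    proof -
      show "l1_fps (y ^ k)" unfolding y_power by (intro l1_mult l1_const l1Xk)
      have "l1norm (y ^ k) \<le> norm (u ^ k) * l1norm (fps_X ^ k :: complex fps)"
        unfolding y_power using l1_mult(2)[OF l1_const(1) l1Xk(1)] by simp
      then show "l1norm (y ^ k) \<le> 1" using u l1Xk(2)[of k] by (simp add: norm_power)
    qed
    have l1sum: "l1_fps (\<Sum>j<N. y ^ j)" "l1norm (\<Sum>j<N. y ^ j) \<le> real N"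
      using l1_sum[of "{..<N}" "\<lambda>j. y ^ j"] l1yk sum_bounded_above[of "{..<N}" "\<lambda>j. l1norm (y ^ j)" 1]
      by auto
    have l1a: "l1_fps a" "l1norm a \<le> 1"
    proof -
      show "l1_fps a" unfolding a_eq by (intro l1_mult l1_const l1sum)
      have "l1norm a \<le> norm (1 / of_nat N :: complex) * real N"
        unfolding a_eq
        by (rule order.trans[OF l1_const_mult(2)[OF l1sum(1)] mult_left_mono[OF l1sum(2)]]) simp
      then show "l1norm a \<le> 1" using N by (simp add: norm_divide)
    qed
    have l1ak: "l1_fps (a ^ k)" "l1norm (a ^ k) \<le> 1" for k
    proof -
      have "l1_fps (a ^ k) \<and> l1norm (a ^ k) \<le> 1"
      proof (induction k)
        case (Suc k)
        have "l1norm (a * a ^ k) \<le> l1norm a * l1norm (a ^ k)" using Suc l1a by (intro l1_mult) auto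
        also have "\<dots> \<le> 1 * 1" using Suc l1a by (intro mult_mono) (auto intro: l1norm_nonneg)
        finally show ?case using l1_mult(1)[of a "a ^ k"] Suc l1a by simp
      qed (simp add: l1norm_one)
      then show "l1_fps (a ^ k)" "l1norm (a ^ k) \<le> 1" by auto
    qed
    define s where "s k = l1norm (scalar (a ^ k) * g)" for k
    have s0: "s 0 = l1norm g" by (simp add: s_def scalar_one fps_one_mult)
    have l1s: "l1_fps (scalar (a ^ k) * g)" for k by (intro l1_scalar_mult l1ak g)
    have s_nonneg: "s k \<ge> 0" for k unfolding s_def by (rule l1norm_nonneg[OF l1s])
    have s_Suc: "s (Suc k) \<le> s k" for k
    proof -
      have "s (Suc k) = l1norm (scalar a * (scalar (a ^ k) * g))"
        by (simp add: s_def scalar_mult mult.assoc)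
      also have "\<dots> \<le> l1norm a * s k" unfolding s_def by (intro l1_scalar_mult l1a l1s)
      also have "\<dots> \<le> s k" using l1a s_nonneg by (simp add: mult_left_le_one_le l1norm_nonneg)
      finally show ?thesis .
    qed
    have s_antimono: "s k' \<le> s k" if "k \<le> k'" for k k'
      using lift_Suc_antimono_le[of s] s_Suc that by blast
    have sm: "l1norm g / real (Suc (N * m)) \<le> s m"
      using large by (simp add: s_def a_power y_def[symmetric])
    have "\<exists>k<m. s k / 2 \<le> s (Suc k)"
    proof (rule ccontr)
      assume neg: "\<not> ?thesis"
      have less: "s (Suc k) < s k / 2" if "k < m" for k using neg that by (auto simp: not_le)
      have "s k \<le> s 0 / 2 ^ k" if "k \<le> m" for k
        using that
      proof (induction k)
        case (Suc k)
        then show ?case using less[of k] by simp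
      qed simp
      then have "s m \<le> l1norm g / 2 ^ m" by (simp add: s0)
      moreover have "m > 0" using m by (cases m) auto
      then have "s 0 > 0" using less[of 0] s_nonneg[of 1] by simp
      then have "l1norm g / 2 ^ m < l1norm g / real (Suc (N * m))"
        using s0 m by (intro divide_strict_left_mono) (simp_all del: of_nat_Suc)
      ultimately show False using sm by linarith
    qed
    then obtain k where k: "k < m" "s k / 2 \<le> s (Suc k)" by blast
    have "(fps_X - fps_const (inverse u)) * a
        = fps_const (- inverse u / of_nat N) * (1 - y ^ N)"
    proof -
      have u0: "u \<noteq> 0" using u by auto
      have "fps_X - fps_const (inverse u) = fps_const (- inverse u) * (1 - y)"
        unfolding y_def right_diff_distrib mult.assoc[symmetric] fps_const_mult
        using u0 by simp
      moreover have "(1 - y) * (\<Sum>j<N. y ^ j) = 1 - y ^ N"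
        by (rule one_diff_power_eq[symmetric])
      then have "(1 - y) * a = fps_const (1 / of_nat N) * (1 - y ^ N)"
        unfolding a_eq by (simp only: mult.left_commute[of "1 - y"])
      ultimately have "(fps_X - fps_const (inverse u)) * a
          = fps_const (- inverse u) * (fps_const (1 / of_nat N) * (1 - y ^ N))"
        by (simp only: mult.assoc)
      then show ?thesis by (simp only: mult.assoc[symmetric] fps_const_mult) simp
    qed
    then have "scalar (fps_X - fps_const (inverse u)) * (scalar (a ^ Suc k) * g)
        = scalar (fps_const (- inverse u / of_nat N) * (1 - y ^ N)) * (scalar (a ^ k) * g)"
      unfolding mult.assoc[symmetric] scalar_mult[symmetric] power_Suc by simp
    also have "l1norm \<dots> \<le> l1norm (fps_const (- inverse u / of_nat N) * (1 - y ^ N)) * s k"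
      unfolding s_def by (intro l1_scalar_mult l1_mult l1_diff l1_const l1yk l1_one l1s)
    also have "\<dots> \<le> (1 / real N * 2) * s k"
    proof (rule mult_right_mono)
      have "l1norm (1 - y ^ N) \<le> 2"
        using l1_diff(2)[OF l1_one l1yk(1), of N] l1yk(2)[of N] by (simp add: l1norm_one)
      moreover have "norm (- inverse u / of_nat N) = 1 / real N"
        using u by (simp add: norm_divide norm_inverse)
      ultimately show "l1norm (fps_const (- inverse u / of_nat N) * (1 - y ^ N)) \<le> 1 / real N * 2"
        using order.trans[OF l1_const_mult(2)[OF l1_diff(1)[OF l1_one l1yk(1)]] mult_left_mono]
        by (metis norm_ge_zero)
    qed (rule s_nonneg)
    also have "\<dots> \<le> (1 / real N * 2) * (2 * s (Suc k))" using k(2) by (intro mult_left_mono) auto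
    also have "\<dots> = 4 / real N * s (Suc k)" by simp
    finally have "l1norm (scalar (fps_X - fps_const (inverse u)) * (scalar (a ^ Suc k) * g))
        \<le> 4 / real N * l1norm (scalar (a ^ Suc k) * g)" by (simp add: s_def)
    moreover have "1 / real (Suc (N * m)) * l1norm g \<le> l1norm (scalar (a ^ Suc k) * g)"
      using sm s_antimono[of "Suc k" m] k(1) by (simp add: s_def)
    moreover have "cmod (inverse u) = 1" using u by (simp add: norm_inverse)
    ultimately show "\<exists>\<omega> p. cmod \<omega> = 1 \<and> l1_fps p \<and> l1norm p \<le> 1 \<and>
      1 / real (Suc (N * m)) * l1norm g \<le> l1norm (scalar p * g) \<and>
      l1norm (scalar (fps_X - fps_const \<omega>) * (scalar p * g))
        \<le> 4 / real N * l1norm (scalar p * g)"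
      using l1ak[of "Suc k"] by blast
  qed
qed

text \<open>If \<open>f\<close> is pointwise invertible on the closed disc, \<open>f h\<close> cannot be small for an approximate
  eigenvector \<open>h\<close> of the shift, on which \<open>f\<close> acts nearly as one of its values. Applied to
  \<open>h = p g\<close> with a scalar series \<open>p\<close> of norm at most \<open>1\<close>, this bounds \<open>f g\<close> from below, since \<open>f h = p f g\<close>.\<close>

lemma l1_multiplication_bounded_below:
  fixes f :: "'a :: complex_banach cbop fps"
  assumes f: "l1_fps f" and inv: "\<And>z. cmod z \<le> 1 \<Longrightarrow> cbop_invertible (fps_value f z)"
  obtains c where "c > 0"
    "\<And>\<rho> g. \<lbrakk>cmod \<rho> \<le> 1; l1_fps g\<rbrakk> \<Longrightarrow> c * l1norm g \<le> l1norm (fps_dilate \<rho> f * g)"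
proof -
  have "bounded ((\<lambda>z. cbop_inv (fps_value f z)) ` cball 0 1)"
    by (intro compact_imp_bounded compact_continuous_image continuous_on_cbop_inv continuous_on_fps_value f) (auto intro: inv)
  then obtain b where b: "b > 0" "\<And>z. cmod z \<le> 1 \<Longrightarrow> norm (cbop_inv (fps_value f z)) \<le> b"
    unfolding bounded_pos by auto
  obtain K where K: "K \<ge> 0" "\<And>\<rho> \<omega> h. \<lbrakk>cmod \<rho> \<le> 1; cmod \<omega> \<le> 1; l1_fps h\<rbrakk> \<Longrightarrow>
      l1norm (fps_dilate \<rho> f * h - fps_const (fps_value f (\<rho> * \<omega>)) * h)
        \<le> K * l1norm (scalar (fps_X - fps_const \<omega>) * h) + 1 / (4 * b) * l1norm h"
    by (rule l1_action_near_value[OF f, of "1 / (4 * b)"]) (use b(1) in auto)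
  \<comment> \<open>Approximate eigenvectors to within \<open>4 / N\<close> are good enough: \<open>f\<close> acts on them as one of its values
      up to an error \<open>1 / (2 b)\<close>, half of the lower bound \<open>1 / b\<close> for that value.\<close>
  define N where "N = Suc (nat \<lceil>16 * K * b\<rceil>)"
  have N: "N \<ge> 1" "real N > 0" by (simp_all add: N_def)
  have "16 * K * b \<le> real (nat \<lceil>16 * K * b\<rceil>)" by (rule real_nat_ceiling_ge)
  then have "16 * K * b \<le> real N" by (simp add: N_def)
  then have KN: "K * (4 / real N) \<le> 1 / (4 * b)" using b(1) N(2) by (simp add: field_simps)
  obtain \<kappa> where \<kappa>: "\<kappa> > 0" "\<And>g :: 'a cbop fps. l1_fps g \<Longrightarrow> \<exists>\<omega> p. cmod \<omega> = 1 \<and> l1_fps p \<and> l1norm p \<le> 1 \<and>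
      \<kappa> * l1norm g \<le> l1norm (scalar p * g) \<and>
      l1norm (scalar (fps_X - fps_const \<omega>) * (scalar p * g))
        \<le> 4 / real N * l1norm (scalar p * g)"
    by (rule shift_approximate_eigenvector[OF N(1)]) auto
  show thesis
  proof (rule that[of "\<kappa> / (2 * b)"])
    show "\<kappa> / (2 * b) > 0" using \<kappa> b by simp
  next
    fix \<rho> and g :: "'a cbop fps" assume \<rho>: "cmod \<rho> \<le> 1" and g: "l1_fps g"
    obtain \<omega> p where \<omega>: "cmod \<omega> = 1" and p: "l1_fps p" "l1norm p \<le> 1"
      and large: "\<kappa> * l1norm g \<le> l1norm (scalar p * g)"
      and eig: "l1norm (scalar (fps_X - fps_const \<omega>) * (scalar p * g))
        \<le> 4 / real N * l1norm (scalar p * g)"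
      using \<kappa>(2)[OF g] by (elim exE conjE)
    define h where "h = scalar p * g"
    have h: "l1_fps h" unfolding h_def by (rule l1_scalar_mult(1)[OF p(1) g])
    let ?f = "fps_dilate \<rho> f" and ?v = "fps_value f (\<rho> * \<omega>)"
    have l1f: "l1_fps ?f" by (rule l1_dilate(1)[OF f \<rho>])
    have \<rho>\<omega>: "cmod (\<rho> * \<omega>) \<le> 1" using \<rho> \<omega> by (simp add: norm_mult)
    have "l1norm (?f * h - fps_const ?v * h)
        \<le> K * (4 / real N * l1norm h) + 1 / (4 * b) * l1norm h"
      using K(2)[OF \<rho> _ h, of \<omega>] \<omega> mult_left_mono[OF eig K(1)] by (simp add: h_def)
    also have "\<dots> \<le> 1 / (4 * b) * l1norm h + 1 / (4 * b) * l1norm h"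
      using mult_right_mono[OF KN l1norm_nonneg[OF h]] by (simp add: mult.assoc)
    finally have near: "l1norm (?f * h - fps_const ?v * h) \<le> 1 / (2 * b) * l1norm h"
      by simp
    have "h = fps_const (cbop_inv ?v) * (fps_const ?v * h)"
      by (simp add: mult.assoc[symmetric] cbop_inv_left[OF inv[OF \<rho>\<omega>]] fps_one_mult)
    then have "l1norm h \<le> norm (cbop_inv ?v) * l1norm (fps_const ?v * h)"
      using l1_const_mult(2)[OF l1_const_mult(1)[OF h]] by metis
    also have "\<dots> \<le> b * l1norm (fps_const ?v * h)"
      using b(2)[OF \<rho>\<omega>] by (intro mult_right_mono l1norm_nonneg l1_const_mult h)
    also have "l1norm (fps_const ?v * h) \<le> l1norm (?f * h) + l1norm (?f * h - fps_const ?v * h)"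
      using l1_diff(2)[OF l1_mult(1)[OF l1f h] l1_diff(1)[OF l1_mult(1)[OF l1f h] l1_const_mult(1)[OF h]]]
      by simp
    also have "l1norm (?f * h) + l1norm (?f * h - fps_const ?v * h)
        \<le> l1norm (?f * h) + 1 / (2 * b) * l1norm h"
      using near by simp
    finally have "l1norm h \<le> b * (l1norm (?f * h) + 1 / (2 * b) * l1norm h)"
      using b(1) by simp
    then have le: "l1norm h \<le> 2 * b * l1norm (?f * h)" using b(1) by (simp add: distrib_left)
    have fh: "?f * h = scalar p * (?f * g)"
      unfolding h_def mult.assoc[symmetric] scalar_commute[of p ?f] ..
    have "l1norm (?f * h) \<le> l1norm (?f * g)"
      unfolding fh
      using l1_scalar_mult(2)[OF p(1) l1_mult(1)[OF l1f g]] p(2) l1norm_nonneg[OF p(1)]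
        l1norm_nonneg[OF l1_mult(1)[OF l1f g]]
      by (meson mult_left_le_one_le order_trans)
    then have "2 * b * l1norm (?f * h) \<le> 2 * b * l1norm (?f * g)"
      using b(1) by (intro mult_left_mono) auto
    then have "\<kappa> * l1norm g \<le> 2 * b * l1norm (?f * g)"
      using large le by (simp add: h_def)
    then show "\<kappa> / (2 * b) * l1norm g \<le> l1norm (?f * g)" using b(1) by (simp add: field_simps)
  qed
qed

lemma l1_dilate_uniformly_continuous:
  fixes f :: "'a :: complex_normed_vector cbop fps"
  assumes f: "l1_fps f" and \<epsilon>: "\<epsilon> > 0"
  obtains d :: real where "d > 0"
    "\<And>x y. \<lbrakk>x \<in> {0..1}; y \<in> {0..1}; \<bar>x - y\<bar> \<le> d\<rbrakk> \<Longrightarrow>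
      l1norm (fps_dilate (of_real x) f - fps_dilate (of_real y) f) \<le> \<epsilon>"
proof -
  obtain N where "\<forall>n\<ge>N. norm (\<Sum>i. norm (fps_nth f (i + n))) < \<epsilon> / 2"
    using suminf_exist_split[of "\<epsilon> / 2", OF _ f[unfolded l1_fps_def]] \<epsilon> by auto
  then have N: "(\<Sum>n. norm (fps_nth f (n + N))) < \<epsilon> / 2" by (auto dest!: spec[of _ N])
  define K where "K = (\<Sum>n<N. real n * norm (fps_nth f n))"
  have K: "K \<ge> 0" by (simp add: K_def sum_nonneg)
  show thesis
  proof (rule that[of "\<epsilon> / (2 * (K + 1))"])
    show "\<epsilon> / (2 * (K + 1)) > 0" using K \<epsilon> by simp
  next
    fix x y :: real assume x: "x \<in> {0..1}" and y: "y \<in> {0..1}" and d: "\<bar>x - y\<bar> \<le> \<epsilon> / (2 * (K + 1))"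
    let ?D = "fps_dilate (of_real x) f - fps_dilate (of_real y) f"
    have nth: "norm (fps_nth ?D n) = \<bar>x ^ n - y ^ n\<bar> * norm (fps_nth f n)" for n
    proof -
      have "fps_nth ?D n = of_real (x ^ n - y ^ n) *\<^sub>C fps_nth f n" by (simp add: scaleC_diff_left)
      then show ?thesis by (simp only: norm_scaleC norm_of_real)
    qed
    have le1: "\<bar>x ^ n - y ^ n\<bar> \<le> 1" for n
    proof -
      have "0 \<le> x ^ n" "x ^ n \<le> 1" "0 \<le> y ^ n" "y ^ n \<le> 1" using x y by (auto intro: power_le_one)
      then show ?thesis by linarith
    qed
    have len: "\<bar>x ^ n - y ^ n\<bar> \<le> real n * \<bar>x - y\<bar>" for n
      using norm_power_diff[of x y n] x y by simp
    have D: "l1_fps ?D" using x y by (intro l1_diff l1_dilate f) auto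
    have "l1norm ?D = (\<Sum>n. norm (fps_nth ?D (n + N))) + (\<Sum>n<N. norm (fps_nth ?D n))"
      unfolding l1norm_def using D unfolding l1_fps_def by (rule suminf_split_initial_segment)
    also have "(\<Sum>n. norm (fps_nth ?D (n + N))) \<le> (\<Sum>n. norm (fps_nth f (n + N)))"
    proof (rule suminf_le)
      show "norm (fps_nth ?D (n + N)) \<le> norm (fps_nth f (n + N))" for n
        unfolding nth using le1 by (intro mult_left_le_one_le) auto
      show "summable (\<lambda>n. norm (fps_nth ?D (n + N)))" "summable (\<lambda>n. norm (fps_nth f (n + N)))"
        by (rule D[unfolded l1_fps_def, THEN summable_ignore_initial_segment]
            f[unfolded l1_fps_def, THEN summable_ignore_initial_segment])+
    qed
    also have "(\<Sum>n<N. norm (fps_nth ?D n)) \<le> (\<Sum>n<N. real n * \<bar>x - y\<bar> * norm (fps_nth f n))"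
      unfolding nth using len by (intro sum_mono mult_right_mono) auto
    also have "\<dots> = K * \<bar>x - y\<bar>" by (simp add: K_def sum_distrib_left mult_ac)
    also have "\<dots> \<le> K * (\<epsilon> / (2 * (K + 1)))" using d K by (intro mult_left_mono)
    also have "\<dots> \<le> \<epsilon> / 2" using K \<epsilon> by (simp add: field_simps)
    finally show "l1norm ?D \<le> \<epsilon>" using N by simp
  qed
qed

text \<open>Wiener's lemma. Let \<open>g\<close> be the formal inverse and let \<open>f\<^sub>\<rho>\<close>, \<open>g\<^sub>\<rho>\<close> be the dilated series. If
  \<open>g\<^sub>\<rho>\<close> is summable, then \<open>c \<parallel>g\<^sub>\<rho>\<parallel> \<le> \<parallel>f\<^sub>\<rho> g\<^sub>\<rho>\<parallel> \<le> 1\<close> with a constant that does not depend on \<open>\<rho>\<close>, and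
  then \<open>g\<^sub>\<rho>\<^sub>' = g\<^sub>\<rho> + g\<^sub>\<rho> (f\<^sub>\<rho> - f\<^sub>\<rho>\<^sub>') g\<^sub>\<rho>\<^sub>'\<close> shows that \<open>g\<^sub>\<rho>\<^sub>'\<close> is summable for all \<open>\<rho>'\<close> within a fixed distance
  of \<open>\<rho>\<close>. So summability propagates from \<open>\<rho> = 0\<close> to \<open>\<rho> = 1\<close> in finitely many steps.\<close>

lemma Wiener_lemma:
  fixes f :: "'a :: complex_banach cbop fps"
  assumes f: "l1_fps f" and inv: "\<And>z. cmod z \<le> 1 \<Longrightarrow> cbop_invertible (fps_value f z)"
  obtains g where "l1_fps g" "f * g = 1" "g * f = 1"
proof -
  have "fps_value f 0 = fps_nth f 0"
    using suminf_finite[of "{0}" "\<lambda>n. (0 :: complex) ^ n *\<^sub>C fps_nth f n"]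
    by (simp add: fps_value_def)
  then have "cbop_invertible (fps_nth f 0)" using inv[of 0] by simp
  then obtain g where g: "f * g = 1" "g * f = 1"
    using formal_inverse[of f] unfolding cbop_invertible_def by blast
  obtain c where c: "c > 0"
    "\<And>\<rho> g. \<lbrakk>cmod \<rho> \<le> 1; l1_fps g\<rbrakk> \<Longrightarrow> c * l1norm g \<le> l1norm (fps_dilate \<rho> f * g)"
    by (rule l1_multiplication_bounded_below[OF f inv]) auto
  obtain d where d: "d > 0" "\<And>x y. \<lbrakk>x \<in> {0..1}; y \<in> {0..1}; \<bar>x - y\<bar> \<le> d\<rbrakk> \<Longrightarrow>
      l1norm (fps_dilate (of_real x) f - fps_dilate (of_real y) f) \<le> c / 2"
    by (rule l1_dilate_uniformly_continuous[OF f, of "c / 2"]) (use c(1) in auto)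
  let ?f = "\<lambda>x :: real. fps_dilate (of_real x) f" and ?g = "\<lambda>x :: real. fps_dilate (of_real x) g"
  have fg: "?f x * ?g x = 1" and gf: "?g x * ?f x = 1" for x
    by (simp_all add: g flip: fps_dilate_mult)
  have step: "l1_fps (?g y)" if x: "x \<in> {0..1}" and y: "y \<in> {0..1}" and xy: "\<bar>x - y\<bar> \<le> d"
    and gx: "l1_fps (?g x)" for x y
  proof -
    have "c * l1norm (?g x) \<le> l1norm (?f x * ?g x)" using x by (intro c(2) gx) auto
    also have "\<dots> \<le> 1" by (simp add: fg l1norm_one norm_one_cbop_le)
    finally have gx_le: "l1norm (?g x) * (c / 2) \<le> 1 / 2" by (simp add: mult.commute)
    let ?D = "?g x * (?f x - ?f y)"
    have "?g x * ?f x * ?g y = ?g y" "?g x * (?f y * ?g y) = ?g x" by (simp_all add: fg gf fps_one_mult)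
    then have eq: "?g y = ?g x + ?D * ?g y"
      by (simp add: left_diff_distrib right_diff_distrib mult.assoc)
    have l1D: "l1_fps (?f x - ?f y)" using x y by (intro l1_diff l1_dilate f) auto
    have "l1norm ?D \<le> l1norm (?g x) * l1norm (?f x - ?f y)" by (rule l1_mult(2)[OF gx l1D])
    also have "\<dots> \<le> l1norm (?g x) * (c / 2)"
      by (intro mult_left_mono d(2) x y xy l1norm_nonneg gx)
    finally have D: "l1norm ?D \<le> 1 / 2" using gx_le by simp
    have "l1norm_upto n (?g y) \<le> 2 * l1norm (?g x)" for n
    proof -
      have "l1norm_upto n (?g y) \<le> l1norm_upto n (?g x) + l1norm_upto n (?D * ?g y)"
        by (subst eq) (rule l1norm_upto_add)
      also have "l1norm_upto n (?g x) \<le> l1norm (?g x)" by (rule l1norm_upto_le[OF gx])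
      also have "l1norm_upto n (?D * ?g y) \<le> l1norm_upto n ?D * l1norm_upto n (?g y)"
        by (rule l1norm_upto_mult)
      also have "\<dots> \<le> 1 / 2 * l1norm_upto n (?g y)"
        using l1norm_upto_le[OF l1_mult(1)[OF gx l1D], of n] D
        by (intro mult_right_mono l1norm_upto_nonneg) simp
      finally show ?thesis by simp
    qed
    then show ?thesis by (rule l1_boundedI)
  qed
  have "l1_fps (?g (min 1 (real k * d)))" for k
  proof (induction k)
    case 0
    have "fps_nth (?g 0) n = 0" if "n > 0" for n using that by simp
    then show ?case unfolding l1_fps_def
      by (intro summable_finite[of "{0}"]) auto
  next
    case (Suc k)
    show ?case
    proof (rule step[OF _ _ _ Suc])
      show "\<bar>min 1 (real k * d) - min 1 (real (Suc k) * d)\<bar> \<le> d"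
        using d(1) by (simp add: min_def distrib_right)
    qed (use d(1) in auto)
  qed
  moreover obtain k :: nat where "1 < real k * d" using reals_Archimedean3[OF d(1)] by blast
  ultimately have "l1_fps (?g 1)" by (metis min.strict_order_iff)
  then show thesis using that g by simp
qed

section \<open>First moments and tails\<close>

lemma summable_first_moment:
  fixes r :: "nat \<Rightarrow> real"
  assumes nonneg: "\<And>n. n \<ge> 1 \<Longrightarrow> r n \<ge> 0" and r: "summable r"
    and tails: "summable (\<lambda>n. \<Sum>k. r (n + Suc k))"
  shows "summable (\<lambda>n. real n * r n)"
proof (rule bounded_imp_summable)
  show "0 \<le> real n * r n" for n using nonneg[of n] by (cases n) auto
  let ?t = "\<lambda>n. \<Sum>k. r (n + Suc k)"
  have s: "summable (\<lambda>k. r (n + Suc k))" for n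
    using summable_ignore_initial_segment[OF r, of "Suc n"] by (simp add: add.commute)
  show "(\<Sum>n\<le>K. real n * r n) \<le> suminf ?t" for K
  proof -
    have "(\<Sum>n\<le>K. real n * r n) = (\<Sum>n\<le>K. \<Sum>k<n. r n)" by simp
    also have "\<dots> = (\<Sum>k<K. \<Sum>n = Suc k..K. r n)" by (rule sum.nested_swap')
    also have "\<dots> \<le> (\<Sum>k<K. ?t k)"
    proof (rule sum_mono)
      fix k
      have "(\<Sum>n = Suc k..K. r n) = (\<Sum>j<K - k. r (k + Suc j))"
        by (rule sum.reindex_bij_witness[of _ "\<lambda>j. k + Suc j" "\<lambda>n. n - Suc k"]) auto
      also have "\<dots> \<le> ?t k" by (rule sum_le_suminf[OF s]) (auto intro: nonneg)
      finally show "(\<Sum>n = Suc k..K. r n) \<le> ?t k" .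
    qed
    also have "\<dots> \<le> suminf ?t"
      by (rule sum_le_suminf[OF tails]) (rule finite_lessThan, rule suminf_nonneg[OF s], simp add: nonneg)
    finally show ?thesis .
  qed
qed

definition fps_tails :: "'b :: real_normed_vector fps \<Rightarrow> 'b fps"
  where "fps_tails f = Abs_fps (\<lambda>k. \<Sum>j. fps_nth f (k + Suc j))"

text \<open>The constant term is required to vanish so that the first moment dominates the \<open>l1\<close> norm.\<close>

definition finite_moment :: "'b :: real_normed_vector fps \<Rightarrow> bool"
  where "finite_moment f \<longleftrightarrow> fps_nth f 0 = 0 \<and> summable (\<lambda>n. real n * norm (fps_nth f n))"

definition moment :: "'b :: real_normed_vector fps \<Rightarrow> real"
  where "moment f = (\<Sum>n. real n * norm (fps_nth f n))"

lemma finite_moment_imp_l1: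
  assumes "finite_moment f"
  shows "l1_fps f" "l1norm f \<le> moment f"
proof -
  have le: "norm (fps_nth f n) \<le> real n * norm (fps_nth f n)" for n
    using assms mult_right_mono[of 1 "real n" "norm (fps_nth f n)"]
    by (cases n) (auto simp: finite_moment_def)
  show l1: "l1_fps f"
    using assms unfolding l1_fps_def finite_moment_def
    by (auto intro!: summable_comparison_test'[of "\<lambda>n. real n * norm (fps_nth f n)" 0] le)
  then show "l1norm f \<le> moment f"
    using assms unfolding l1norm_def moment_def finite_moment_def l1_fps_def
    by (intro suminf_le le) auto
qed

lemma finite_moment_diff:
  assumes "finite_moment f" "finite_moment g"
  shows "finite_moment (f - g)"
proof -
  have "summable (\<lambda>n. real n * norm (fps_nth f n) + real n * norm (fps_nth g n))"
    using assms by (intro summable_add) (auto simp: finite_moment_def)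
  then have "summable (\<lambda>n. real n * norm (fps_nth (f - g) n))"
    by (rule summable_comparison_test'[of _ 0])
      (simp add: norm_triangle_ineq4 mult_left_mono flip: distrib_left)
  then show ?thesis using assms by (simp add: finite_moment_def)
qed

lemma summable_tail:
  fixes x :: "nat \<Rightarrow> 'b :: real_normed_vector"
  shows "summable x \<Longrightarrow> summable (\<lambda>j. x (k + Suc j))"
  using summable_ignore_initial_segment[of x "Suc k"] by (simp add: add.commute)

lemma l1_tails:
  fixes f :: "'b :: banach fps"
  assumes f: "finite_moment f"
  shows "l1_fps (fps_tails f)" "l1norm (fps_tails f) \<le> moment f"
proof -
  let ?x = "\<lambda>n. norm (fps_nth f n)"
  have x: "summable ?x" using finite_moment_imp_l1(1)[OF f] by (simp add: l1_fps_def)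
  have m: "summable (\<lambda>n. real n * ?x n)" using f by (simp add: finite_moment_def)
  have "l1norm_upto n (fps_tails f) \<le> moment f" for n
  proof -
    have nth: "norm (fps_nth (fps_tails f) k) \<le> (\<Sum>j. if k < j then ?x j else 0)" for k
    proof -
      let ?y = "\<lambda>j. if k < j then ?x j else 0"
      have y: "summable ?y" by (rule summable_comparison_test'[OF x, of 0]) simp
      have "norm (fps_nth (fps_tails f) k) \<le> (\<Sum>j. ?x (k + Suc j))"
        unfolding fps_tails_def fps_nth_Abs_fps by (rule summable_norm[OF summable_tail[OF x]])
      also have "\<dots> = suminf ?y"
        using suminf_split_initial_segment[OF y, of "Suc k"] by (simp add: add.commute)
      finally show ?thesis .
    qed
    have y: "summable (\<lambda>j. if k < j then ?x j else 0)" for k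
      by (rule summable_comparison_test'[OF x, of 0]) simp
    have "l1norm_upto n (fps_tails f) \<le> (\<Sum>k\<le>n. \<Sum>j. if k < j then ?x j else 0)"
      unfolding l1norm_upto_def by (intro sum_mono nth)
    also have "\<dots> = (\<Sum>j. \<Sum>k\<le>n. if k < j then ?x j else 0)"
      by (rule suminf_sum[symmetric]) (rule y)
    also have "\<dots> \<le> (\<Sum>j. real j * ?x j)"
    proof (rule suminf_le)
      show "(\<Sum>k\<le>n. if k < j then ?x j else 0) \<le> real j * ?x j" for j
      proof -
        have "(\<Sum>k\<le>n. if k < j then ?x j else 0) = (\<Sum>k\<in>{..n} \<inter> {..<j}. ?x j)"
          by (subst sum.inter_restrict) auto
        also have "\<dots> \<le> (\<Sum>k<j. ?x j)" by (rule sum_mono2) auto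
        finally show ?thesis by simp
      qed
    qed (auto intro!: summable_sum y m)
    finally show ?thesis by (simp add: moment_def)
  qed
  then show "l1_fps (fps_tails f)" "l1norm (fps_tails f) \<le> moment f" by (rule l1_boundedI)+
qed

lemma fps_tails_diff:
  fixes f g :: "'b :: banach fps"
  assumes "l1_fps f" "l1_fps g"
  shows "fps_tails (f - g) = fps_tails f - fps_tails g"
proof -
  have "summable (\<lambda>j. fps_nth f (k + Suc j))" "summable (\<lambda>j. fps_nth g (k + Suc j))" for k
    by (rule assms[unfolded l1_fps_def, THEN summable_norm_cancel, THEN summable_tail])+
  then show ?thesis by (simp add: fps_eq_iff fps_tails_def suminf_diff)
qed

lemma fps_tails_nth_diff:
  fixes f :: "'b :: banach fps"
  assumes "l1_fps f"
  shows "fps_nth (fps_tails f) k = fps_nth f (Suc k) + fps_nth (fps_tails f) (Suc k)"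
proof -
  have "summable (\<lambda>j. fps_nth f (k + Suc j))"
    by (rule summable_tail[OF summable_norm_cancel[OF assms[unfolded l1_fps_def]]])
  from suminf_split_head[OF this] show ?thesis by (simp add: fps_tails_def)
qed

abbreviation one_minus_X :: "complex \<Rightarrow> 'a :: complex_normed_vector cbop fps"
  where "one_minus_X q \<equiv> scalar (1 - fps_const q * fps_X)"

lemma one_minus_X_mult: "one_minus_X q * f = f - fps_const (q *\<^sub>C 1) * (fps_X * f)"
  by (simp add: scalar_diff scalar_one scalar_mult scalar_const scalar_X
      left_diff_distrib fps_one_mult mult.assoc)

text \<open>Dividing \<open>f(1) - f\<close> by \<open>1 - X\<close> costs one moment and leaves a summable series.\<close>

lemma one_minus_X_tails:
  fixes f :: "'a :: complex_banach cbop fps"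
  assumes f: "l1_fps f" and f0: "fps_nth f 0 = 0"
  shows "one_minus_X 1 * fps_tails f = fps_const (fps_value f 1) - f"
proof (rule fps_ext)
  fix n
  have eq: "one_minus_X 1 * fps_tails f = fps_tails f - fps_X * fps_tails f"
    using one_minus_X_mult[of 1 "fps_tails f"] by (simp add: fps_one_mult)
  have "fps_value f 1 = fps_nth (fps_tails f) 0"
    using suminf_split_head[of "fps_nth f"] f f0 summable_norm_cancel[of "fps_nth f"]
    by (simp add: fps_value_def fps_tails_def l1_fps_def)
  then show "fps_nth (one_minus_X 1 * fps_tails f) n = fps_nth (fps_const (fps_value f 1) - f) n"
    using fps_tails_nth_diff[OF f, of "n - 1"] f0 unfolding eq by (cases n) simp_all
qed

text \<open>Summation by parts: the sum of the first \<open>K\<close> tails is that of the terms \<open>n f\<^sub>n\<close> with \<open>n \<le> K\<close> plus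
  \<open>K\<close> times the tail beyond \<open>K\<close>, and the latter vanishes in the limit by the finite first moment.\<close>

lemma fps_value_tails_1:
  fixes f :: "'a :: complex_banach cbop fps"
  assumes f: "finite_moment f"
  shows "fps_value (fps_tails f) 1 = (\<Sum>n. real (Suc n) *\<^sub>R fps_nth f (Suc n))"
proof -
  let ?u = "fps_nth (fps_tails f)" and ?x = "\<lambda>n. real n * norm (fps_nth f n)"
  note l1 = finite_moment_imp_l1(1)[OF f] l1_tails(1)[OF f]
  have m: "summable ?x" using f by (simp add: finite_moment_def)
  have partial: "(\<Sum>k<K. ?u k) - real K *\<^sub>R ?u K = (\<Sum>n<K. real (Suc n) *\<^sub>R fps_nth f (Suc n))" for K
  proof (induction K)
    case (Suc K)
    have "(\<Sum>k<Suc K. ?u k) - real (Suc K) *\<^sub>R ?u (Suc K)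
        = ((\<Sum>k<K. ?u k) - real K *\<^sub>R ?u K) + real (Suc K) *\<^sub>R (?u K - ?u (Suc K))"
      by (simp add: algebra_simps)
    also have "?u K - ?u (Suc K) = fps_nth f (Suc K)" using fps_tails_nth_diff[OF l1(1), of K] by simp
    finally show ?case using Suc.IH by simp
  qed simp
  have "(\<lambda>K. real K *\<^sub>R ?u K) \<longlonglongrightarrow> 0"
  proof (rule LIMSEQ_I)
    fix e :: real assume "e > 0"
    then obtain N where N: "\<And>n. n \<ge> N \<Longrightarrow> norm (\<Sum>i. ?x (i + n)) < e"
      using suminf_exist_split[OF _ m] by blast
    have "norm (real K *\<^sub>R ?u K) < e" if K: "K \<ge> N" for K
    proof -
      have sx: "summable (\<lambda>j. norm (fps_nth f (K + Suc j)))"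
        using l1(1) unfolding l1_fps_def by (rule summable_tail)
      have "norm (real K *\<^sub>R ?u K) \<le> real K * (\<Sum>j. norm (fps_nth f (K + Suc j)))"
        using summable_norm[OF sx] by (simp add: fps_tails_def mult_left_mono)
      also have "\<dots> = (\<Sum>j. real K * norm (fps_nth f (K + Suc j)))"
        by (rule suminf_mult[OF sx, symmetric])
      also have "\<dots> \<le> (\<Sum>j. ?x (j + Suc K))"
      proof (rule suminf_le)
        show "real K * norm (fps_nth f (K + Suc j)) \<le> ?x (j + Suc K)" for j
          by (simp add: add.commute mult_right_mono)
        show "summable (\<lambda>j. real K * norm (fps_nth f (K + Suc j)))" by (rule summable_mult[OF sx])
        show "summable (\<lambda>j. ?x (j + Suc K))" by (rule summable_ignore_initial_segment[OF m])
      qed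
      also have "\<dots> < e" using N[of "Suc K"] K by simp
      finally show ?thesis .
    qed
    then show "\<exists>N. \<forall>K\<ge>N. norm (real K *\<^sub>R ?u K - 0) < e" by auto
  qed
  moreover have "(\<lambda>K. \<Sum>k<K. ?u k) \<longlonglongrightarrow> fps_value (fps_tails f) 1"
    using summable_LIMSEQ[OF summable_norm_cancel[OF l1(2)[unfolded l1_fps_def]]]
    by (simp add: fps_value_def)
  ultimately have "(\<lambda>K. (\<Sum>k<K. ?u k) - real K *\<^sub>R ?u K) \<longlonglongrightarrow> fps_value (fps_tails f) 1 - 0"
    by (intro tendsto_diff)
  then have "(\<lambda>n. real (Suc n) *\<^sub>R fps_nth f (Suc n)) sums fps_value (fps_tails f) 1"
    by (simp only: partial sums_def diff_0_right)
  then show ?thesis by (simp add: sums_iff)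
qed

section \<open>Geometric series\<close>

definition geometric_fps :: "complex \<Rightarrow> complex fps"
  where "geometric_fps q = Abs_fps (\<lambda>n. q ^ n)"

lemma geometric_fps_mult: "geometric_fps q * (1 - fps_const q * fps_X) = 1"
proof (rule fps_ext)
  fix n
  have "fps_nth ((1 - fps_const q * fps_X) * geometric_fps q) n = fps_nth 1 n"
    by (cases n) (simp_all add: geometric_fps_def left_diff_distrib mult.assoc)
  then show "fps_nth (geometric_fps q * (1 - fps_const q * fps_X)) n = fps_nth 1 n"
    by (simp only: mult.commute)
qed

lemma scalar_geometric_fps_mult:
  "scalar (geometric_fps q) * (one_minus_X q * f) = (f :: 'a :: complex_normed_vector cbop fps)"
  "one_minus_X q * (scalar (geometric_fps q) * f) = f"
proof -
  have "scalar (geometric_fps q) * (one_minus_X q * f) = f"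
    unfolding mult.assoc[symmetric] scalar_mult[symmetric] geometric_fps_mult
    by (simp add: scalar_one fps_one_mult)
  moreover have "one_minus_X q * (scalar (geometric_fps q) * f) = f"
    unfolding mult.assoc[symmetric] scalar_mult[symmetric] mult.commute[of "1 - _" "geometric_fps q"]
      geometric_fps_mult by (simp add: scalar_one fps_one_mult)
  ultimately show "scalar (geometric_fps q) * (one_minus_X q * f) = f"
    "one_minus_X q * (scalar (geometric_fps q) * f) = f" by auto
qed

lemma l1_geometric_fps:
  assumes "cmod q < 1"
  shows "l1_fps (geometric_fps q)" "l1norm (geometric_fps q) = 1 / (1 - cmod q)"
  using geometric_sums[of "cmod q"] assms
  by (simp_all add: l1_fps_def l1norm_def geometric_fps_def norm_power sums_iff)

lemma l1_one_minus_const_X: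
  "l1_fps (1 - fps_const q * fps_X :: complex fps)"
  "l1norm (1 - fps_const q * fps_X :: complex fps) \<le> 1 + cmod q"
proof -
  have X: "l1_fps (fps_const q * fps_X)" "l1norm (fps_const q * fps_X) \<le> cmod q"
    using l1_const_mult[OF l1_fps_X, of q] l1_X_mult(2)[of "1 :: complex fps"]
    by (simp_all add: l1norm_one)
  show "l1_fps (1 - fps_const q * fps_X :: complex fps)" by (intro l1_diff X) simp
  show "l1norm (1 - fps_const q * fps_X :: complex fps) \<le> 1 + cmod q"
    using l1_diff(2)[OF l1_one X(1)] X(2) by (simp add: l1norm_one)
qed

text \<open>Unlike the geometric series, this quotient stays bounded as long as \<open>q\<close> approaches \<open>1\<close>
  nontangentially.\<close>

lemma l1_geometric_fps_one_minus_X: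
  assumes "cmod q < 1"
  shows "l1_fps (geometric_fps q * (1 - fps_X))"
    "l1norm (geometric_fps q * (1 - fps_X)) \<le> 1 + cmod (1 - q) / (1 - cmod q)"
proof -
  have "geometric_fps q * (1 - fps_X)
      = geometric_fps q * (1 - fps_const q * fps_X) - fps_const (1 - q) * (fps_X * geometric_fps q)"
    by (simp add: algebra_simps flip: fps_const_sub)
  then have eq: "geometric_fps q * (1 - fps_X) = 1 - fps_const (1 - q) * (fps_X * geometric_fps q)"
    by (simp only: geometric_fps_mult)
  note X = l1_X_mult[OF l1_geometric_fps(1)[OF assms]]
  show "l1_fps (geometric_fps q * (1 - fps_X))"
    unfolding eq by (intro l1_diff l1_const_mult X) simp
  show "l1norm (geometric_fps q * (1 - fps_X)) \<le> 1 + cmod (1 - q) / (1 - cmod q)"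
    unfolding eq
    using l1_diff(2)[OF l1_one l1_const_mult(1)[OF X(1)], of "1 - q"] l1_const_mult(2)[OF X(1), of "1 - q"]
    by (simp add: X(2) l1_geometric_fps[OF assms] l1norm_one)
qed

lemma l1_one_minus_X_mult:
  fixes f :: "'a :: complex_normed_vector cbop fps"
  assumes "l1_fps f"
  shows "l1_fps (one_minus_X q * f)" "l1norm (one_minus_X q * f) \<le> (1 + cmod q) * l1norm f"
proof -
  show "l1_fps (one_minus_X q * f)" by (intro l1_scalar_mult l1_one_minus_const_X assms)
  show "l1norm (one_minus_X q * f) \<le> (1 + cmod q) * l1norm f"
    by (rule order.trans[OF l1_scalar_mult(2)[OF l1_one_minus_const_X(1) assms]])
      (intro mult_right_mono l1_one_minus_const_X l1norm_nonneg assms)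
qed

lemma fps_value_one_minus_X_mult:
  fixes f :: "'a :: complex_banach cbop fps"
  assumes "l1_fps f" "cmod z \<le> 1"
  shows "fps_value (one_minus_X q * f) z = (1 - q * z) *\<^sub>C fps_value f z"
proof -
  have c: "abs_conv z (fps_X * f)" "abs_conv z f"
    by (intro l1_imp_abs_conv l1_X_mult assms)+
  have cc: "abs_conv z (fps_const (q *\<^sub>C 1))" "abs_conv z fps_X"
    "abs_conv z (fps_const (q *\<^sub>C 1) * (fps_X * f))"
    by (intro l1_imp_abs_conv assms l1_const_mult l1_X_mult | simp)+
  show ?thesis
    unfolding one_minus_X_mult
    by (simp add: fps_value_diff[OF c(2) cc(3)] fps_value_mult[OF cc(1) c(1)] fps_value_mult[OF cc(2) c(2)]
        scaleC_diff_left scaleC_mult_left scaleC_scaleC)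
qed

section \<open>Factorization and asymptotics of renewal series\<close>

text \<open>With \<open>A = 1 - f\<close>, the eigenvalue equation for \<open>f(1)\<close> turns \<open>A E\<close> into \<open>(1 - l) E\<close> plus a multiple of
  \<open>1 - X\<close>, and dividing both by \<open>1 - q X\<close> gives the last factor on the right. The
  corrected eigenvectors \<open>(1 - (1 - X) Y) E\<close> serve to make this factor continuous at \<open>q = 1\<close> in the
  \<open>l1\<close> norm, for the right choice of \<open>Y\<close>.\<close>

lemma renewal_factorization:
  fixes f :: "'a :: complex_banach cbop fps"
  assumes f: "l1_fps f" "fps_nth f 0 = 0" and E: "fps_value f 1 * E = l *\<^sub>C E"
  shows "(1 - f) * (one_minus_X q * fps_const Q + fps_const E - one_minus_X 1 * fps_const (Y * E))
    = one_minus_X q * ((1 - f) * fps_const Q + scalar (geometric_fps q)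
      * (fps_const ((1 - l) *\<^sub>C E) + one_minus_X 1 * ((fps_tails f - (1 - f) * fps_const Y) * fps_const E)))"
proof -
  let ?U = "fps_tails f" and ?D = "one_minus_X 1"
  have "1 - f = fps_const (1 - fps_value f 1) + ?D * ?U"
    unfolding one_minus_X_tails[OF f] fps_const_sub[symmetric] by simp
  then have "(1 - f) * fps_const E = fps_const ((1 - fps_value f 1) * E) + ?D * (?U * fps_const E)"
    by (simp only: distrib_right fps_const_mult mult.assoc)
  also have "(1 - fps_value f 1) * E = (1 - l) *\<^sub>C E"
    by (simp add: left_diff_distrib E scaleC_diff_left)
  finally have AE: "(1 - f) * fps_const E = fps_const ((1 - l) *\<^sub>C E) + ?D * (?U * fps_const E)" .
  have comm: "(1 - f) * (scalar p * h) = scalar p * ((1 - f) * h)" for p h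
    unfolding mult.assoc[symmetric] scalar_commute[of p "1 - f"] ..
  have "(1 - f) * (one_minus_X q * fps_const Q + fps_const E - ?D * fps_const (Y * E))
      = one_minus_X q * ((1 - f) * fps_const Q) + (1 - f) * fps_const E - ?D * ((1 - f) * fps_const (Y * E))"
    by (simp only: right_diff_distrib[of "1 - f"] distrib_left[of "1 - f"] comm)
  also have "\<dots> = one_minus_X q * ((1 - f) * fps_const Q) + (fps_const ((1 - l) *\<^sub>C E)
      + ?D * ((?U - (1 - f) * fps_const Y) * fps_const E))"
    unfolding AE fps_const_mult[symmetric] left_diff_distrib[of ?U] right_diff_distrib[of ?D] mult.assoc
    by (simp only: add_diff_eq add.assoc)
  finally show ?thesis by (simp only: distrib_left[of "one_minus_X q"] scalar_geometric_fps_mult)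
qed

text \<open>If \<open>A J = (1 - q X) (B + \<Delta>)\<close> with \<open>\<Delta>\<close> small, then \<open>J B\<^sup>-\<^sup>1\<close> approximates \<open>(1 - q X) A\<^sup>-\<^sup>1\<close>. The estimate
  uses truncated norms because the summability of the latter series is part of the conclusion.\<close>

lemma approximate_factor_inverse:
  fixes A J T B \<Delta> g :: "'a :: complex_normed_vector cbop fps"
  assumes TA: "T * A = 1" and Bg: "B * g = 1" and AJ: "A * J = one_minus_X q * (B + \<Delta>)"
    and l1: "l1_fps (J * g)" "l1_fps (\<Delta> * g)" and small: "l1norm (\<Delta> * g) \<le> 1 / 2"
  shows "l1_fps (one_minus_X q * T)"
    "l1norm (one_minus_X q * T - J * g) \<le> 2 * l1norm (\<Delta> * g) * l1norm (J * g)"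
proof -
  let ?D = "one_minus_X q * T" and ?k = "\<Delta> * g"
  have "J * g = (T * A) * J * g" by (simp add: TA fps_one_mult)
  also have "\<dots> = T * (A * J) * g" by (simp only: mult.assoc)
  also have "\<dots> = T * one_minus_X q * (B * g + \<Delta> * g)"
    unfolding AJ by (simp only: mult.assoc distrib_right distrib_left)
  also have "\<dots> = ?D + ?D * ?k"
    unfolding Bg scalar_commute[of _ T, symmetric] by (simp add: distrib_left fps_one_mult)
  finally have eq: "?D = J * g + (- ?D) * ?k" by (simp add: algebra_simps)
  have "l1norm_upto n ?D \<le> 2 * l1norm (J * g)" for n
  proof -
    have "l1norm_upto n ?D \<le> l1norm_upto n (J * g) + l1norm_upto n ((- ?D) * ?k)"
      by (subst eq) (rule l1norm_upto_add)
    also have "l1norm_upto n ((- ?D) * ?k) \<le> l1norm_upto n (- ?D) * l1norm_upto n ?k"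
      by (rule l1norm_upto_mult)
    also have "\<dots> \<le> l1norm_upto n ?D * (1 / 2)"
      using l1norm_upto_le[OF l1(2), of n] small
      by (intro mult_mono) (auto simp: l1norm_upto_def sum_nonneg)
    finally show ?thesis using l1norm_upto_le[OF l1(1), of n] by simp
  qed
  note bounded = l1_boundedI[OF this]
  show D: "l1_fps ?D" by (rule bounded(1))
  have "?D - J * g = - (?D * ?k)" using eq by (simp add: algebra_simps)
  then have "l1norm (?D - J * g) = l1norm (?D * ?k)" by (simp add: l1_minus)
  also have "\<dots> \<le> l1norm ?D * l1norm ?k" by (rule l1_mult(2)[OF D l1(2)])
  also have "\<dots> \<le> 2 * l1norm (J * g) * l1norm ?k"
    by (intro mult_right_mono bounded(2) l1norm_nonneg l1)
  finally show "l1norm (?D - J * g) \<le> 2 * l1norm ?k * l1norm (J * g)" by (simp add: mult_ac)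
qed

text \<open>The coefficients of \<open>D / (1 - q X)\<close> are \<open>\<Sum>\<^sub>k\<^sub>\<le>\<^sub>n q\<^sup>n\<^sup>-\<^sup>k D\<^sub>k\<close>. Replacing \<open>D\<close> by \<open>D0\<close>, the power \<open>q\<^sup>n\<^sup>-\<^sup>k\<close> by
  \<open>q\<^sup>n\<close>, and the sum over \<open>k \<le> n\<close> by the sum over all \<open>k\<close>, costs one of the three error terms each.\<close>

lemma geometric_convolution_asymptotics:
  fixes D D0 :: "'a :: complex_banach cbop fps"
  assumes q: "cmod q \<le> 1" and D: "l1_fps D" and D0: "l1_fps D0"
  shows "norm (fps_nth (scalar (geometric_fps q) * D) n - q ^ n *\<^sub>C fps_value D0 1)
    \<le> l1norm (D - D0) + (\<Sum>k. cmod (1 - q ^ k) * norm (fps_nth D0 k))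
      + (\<Sum>k. norm (fps_nth D0 (k + Suc n)))"
proof -
  have qn: "cmod (q ^ k) \<le> 1" for k using q by (simp add: norm_power power_le_one)
  let ?d = "fps_nth D0" and ?e = "fps_nth (D - D0)"
  have s: "summable (\<lambda>k. norm (?d k))" "summable ?d"
    using D0 unfolding l1_fps_def by (auto intro: summable_norm_cancel)
  have "fps_nth (scalar (geometric_fps q) * D) n = (\<Sum>i\<le>n. q ^ (n - i) *\<^sub>C fps_nth D i)"
    unfolding scalar_mult_nth geometric_fps_def fps_nth_Abs_fps
    by (rule sum.reindex_bij_witness[of _ "\<lambda>i. n - i" "\<lambda>i. n - i"]) auto
  also have "\<dots> = (\<Sum>i\<le>n. q ^ (n - i) *\<^sub>C ?e i) + (\<Sum>i\<le>n. q ^ (n - i) *\<^sub>C ?d i)"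
    by (simp add: scaleC_add_right[symmetric] flip: sum.distrib)
  also have "(\<Sum>i\<le>n. q ^ (n - i) *\<^sub>C ?d i)
      = (\<Sum>i\<le>n. (q ^ (n - i) * (1 - q ^ i)) *\<^sub>C ?d i) + q ^ n *\<^sub>C (\<Sum>i\<le>n. ?d i)"
    unfolding scaleC_sum_right sum.distrib[symmetric]
    by (rule sum.cong) (auto simp: right_diff_distrib scaleC_diff_left simp flip: power_add)
  also have "fps_value D0 1 = (\<Sum>k. ?d (k + Suc n)) + (\<Sum>i\<le>n. ?d i)"
    using suminf_split_initial_segment[OF s(2), of "Suc n"]
    by (simp only: fps_value_def power_one scaleC_one lessThan_Suc_atMost)
  then have val: "q ^ n *\<^sub>C (\<Sum>i\<le>n. ?d i) = q ^ n *\<^sub>C fps_value D0 1 - q ^ n *\<^sub>C (\<Sum>k. ?d (k + Suc n))"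
    by (simp add: scaleC_add_right)
  finally have eq: "fps_nth (scalar (geometric_fps q) * D) n - q ^ n *\<^sub>C fps_value D0 1
      = (\<Sum>i\<le>n. q ^ (n - i) *\<^sub>C ?e i) + (\<Sum>i\<le>n. (q ^ (n - i) * (1 - q ^ i)) *\<^sub>C ?d i)
        - q ^ n *\<^sub>C (\<Sum>k. ?d (k + Suc n))"
    unfolding val by simp
  have "norm (\<Sum>i\<le>n. q ^ (n - i) *\<^sub>C ?e i) \<le> (\<Sum>i\<le>n. norm (?e i))"
    using qn by (intro order.trans[OF norm_sum sum_mono]) (simp add: norm_scaleC mult_left_le_one_le)
  also have "\<dots> \<le> l1norm (D - D0)"
    using l1norm_upto_le[OF l1_diff(1)[OF D D0], of n] by (simp add: l1norm_upto_def)
  finally have 1: "norm (\<Sum>i\<le>n. q ^ (n - i) *\<^sub>C ?e i) \<le> l1norm (D - D0)" .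
  have s1: "summable (\<lambda>k. cmod (1 - q ^ k) * norm (?d k))"
  proof (rule summable_comparison_test'[OF summable_mult[OF s(1), of 2], of 0])
    fix k
    have "cmod (1 - q ^ k) \<le> 2" using norm_triangle_ineq4[of 1 "q ^ k"] qn[of k] by simp
    then show "norm (cmod (1 - q ^ k) * norm (?d k)) \<le> 2 * norm (?d k)"
      by (simp add: mult_right_mono)
  qed
  have "norm (\<Sum>i\<le>n. (q ^ (n - i) * (1 - q ^ i)) *\<^sub>C ?d i) \<le> (\<Sum>i\<le>n. cmod (1 - q ^ i) * norm (?d i))"
    using qn by (intro order.trans[OF norm_sum sum_mono])
      (simp add: norm_scaleC norm_mult mult.assoc mult_left_le_one_le)
  also have "\<dots> \<le> (\<Sum>k. cmod (1 - q ^ k) * norm (?d k))"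
    by (rule sum_le_suminf[OF s1]) auto
  finally have 2: "norm (\<Sum>i\<le>n. (q ^ (n - i) * (1 - q ^ i)) *\<^sub>C ?d i)
      \<le> (\<Sum>k. cmod (1 - q ^ k) * norm (?d k))" .
  have s2: "summable (\<lambda>k. norm (?d (k + Suc n)))" by (rule summable_ignore_initial_segment[OF s(1)])
  have "norm (q ^ n *\<^sub>C (\<Sum>k. ?d (k + Suc n))) \<le> norm (\<Sum>k. ?d (k + Suc n))"
    using qn by (simp add: norm_scaleC mult_left_le_one_le)
  also have "\<dots> \<le> (\<Sum>k. norm (?d (k + Suc n)))" by (rule summable_norm[OF s2])
  finally have 3: "norm (q ^ n *\<^sub>C (\<Sum>k. ?d (k + Suc n))) \<le> (\<Sum>k. norm (?d (k + Suc n)))" .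
  show ?thesis
    unfolding eq
    using norm_triangle_ineq4[of "(\<Sum>i\<le>n. q ^ (n - i) *\<^sub>C ?e i) + (\<Sum>i\<le>n. (q ^ (n - i) * (1 - q ^ i)) *\<^sub>C ?d i)"
        "q ^ n *\<^sub>C (\<Sum>k. ?d (k + Suc n))"]
      norm_triangle_ineq[of "\<Sum>i\<le>n. q ^ (n - i) *\<^sub>C ?e i" "\<Sum>i\<le>n. (q ^ (n - i) * (1 - q ^ i)) *\<^sub>C ?d i"]
      1 2 3 by linarith
qed

lemma formal_inverse_in_disc:
  fixes f T :: "'a :: complex_banach cbop fps"
  assumes f: "l1_fps f" and T: "(1 - f) * T = 1" "T * (1 - f) = 1"
    and bound: "\<And>n. norm (fps_nth T n) \<le> K" and z: "cmod z < 1"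
  shows "cbop_invertible (1 - fps_value f z)"
    "(\<lambda>n. z ^ n *\<^sub>C fps_nth T n) sums cbop_inv (1 - fps_value f z)"
proof -
  have cf: "abs_conv z f" "abs_conv z 1" "abs_conv z (1 - f)"
    using z by (auto intro!: l1_imp_abs_conv l1_diff f)
  have cT: "abs_conv z T"
    unfolding abs_conv_def
  proof (rule summable_comparison_test'[of "\<lambda>n. K * cmod z ^ n" 0])
    show "summable (\<lambda>n. K * cmod z ^ n)" using z by (intro summable_mult summable_geometric) simp
    show "norm (norm (z ^ n *\<^sub>C fps_nth T n)) \<le> K * cmod z ^ n" for n
      using mult_left_mono[OF bound[of n], of "cmod z ^ n"] by (simp add: norm_scaleC norm_power mult.commute)
  qed
  have "fps_value (1 - f) z * fps_value T z = 1" "fps_value T z * fps_value (1 - f) z = 1"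
    by (simp_all add: T flip: fps_value_mult[OF cf(3) cT] fps_value_mult[OF cT cf(3)])
  then have inv: "(1 - fps_value f z) * fps_value T z = 1" "fps_value T z * (1 - fps_value f z) = 1"
    by (simp_all add: fps_value_diff[OF cf(2) cf(1)])
  then show "cbop_invertible (1 - fps_value f z)" by (rule cbop_invertibleI)
  have "cbop_inv (1 - fps_value f z) = fps_value T z" by (rule cbop_inv_eqI[OF inv])
  then show "(\<lambda>n. z ^ n *\<^sub>C fps_nth T n) sums cbop_inv (1 - fps_value f z)"
    using summable_sums[OF summable_norm_cancel[OF cT[unfolded abs_conv_def]]]
    by (simp add: fps_value_def)
qed

text \<open>For \<open>m\<close> tending to \<open>0\<close> from above, \<open>1 - a m\<close> tends to \<open>1\<close> nontangentially, inside the disc.\<close>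

lemma eventually_cmod_one_minus_le:
  fixes m :: "'b \<Rightarrow> real"
  assumes a: "Re a > 0" and m: "(m \<longlongrightarrow> 0) F" "\<forall>\<^sub>F t in F. m t > 0"
  shows "\<forall>\<^sub>F t in F. Re a / 2 * m t > 0 \<and> cmod (1 - a * of_real (m t)) \<le> 1 - Re a / 2 * m t"
proof -
  have "((\<lambda>t. m t * (cmod a)\<^sup>2) \<longlongrightarrow> 0) F" using m(1) by (rule tendsto_mult_left_zero)
  then have "\<forall>\<^sub>F t in F. m t * (cmod a)\<^sup>2 < Re a" using a by (rule order_tendstoD)
  with m(2) show ?thesis
  proof eventually_elim
    case (elim t)
    let ?m = "m t"
    have "Re a * (Re a * ?m) = ?m * (Re a)\<^sup>2" by (simp add: power2_eq_square)
    also have "\<dots> \<le> ?m * (cmod a)\<^sup>2"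
      using elim by (intro mult_left_mono) (simp_all add: cmod_power2)
    also have "\<dots> \<le> Re a * 1" using elim by simp
    finally have am: "Re a * ?m \<le> 1" using a by simp
    have "(cmod (1 - a * of_real ?m))\<^sup>2 = 1 - 2 * (Re a * ?m) + ?m * (?m * (cmod a)\<^sup>2)"
      unfolding cmod_power2 by (simp add: power2_eq_square algebra_simps)
    also have "\<dots> \<le> 1 - 2 * (Re a * ?m) + ?m * Re a"
      using elim by (intro add_left_mono mult_left_mono) auto
    also have "\<dots> \<le> (1 - Re a / 2 * ?m)\<^sup>2"
      using zero_le_power2[of "Re a * ?m"] by (simp add: power2_eq_square algebra_simps)
    finally have "cmod (1 - a * of_real ?m) \<le> 1 - Re a / 2 * ?m"
      by (rule power2_le_imp_le) (use am in simp)
    then show ?case using a elim by simp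
  qed
qed

text \<open>Here \<open>\<Delta>\<close> is the error in \<open>((1 - \<lambda>) E + (1 - X) H) / (1 - q X) \<rightarrow> H0\<close>. The norm of \<open>1 / (1 - q X)\<close>
  is only \<open>O(1 / m)\<close>, but that of \<open>(1 - X) / (1 - q X)\<close> stays bounded. Errors \<open>o(m)\<close> and multiples of
  \<open>1 - X\<close> by an error \<open>o(1)\<close> are therefore harmless. What remains is \<open>m (\<mu> P - X H0) / (1 - q X)\<close>; its
  numerator vanishes at \<open>1\<close>, and \<open>1 / (1 - q X)\<close> is almost an eigenvector of the shift for the
  eigenvalue \<open>1\<close>, so this tends to \<open>0\<close> as well.\<close>

lemma geometric_quotient_tendsto:
  fixes H :: "real \<Rightarrow> 'a :: complex_banach cbop fps" and H0 :: "'a cbop fps" and E :: "real \<Rightarrow> 'a cbop"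
    and m :: "real \<Rightarrow> real" and lam h :: "real \<Rightarrow> complex" and \<mu> :: real and c :: complex
  defines "q \<equiv> \<lambda>t. 1 - c / of_real \<mu> * of_real (m t)"
  defines "\<Delta> \<equiv> \<lambda>t. scalar (geometric_fps (q t)) * (fps_const ((1 - lam t) *\<^sub>C E t) + one_minus_X 1 * H t) - H0"
  assumes \<mu>: "\<mu> > 0" and c: "Re c > 0"
    and m: "(m \<longlongrightarrow> 0) F" "\<forall>\<^sub>F t in F. m t > 0"
    and h: "(h \<longlongrightarrow> 0) F" "\<forall>\<^sub>F t in F. lam t = 1 - (c + h t) * of_real (m t)"
    and E: "(E \<longlongrightarrow> P) F"
    and H: "\<forall>\<^sub>F t in F. l1_fps (H t)" "((\<lambda>t. l1norm (H t - H0)) \<longlongrightarrow> 0) F"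
    and H0: "l1_fps H0" "fps_value H0 1 = of_real \<mu> *\<^sub>C P"
  shows "\<forall>\<^sub>F t in F. l1_fps (\<Delta> t)" and "((\<lambda>t. l1norm (\<Delta> t)) \<longlongrightarrow> 0) F"
proof -
  define a where "a = c / of_real \<mu>"
  have Rea: "Re a > 0" using c \<mu> by (simp add: a_def)
  define K1 where "K1 = 2 / Re a"
  define K2 where "K2 = 1 + cmod a * K1"
  have K: "K1 > 0" "K2 > 0" using Rea by (simp_all add: K1_def K2_def add_pos_nonneg)
  define G where "G t = (scalar (geometric_fps (q t)) :: 'a cbop fps)" for t
  define V where "V = fps_const (of_real \<mu> *\<^sub>C P) - fps_X * H0"
  have l1V: "l1_fps V" unfolding V_def by (intro l1_diff l1_const l1_X_mult H0)
  have V1: "fps_value V 1 = 0"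
  proof -
    have conv: "abs_conv 1 (fps_const (of_real \<mu> *\<^sub>C P))" "abs_conv 1 (fps_X * H0)"
      "abs_conv 1 fps_X" "abs_conv 1 H0"
      by (intro l1_imp_abs_conv l1_const l1_X_mult H0 l1_fps_X; simp)+
    show ?thesis
      by (simp add: V_def fps_value_diff[OF conv(1,2)] fps_value_mult[OF conv(3,4)] H0(2))
  qed
  \<comment> \<open>As \<open>q\<close> approaches \<open>1\<close> nontangentially, \<open>m\<close> is comparable to \<open>1 - \<bar>q\<bar>\<close>, the inverse of the
      norm of the geometric series.\<close>
  have "\<forall>\<^sub>F t in F. Re a / 2 * m t > 0 \<and> cmod (q t) \<le> 1 - Re a / 2 * m t"
    unfolding q_def a_def[symmetric] by (rule eventually_cmod_one_minus_le[OF Rea m])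
  with m(2) have ev: "\<forall>\<^sub>F t in F. m t > 0 \<and> cmod (q t) < 1 \<and> m t / (1 - cmod (q t)) \<le> K1"
  proof eventually_elim
    case (elim t)
    then have le: "cmod (q t) \<le> 1 - Re a / 2 * m t" by simp
    have "cmod (q t) < 1" using elim by linarith
    moreover have "m t \<le> K1 * (1 - cmod (q t))"
      using mult_left_mono[of "Re a / 2 * m t" "1 - cmod (q t)" K1] le K(1) Rea by (simp add: K1_def)
    ultimately show ?case using elim by (simp add: field_simps)
  qed
  have bounds: "l1_fps (geometric_fps (q t))" "m t * l1norm (geometric_fps (q t)) \<le> K1"
    "l1_fps (geometric_fps (q t) * (1 - fps_X))" "l1norm (geometric_fps (q t) * (1 - fps_X)) \<le> K2"
    if t: "m t > 0 \<and> cmod (q t) < 1 \<and> m t / (1 - cmod (q t)) \<le> K1" for t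
  proof -
    have q1: "cmod (q t) < 1" using t by simp
    show "l1_fps (geometric_fps (q t))" "l1_fps (geometric_fps (q t) * (1 - fps_X))"
      by (rule l1_geometric_fps(1)[OF q1], rule l1_geometric_fps_one_minus_X(1)[OF q1])
    show "m t * l1norm (geometric_fps (q t)) \<le> K1" using t by (simp add: l1_geometric_fps(2)[OF q1])
    have "cmod (1 - q t) / (1 - cmod (q t)) = cmod a * (m t / (1 - cmod (q t)))"
      using t by (simp add: q_def a_def[symmetric] norm_mult)
    also have "\<dots> \<le> cmod a * K1" using t by (intro mult_left_mono) auto
    finally show "l1norm (geometric_fps (q t) * (1 - fps_X)) \<le> K2"
      using l1_geometric_fps_one_minus_X(2)[OF q1] by (simp add: K2_def)
  qed
  have Glim: "((\<lambda>t. m t * l1norm (V * G t)) \<longlongrightarrow> 0) F"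
  proof (rule tendstoI)
    fix e :: real assume e: "e > 0"
    define \<epsilon> where "\<epsilon> = e / (2 * K1)"
    have \<epsilon>: "\<epsilon> > 0" using e K by (simp add: \<epsilon>_def)
    obtain K where K0: "K \<ge> 0" and near: "\<And>\<rho> \<omega> h. \<lbrakk>cmod \<rho> \<le> 1; cmod \<omega> \<le> 1; l1_fps h\<rbrakk> \<Longrightarrow>
      l1norm (fps_dilate \<rho> V * h - fps_const (fps_value V (\<rho> * \<omega>)) * h)
        \<le> K * l1norm (scalar (fps_X - fps_const \<omega>) * h) + \<epsilon> * l1norm h"
      by (rule l1_action_near_value[OF l1V \<epsilon>]) auto
    have "((\<lambda>t. K * K2 * m t) \<longlongrightarrow> 0) F" using tendsto_mult_right_zero[OF m(1)] .
    then have "\<forall>\<^sub>F t in F. K * K2 * m t < e / 2" by (rule order_tendstoD(2)) (use e in simp)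
    with ev show "\<forall>\<^sub>F t in F. dist (m t * l1norm (V * G t)) 0 < e"
    proof eventually_elim
      case (elim t)
      note b = bounds[OF elim(1)]
      have G: "l1_fps (G t)" "l1norm (G t) \<le> l1norm (geometric_fps (q t))"
        using l1_scalar_mult[OF b(1) l1_one[where 'b = "'a cbop"]]
          mult_left_mono[OF norm_one_cbop_le[where 'a = 'a] l1norm_nonneg[OF b(1)]]
        by (simp_all add: G_def fps_one_mult l1norm_one)
      have "scalar (fps_X - fps_const 1) * G t = - scalar (geometric_fps (q t) * (1 - fps_X))"
        unfolding G_def scalar_mult[symmetric]
        by (simp add: fps_eq_iff scalar_nth algebra_simps scaleC_minus_left flip: scaleC_minus_left)
      also have "\<dots> = - (scalar (geometric_fps (q t) * (1 - fps_X)) * 1)" by (simp add: fps_one_mult)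
      finally have "l1norm (scalar (fps_X - fps_const 1) * G t)
          = l1norm (scalar (geometric_fps (q t) * (1 - fps_X)) * (1 :: 'a cbop fps))"
        by (simp only: l1_minus)
      also have "\<dots> \<le> l1norm (geometric_fps (q t) * (1 - fps_X)) * l1norm (1 :: 'a cbop fps)"
        by (rule l1_scalar_mult(2)[OF b(3) l1_one])
      also have "\<dots> \<le> K2 * 1"
        using b(4) K by (intro mult_mono) (auto simp: l1norm_one norm_one_cbop_le)
      finally have X: "l1norm (scalar (fps_X - fps_const 1) * G t) \<le> K2" by simp
      have "l1norm (V * G t) \<le> K * l1norm (scalar (fps_X - fps_const 1) * G t) + \<epsilon> * l1norm (G t)"
        using near[of 1 1 "G t"] G(1) by (simp add: V1)
      also have "\<dots> \<le> K * K2 + \<epsilon> * l1norm (geometric_fps (q t))"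
        using X K0 \<epsilon> G(2) by (intro add_mono mult_left_mono) auto
      finally have "m t * l1norm (V * G t) \<le> m t * (K * K2 + \<epsilon> * l1norm (geometric_fps (q t)))"
        using elim by (intro mult_left_mono) auto
      also have "\<dots> = K * K2 * m t + \<epsilon> * (m t * l1norm (geometric_fps (q t)))"
        by (simp add: algebra_simps)
      also have "\<dots> \<le> K * K2 * m t + \<epsilon> * K1" using b(2) \<epsilon> by (intro add_left_mono mult_left_mono) auto
      also have "\<dots> < e / 2 + e / 2" using elim(2) K by (simp add: \<epsilon>_def)
      finally have "m t * l1norm (V * G t) < e" by simp
      moreover have "0 \<le> m t * l1norm (V * G t)"
        using elim(1) l1norm_nonneg[OF l1_mult(1)[OF l1V G(1)]] by simp
      ultimately show ?case by simp
    qed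
  qed
  define W where "W t = fps_const ((h t * of_real (m t)) *\<^sub>C E t)
    + fps_const ((c * of_real (m t)) *\<^sub>C (E t - P))" for t
  define bd where "bd t = K1 * (cmod (h t) * norm (E t) + cmod c * norm (E t - P))
    + K2 * l1norm (H t - H0) + cmod a * (m t * l1norm (V * G t))" for t
  have main: "\<forall>\<^sub>F t in F. l1_fps (\<Delta> t) \<and> l1norm (\<Delta> t) \<le> bd t"
    using ev h(2) H(1)
  proof eventually_elim
    case (elim t)
    note b = bounds[OF elim(1)]
    have l1H: "l1_fps (H t - H0)" by (intro l1_diff elim H0)
    have "H0 = G t * (one_minus_X (q t) * H0)" by (simp add: G_def scalar_geometric_fps_mult)
    then have "\<Delta> t = G t * (fps_const ((1 - lam t) *\<^sub>C E t) + one_minus_X 1 * H t - one_minus_X (q t) * H0)"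
      by (simp only: \<Delta>_def G_def right_diff_distrib)
    also have "one_minus_X (q t) * H0
        = one_minus_X 1 * H0 + fps_const ((1 - q t) *\<^sub>C 1) * (fps_X * H0)"
      unfolding one_minus_X_mult scaleC_diff_left fps_const_sub[symmetric] left_diff_distrib by simp
    also have "fps_const ((1 - lam t) *\<^sub>C E t) = W t + fps_const ((c * of_real (m t)) *\<^sub>C P)"
      unfolding W_def fps_const_add elim(2)
      by (simp add: scaleC_diff_right scaleC_add_left algebra_simps)
    also have "fps_const ((c * of_real (m t)) *\<^sub>C P)
        = fps_const ((1 - q t) *\<^sub>C 1) * fps_const (of_real \<mu> *\<^sub>C P)"
      using \<mu> by (simp add: scaleC_mult_left scaleC_scaleC q_def)
    also have "W t + fps_const ((1 - q t) *\<^sub>C 1) * fps_const (of_real \<mu> *\<^sub>C P) + one_minus_X 1 * H t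
        - (one_minus_X 1 * H0 + fps_const ((1 - q t) *\<^sub>C 1) * (fps_X * H0))
        = W t + one_minus_X 1 * (H t - H0) + fps_const ((1 - q t) *\<^sub>C 1) * V"
      unfolding V_def right_diff_distrib by (simp only: algebra_simps)
    also have "G t * \<dots> = G t * W t + scalar (geometric_fps (q t) * (1 - fps_X)) * (H t - H0)
        + fps_const ((1 - q t) *\<^sub>C 1) * (V * G t)"
      unfolding distrib_left G_def scalar_mult scalar_commute[of _ V]
        scalar_const[symmetric]
      by (simp add: mult.assoc) (metis mult.assoc scalar_commute)
    finally have eq: "\<Delta> t = G t * W t + scalar (geometric_fps (q t) * (1 - fps_X)) * (H t - H0)
        + fps_const ((1 - q t) *\<^sub>C 1) * (V * G t)" .
    have l1G: "l1_fps (G t)"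
      using l1_scalar_mult(1)[OF b(1) l1_one[where 'b = "'a cbop"]] by (simp add: G_def fps_one_mult)
    have l1VG: "l1_fps (V * G t)" by (intro l1_mult l1V l1G)
    let ?e = "cmod (h t) * norm (E t) + cmod c * norm (E t - P)" and ?\<gamma> = "l1norm (geometric_fps (q t))"
    let ?S = "scalar (geometric_fps (q t) * (1 - fps_X)) :: 'a cbop fps"
    have l1W: "l1_fps (W t)" "l1norm (W t) \<le> m t * ?e"
    proof -
      show "l1_fps (W t)" unfolding W_def by (intro l1_add l1_const)
      have "l1norm (W t) \<le> norm ((h t * of_real (m t)) *\<^sub>C E t)
          + norm ((c * of_real (m t)) *\<^sub>C (E t - P))"
        unfolding W_def using l1_add(2)[OF l1_const(1) l1_const(1)] by (simp only: l1_const(2))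
      then show "l1norm (W t) \<le> m t * ?e"
        using elim(1) by (simp add: norm_scaleC norm_mult distrib_left mult_ac)
    qed
    have p1: "l1_fps (G t * W t)" and p2: "l1_fps (?S * (H t - H0))"
      and p3: "l1_fps (fps_const ((1 - q t) *\<^sub>C 1) * (V * G t))"
      unfolding G_def by (intro l1_scalar_mult b l1W l1H l1_const_mult l1VG[unfolded G_def])+
    have "l1norm (G t * W t) \<le> ?\<gamma> * l1norm (W t)"
      unfolding G_def by (rule l1_scalar_mult(2)[OF b(1) l1W(1)])
    also have "\<dots> \<le> ?\<gamma> * (m t * ?e)"
      by (intro mult_left_mono l1W l1norm_nonneg b)
    also have "\<dots> = (m t * ?\<gamma>) * ?e"
      by (simp only: mult_ac)
    also have "\<dots> \<le> K1 * ?e"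
      by (intro mult_right_mono b) simp
    finally have 1: "l1norm (G t * W t) \<le> K1 * ?e" .
    have 2: "l1norm (?S * (H t - H0)) \<le> K2 * l1norm (H t - H0)"
      by (rule order.trans[OF l1_scalar_mult(2)[OF b(3) l1H] mult_right_mono[OF b(4) l1norm_nonneg[OF l1H]]])
    have 3: "l1norm (fps_const ((1 - q t) *\<^sub>C 1) * (V * G t)) = cmod a * (m t * l1norm (V * G t))"
      using elim(1) by (simp add: l1_scaleC_const_mult[OF l1VG] q_def a_def norm_mult norm_divide)
    show ?case
      using l1_add[OF l1_add(1)[OF p1 p2] p3] l1_add(2)[OF p1 p2] 1 2 3 unfolding eq bd_def by auto
  qed
  then show "\<forall>\<^sub>F t in F. l1_fps (\<Delta> t)" by (rule eventually_mono) simp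
  have "(bd \<longlongrightarrow> K1 * (cmod 0 * norm P + cmod c * norm (P - P)) + K2 * 0 + cmod a * 0) F"
    unfolding bd_def by (intro tendsto_intros h E H Glim)
  then have bd: "(bd \<longlongrightarrow> 0) F" by simp
  show "((\<lambda>t. l1norm (\<Delta> t)) \<longlongrightarrow> 0) F"
    by (rule Lim_null_comparison[OF _ bd]) (use main in eventually_elim, auto simp: l1norm_nonneg)
qed

section \<open>The renewal theorem\<close>

text \<open>On a neighbourhood in which the eigenvalue is unique, the definite description behind \<open>\<Lambda>\<close> denotes it.\<close>

lemma perturbed_eigenvalue_operators:
  fixes F :: "complex \<Rightarrow> real \<Rightarrow> 'a :: complex_banach cbop" and T0 P S :: "'a cbop"
  assumes P: "P \<noteq> 0" "P * P = P" "(1 - T0) * P = 0" "P * (1 - T0) = 0"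
      "(1 - T0) * S = 1 - P" "S * (1 - T0) = 1 - P" "P * S = 0" "S * P = 0"
      "\<And>X. \<exists>a. P * X * P = a *\<^sub>C P"
    and \<Lambda>: "perturbed_eigenvalue F \<Lambda>"
    and F: "((\<lambda>t. F 1 t) \<longlongrightarrow> T0) (at 0)" and \<Lambda>_lim: "((\<lambda>t. \<Lambda> 1 t) \<longlongrightarrow> 1) (at 0)"
  obtains E where "\<forall>\<^sub>F t in at 0. F 1 t * E t = \<Lambda> 1 t *\<^sub>C E t" "(E \<longlongrightarrow> P) (at 0)"
proof -
  obtain \<eta>\<^sub>1 \<delta>\<^sub>1 L :: real where \<eta>\<^sub>1: "\<eta>\<^sub>1 > 0" "\<delta>\<^sub>1 > 0" "L \<ge> 0"
    and op: "\<And>T w. norm (T - T0) < \<delta>\<^sub>1 \<Longrightarrow> dist w 1 < \<eta>\<^sub>1 \<Longrightarrow> eigenvalue T w \<Longrightarrow>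
      \<exists>E. T * E = w *\<^sub>C E \<and> norm (E - P) \<le> L * (norm (T - T0) + dist w 1)"
    and uniq: "\<And>\<eta>. 0 < \<eta> \<Longrightarrow> \<eta> < \<eta>\<^sub>1 \<Longrightarrow>
      \<exists>\<delta>>0. \<forall>T. norm (T - T0) < \<delta> \<longrightarrow> (\<exists>!w. eigenvalue T w \<and> dist w 1 < \<eta>)"
    by (rule simple_eigenvalue_perturbation[where l = 1 and ?T0.0 = T0 and P = P and S = S])
      (use P in auto)
  obtain \<eta>\<^sub>0 where \<eta>\<^sub>0: "\<eta>\<^sub>0 > 0" and near: "\<And>\<eta>. 0 < \<eta> \<Longrightarrow> \<eta> < \<eta>\<^sub>0 \<Longrightarrow>
      \<exists>d>0. \<forall>z t. cmod z \<le> 1 \<and> cmod (z - 1) < d \<and> \<bar>t\<bar> < d \<longrightarrow> \<Lambda> z t = eigenvalue_near \<eta> 1 (F z t)"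
    using \<Lambda> unfolding perturbed_eigenvalue_def by auto
  define \<eta> where "\<eta> = min \<eta>\<^sub>0 \<eta>\<^sub>1 / 2"
  have \<eta>: "0 < \<eta>" "\<eta> < \<eta>\<^sub>0" "\<eta> < \<eta>\<^sub>1" using \<eta>\<^sub>0 \<eta>\<^sub>1 by (auto simp: \<eta>_def min_def)
  obtain d where d: "d > 0"
    "\<And>z t. cmod z \<le> 1 \<Longrightarrow> cmod (z - 1) < d \<Longrightarrow> \<bar>t\<bar> < d \<Longrightarrow> \<Lambda> z t = eigenvalue_near \<eta> 1 (F z t)"
    using near[OF \<eta>(1,2)] by auto
  obtain \<delta> where \<delta>: "\<delta> > 0" "\<And>T. norm (T - T0) < \<delta> \<Longrightarrow> \<exists>!w. eigenvalue T w \<and> dist w 1 < \<eta>"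
    using uniq[OF \<eta>(1,3)] by auto
  have F0: "((\<lambda>t. norm (F 1 t - T0)) \<longlongrightarrow> 0) (at 0)" using F by (intro tendsto_norm_zero LIM_zero)
  have "\<forall>\<^sub>F t in at 0. \<bar>t\<bar> < d" using d(1) by (auto simp: eventually_at dist_real_def)
  moreover have "\<forall>\<^sub>F t in at 0. norm (F 1 t - T0) < min \<delta> \<delta>\<^sub>1"
    by (rule order_tendstoD(2)[OF F0]) (use \<delta> \<eta>\<^sub>1 in auto)
  ultimately have ev: "\<forall>\<^sub>F t in at 0. \<exists>E. F 1 t * E = \<Lambda> 1 t *\<^sub>C E
      \<and> norm (E - P) \<le> L * (norm (F 1 t - T0) + dist (\<Lambda> 1 t) 1)"
  proof eventually_elim
    case (elim t)
    have "\<Lambda> 1 t = (THE w. eigenvalue (F 1 t) w \<and> dist w 1 < \<eta>)"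
      using d(2)[of 1 t] d(1) elim by (simp add: eigenvalue_near_def)
    then have "eigenvalue (F 1 t) (\<Lambda> 1 t) \<and> dist (\<Lambda> 1 t) 1 < \<eta>"
      using theI'[OF \<delta>(2)[of "F 1 t"]] elim by simp
    then show ?case using op[of "F 1 t" "\<Lambda> 1 t"] elim \<eta> by simp
  qed
  define E where "E t = (SOME E. F 1 t * E = \<Lambda> 1 t *\<^sub>C E
      \<and> norm (E - P) \<le> L * (norm (F 1 t - T0) + dist (\<Lambda> 1 t) 1))" for t
  have E: "\<forall>\<^sub>F t in at 0. F 1 t * E t = \<Lambda> 1 t *\<^sub>C E t
      \<and> norm (E t - P) \<le> L * (norm (F 1 t - T0) + dist (\<Lambda> 1 t) 1)"
    using ev unfolding E_def by (rule eventually_mono) (rule someI_ex)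
  show thesis
  proof (rule that)
    show "\<forall>\<^sub>F t in at 0. F 1 t * E t = \<Lambda> 1 t *\<^sub>C E t" using E by (rule eventually_mono) simp
    have "((\<lambda>t. dist (\<Lambda> 1 t) 1) \<longlongrightarrow> 0) (at 0)"
      using tendsto_dist[OF \<Lambda>_lim tendsto_const[of 1]] by simp
    from tendsto_mult_right_zero[OF tendsto_add_zero[OF F0 this]]
    have lim: "((\<lambda>t. L * (norm (F 1 t - T0) + dist (\<Lambda> 1 t) 1)) \<longlongrightarrow> 0) (at 0)" .
    have "((\<lambda>t. E t - P) \<longlongrightarrow> 0) (at 0)"
      by (rule Lim_null_comparison[OF _ lim]) (use E in \<open>rule eventually_mono, simp\<close>)
    then show "(E \<longlongrightarrow> P) (at 0)" by (rule LIM_zero_cancel)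
  qed
qed

text \<open>The unperturbed case. Away from \<open>1\<close> the factorization shows that \<open>B(z)\<close> is invertible, and
  \<open>B(1) = A + \<mu> P\<close> by the choice of \<open>Y\<close>, with inverse \<open>S + P / \<mu>\<close>. So Wiener's lemma applies.\<close>

lemma unperturbed_renewal_inverse:
  fixes f :: "'a :: complex_banach cbop fps" and P S :: "'a cbop" and \<mu> :: real
  defines "R' \<equiv> fps_value (fps_tails f) 1" and "A \<equiv> 1 - fps_value f 1"
  defines "H0 \<equiv> (fps_tails f - (1 - f) * fps_const (S * R')) * fps_const P"
  defines "B0 \<equiv> (1 - f) * fps_const (1 - P) + H0"
    and "J0 \<equiv> one_minus_X 1 * fps_const (1 - P) + fps_const P - one_minus_X 1 * fps_const (S * R' * P)"
  assumes f: "finite_moment f"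
    and P: "P * P = P" "A * P = 0" "P * A = 0" "A * S = 1 - P" "S * A = 1 - P" "P * S = 0" "S * P = 0"
    and \<mu>: "\<mu> > 0" "P * R' * P = \<mu> *\<^sub>R P"
    and inv: "\<And>z. cmod z \<le> 1 \<Longrightarrow> z \<noteq> 1 \<Longrightarrow> cbop_invertible (1 - fps_value f z)"
  shows "l1_fps H0" "l1_fps J0" "fps_value H0 1 = of_real \<mu> *\<^sub>C P"
    "(1 - f) * J0 = one_minus_X 1 * B0"
    "\<exists>g. l1_fps g \<and> B0 * g = 1 \<and> fps_value (J0 * g) 1 = (1 / of_real \<mu>) *\<^sub>C P"
proof -
  define W where "W = S * R' * P"
  note l1f = finite_moment_imp_l1(1)[OF f] and l1U = l1_tails(1)[OF f]
  have l1A: "l1_fps (1 - f)" by (intro l1_diff l1f) simp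
  show l1H: "l1_fps H0" unfolding H0_def by (intro l1_mult l1_diff l1U l1A l1_const)
  then have l1B: "l1_fps B0" unfolding B0_def by (intro l1_add l1_mult l1A l1_const)
  show l1J: "l1_fps J0" unfolding J0_def by (intro l1_add l1_diff l1_one_minus_X_mult l1_const)
  have "fps_value f 1 * P = 1 *\<^sub>C P" using P(2) by (simp add: A_def left_diff_distrib)
  from renewal_factorization[OF l1f _ this, where q = 1 and Q = "1 - P" and Y = "S * R'"]
  show AJ: "(1 - f) * J0 = one_minus_X 1 * B0"
    using f by (simp add: finite_moment_def J0_def B0_def H0_def scalar_geometric_fps_mult[of 1, simplified])
  have conv: "l1_fps x \<Longrightarrow> abs_conv 1 x" for x :: "'a cbop fps" by (rule l1_imp_abs_conv) simp_all
  have val_mult: "fps_value (x * y) 1 = fps_value x 1 * fps_value y 1" if "l1_fps x" "l1_fps y" for x y :: "'a cbop fps"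
    by (rule fps_value_mult) (use that conv in auto)
  have valA: "fps_value (1 - f) 1 = A"
    by (simp add: A_def fps_value_diff conv l1f)
  have "fps_value H0 1 = (R' - A * (S * R')) * P"
    unfolding H0_def
    by (simp add: val_mult l1_diff l1_mult l1A l1U fps_value_diff conv valA R'_def)
  also have "A * (S * R') = (1 - P) * R'" by (simp only: mult.assoc[symmetric] P)
  finally have H1: "fps_value H0 1 = \<mu> *\<^sub>R P" using \<mu>(2) by (simp add: left_diff_distrib)
  then show "fps_value H0 1 = of_real \<mu> *\<^sub>C P" by (simp add: scaleR_scaleC)
  have "A * (1 - P) = A" by (simp add: right_diff_distrib P)
  then have B1: "fps_value B0 1 = A + \<mu> *\<^sub>R P"
    unfolding B0_def by (simp add: fps_value_add conv l1_mult l1A l1H val_mult valA H1)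
  have invB: "cbop_invertible (fps_value B0 z)" if z: "cmod z \<le> 1" for z
  proof (cases "z = 1")
    case True
    have "(A + \<mu> *\<^sub>R P) * (S + (1 / \<mu>) *\<^sub>R P) = 1" "(S + (1 / \<mu>) *\<^sub>R P) * (A + \<mu> *\<^sub>R P) = 1"
      using \<mu>(1) by (simp_all add: distrib_left distrib_right P)
    then have "cbop_invertible (A + \<mu> *\<^sub>R P)" by (rule cbop_invertibleI)
    then show ?thesis using True B1 by simp
  next
    case False
    define Q where "Q = 1 - P"
    have Q: "P * Q = 0" "Q * P = 0" "Q * Q = Q" "P * W = 0" "W * P = W" "Q * W = W" "W * Q = 0" "W * W = 0"
    proof -
      show "P * Q = 0" "Q * P = 0" "Q * Q = Q" by (simp_all add: Q_def left_diff_distrib right_diff_distrib P)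
      show PW: "P * W = 0" by (simp add: W_def mult.assoc[symmetric] P)
      show WP: "W * P = W" by (simp add: W_def mult.assoc P)
      show "Q * W = W" by (simp add: Q_def left_diff_distrib PW)
      show "W * Q = 0" by (simp add: Q_def right_diff_distrib WP)
      have "W * W = W * (P * W)" by (simp only: mult.assoc[symmetric] WP)
      then show "W * W = 0" by (simp add: PW)
    qed
    have QP: "Q + P = 1" by (simp add: Q_def)
    let ?v = "1 - z"
    have valJ: "fps_value J0 z = ?v *\<^sub>C Q + P - ?v *\<^sub>C W"
    proof -
      have c: "abs_conv z (one_minus_X 1 * fps_const Q)" "abs_conv z (fps_const P)"
        "abs_conv z (one_minus_X 1 * fps_const W)" "abs_conv z (one_minus_X 1 * fps_const Q + fps_const P)"
        by (intro l1_imp_abs_conv z l1_add l1_one_minus_X_mult l1_const)+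
      show ?thesis
        unfolding J0_def W_def[symmetric] Q_def[symmetric] fps_value_diff[OF c(4,3)] fps_value_add[OF c(1,2)]
          fps_value_one_minus_X_mult[OF l1_const(1) z] by simp
    qed
    have J1: "(?v *\<^sub>C Q + P - ?v *\<^sub>C W) * ((1 / ?v) *\<^sub>C Q + P + W) = 1"
      using False QP
      by (simp add: left_diff_distrib distrib_left distrib_right scaleC_mult_left scaleC_mult_right
          scaleC_scaleC Q P scaleC_zero_right)
    have J2: "((1 / ?v) *\<^sub>C Q + P + W) * (?v *\<^sub>C Q + P - ?v *\<^sub>C W) = 1"
      using False QP
      by (simp add: right_diff_distrib distrib_left distrib_right scaleC_mult_left scaleC_mult_right
          scaleC_scaleC Q P scaleC_zero_right)
    have c: "abs_conv z (1 - f)" "abs_conv z J0" "abs_conv z f" "abs_conv z 1"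
      by (intro l1_imp_abs_conv z l1A l1J l1f l1_one)+
    have "?v *\<^sub>C fps_value B0 z = fps_value ((1 - f) * J0) z"
      unfolding AJ fps_value_one_minus_X_mult[OF l1B z] by simp
    also have "\<dots> = (1 - fps_value f z) * fps_value J0 z"
      by (simp add: fps_value_mult[OF c(1,2)] fps_value_diff[OF c(4,3)])
    finally have AJz: "?v *\<^sub>C fps_value B0 z = (1 - fps_value f z) * fps_value J0 z" .
    have "fps_value B0 z = (1 / ?v) *\<^sub>C (?v *\<^sub>C fps_value B0 z)"
      using False by (simp add: scaleC_scaleC)
    then have "fps_value B0 z = (1 / ?v) *\<^sub>C ((1 - fps_value f z) * fps_value J0 z)"
      unfolding AJz .
    moreover have "cbop_invertible (fps_value J0 z)"
      unfolding valJ by (rule cbop_invertibleI[OF J1 J2])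
    ultimately show ?thesis
      using inv[OF z False] False by (simp add: cbop_invertible_scaleC cbop_invertible_mult)
  qed
  obtain g where g: "l1_fps g" "B0 * g = 1" by (rule Wiener_lemma[OF l1B invB]) auto
  have "P * (A + \<mu> *\<^sub>R P) = \<mu> *\<^sub>R P" by (simp add: distrib_left P)
  moreover have "(A + \<mu> *\<^sub>R P) * fps_value g 1 = 1"
    using val_mult[OF l1B g(1)] by (simp add: g(2) B1)
  ultimately have Pg: "\<mu> *\<^sub>R (P * fps_value g 1) = P"
    using mult.assoc[of P "A + \<mu> *\<^sub>R P" "fps_value g 1"] by simp
  have "P * fps_value g 1 = (1 / \<mu>) *\<^sub>R (\<mu> *\<^sub>R (P * fps_value g 1))" using \<mu>(1) by simp
  then have "P * fps_value g 1 = (1 / of_real \<mu>) *\<^sub>C P"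
    unfolding Pg scaleR_scaleC[of _ P] by simp
  moreover have "fps_value J0 1 = P"
  proof -
    have c: "abs_conv 1 (one_minus_X 1 * fps_const (1 - P))" "abs_conv 1 (fps_const P)"
        "abs_conv 1 (one_minus_X 1 * fps_const W)"
        "abs_conv 1 (one_minus_X 1 * fps_const (1 - P) + fps_const P)"
      by (intro conv l1_add l1_one_minus_X_mult l1_const)+
    show ?thesis
      unfolding J0_def W_def[symmetric] fps_value_diff[OF c(4,3)] fps_value_add[OF c(1,2)]
      by (subst (1 2) fps_value_one_minus_X_mult) simp_all
  qed
  ultimately have "fps_value (J0 * g) 1 = (1 / of_real \<mu>) *\<^sub>C P" by (simp add: val_mult[OF l1J g(1)])
  with g show "\<exists>g. l1_fps g \<and> B0 * g = 1 \<and> fps_value (J0 * g) 1 = (1 / of_real \<mu>) *\<^sub>C P" by blast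
qed

theorem theorem2p1:
  fixes R :: "nat \<Rightarrow> 'a :: complex_banach cbop"
    and r :: "nat \<Rightarrow> real"
    and P :: "'a cbop"
    and \<mu> \<alpha> C :: real
    and Rt :: "nat \<Rightarrow> real \<Rightarrow> 'a cbop"
    and \<Lambda> :: "complex \<Rightarrow> real \<Rightarrow> complex"
    and c :: complex
    and h :: "real \<Rightarrow> complex"
    and M :: "real \<Rightarrow> real"
  assumes R_le: "\<And>n. n \<ge> 1 \<Longrightarrow> norm (R n) \<le> r n"
    and r_summable: "summable r"
    and tail_summable: "summable (\<lambda>n. \<Sum>k. r (n + Suc k))"
    and simple: "simple_isolated_eigenvalue (op_series R 1) 1"
    and invertible: "\<And>z. cmod z \<le> 1 \<Longrightarrow> z \<noteq> 1 \<Longrightarrow> cbop_invertible (1 - op_series R z)"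
    and P: "spectral_projection (op_series R 1) 1 P"
    and \<mu>_pos: "\<mu> > 0"
    and \<mu>: "P * op_series_deriv_1 R * P = \<mu> *\<^sub>R P"
    and \<alpha>_pos: "\<alpha> > 0"
    and Rt_cont: "\<And>n. n \<ge> 1 \<Longrightarrow> continuous (at 0 within {-\<alpha>..\<alpha>}) (Rt n)"
    and Rt_0: "\<And>n. n \<ge> 1 \<Longrightarrow> Rt n 0 = R n"
    and C_pos: "C > 0"
    and Rt_le: "\<And>n t. n \<ge> 1 \<Longrightarrow> t \<in> {-\<alpha>..\<alpha>} \<Longrightarrow> norm (Rt n t) \<le> C * r n"
    and \<Lambda>: "perturbed_eigenvalue (\<lambda>z t. op_series (\<lambda>n. Rt n t) z) \<Lambda>"
    and c_pos: "Re c > 0"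
    and M_cont: "continuous_on {0..} M"
    and M_nonneg: "\<And>x. x \<ge> 0 \<Longrightarrow> M x \<ge> 0"
    and M_zero_iff: "\<And>x. x \<ge> 0 \<Longrightarrow> M x = 0 \<longleftrightarrow> x = 0"
    and h_lim: "(h \<longlongrightarrow> 0) (at 0)"
    and \<Lambda>_expansion:
      "\<forall>\<^sub>F t in at 0. \<Lambda> 1 t = 1 - (c + h t) * complex_of_real (M \<bar>t\<bar>)"
  shows "\<exists>\<epsilon>\<^sub>0>0. \<epsilon>\<^sub>0 \<le> \<alpha> \<and>
    (\<exists>T :: nat \<Rightarrow> real \<Rightarrow> 'a cbop.
      (\<forall>t z. \<bar>t\<bar> < \<epsilon>\<^sub>0 \<and> cmod z < 1 \<longrightarrow>
        cbop_invertible (1 - op_series (\<lambda>n. Rt n t) z) \<and>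
        (\<lambda>n. z ^ n *\<^sub>C T n t) sums cbop_inv (1 - op_series (\<lambda>n. Rt n t) z)) \<and>
      (\<exists>(\<epsilon> :: real \<Rightarrow> real) (\<delta> :: nat \<Rightarrow> real).
        (\<epsilon> \<longlongrightarrow> 0) (at 0) \<and> \<delta> \<longlonglongrightarrow> 0 \<and>
        (\<forall>t n. \<bar>t\<bar> < \<epsilon>\<^sub>0 \<and> n \<ge> 1 \<longrightarrow>
          norm (T n t - (1 / complex_of_real \<mu> *
              (1 - c / complex_of_real \<mu> * complex_of_real (M \<bar>t\<bar>)) ^ n) *\<^sub>C P)
            \<le> \<epsilon> t + \<delta> n)))"
proof -
  let ?T0 = "op_series R 1"
  obtain S where P_nz: "P \<noteq> 0" and PP: "P * P = P" and AP: "(1 - ?T0) * P = 0" and PA: "P * (1 - ?T0) = 0"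
    and AS: "(1 - ?T0) * S = 1 - P" and SA: "S * (1 - ?T0) = 1 - P" and PS: "P * S = 0" and SP: "S * P = 0"
    and compr: "\<And>X. \<exists>a. P * X * P = a *\<^sub>C P"
    by (rule simple_isolated_eigenvalue_decomposition[OF simple P, unfolded scaleC_one]) auto
  \<comment> \<open>The operators are indexed from \<open>1\<close>, so the constant terms are \<open>0\<close>.\<close>
  define F where "F t = Abs_fps (\<lambda>n. if n = 0 then 0 else Rt n t)" for t
  have r_nonneg: "r n \<ge> 0" if "n \<ge> 1" for n using R_le[OF that] norm_ge_zero order.trans by blast
  have nr: "summable (\<lambda>n. real n * r n)"
    by (rule summable_first_moment[OF r_nonneg r_summable tail_summable])
  have F_le: "real n * norm (fps_nth (F t) n) \<le> C * (real n * r n)" if "t \<in> {-\<alpha>..\<alpha>}" for t n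
    using mult_left_mono[OF Rt_le[of n t], of "real n"] that by (cases n) (auto simp: F_def mult_ac)
  have FM: "finite_moment (F t)" if t: "t \<in> {-\<alpha>..\<alpha>}" for t
    unfolding finite_moment_def
  proof
    show "summable (\<lambda>n. real n * norm (fps_nth (F t) n))"
      by (rule summable_comparison_test'[OF summable_mult[OF nr, of C], of 0]) (use F_le[OF t] in simp)
  qed (simp add: F_def)
  have zero: "0 \<in> {-\<alpha>..\<alpha>}" using \<alpha>_pos by simp
  note l1F = finite_moment_imp_l1(1)[OF FM]
  have op: "op_series (\<lambda>n. Rt n t) z = fps_value (F t) z" if "t \<in> {-\<alpha>..\<alpha>}" "cmod z \<le> 1" for t z
  proof -
    have "summable (\<lambda>n. z ^ n *\<^sub>C fps_nth (F t) n)"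
      using l1_imp_abs_conv[OF l1F[OF that(1)] that(2)] unfolding abs_conv_def by (rule summable_norm_cancel)
    from suminf_split_head[OF this] show ?thesis by (simp add: op_series_def fps_value_def F_def)
  qed
  have op0: "op_series R z = fps_value (F 0) z" if "cmod z \<le> 1" for z
    using op[OF zero that] by (simp add: op_series_def Rt_0)
  have T0: "?T0 = fps_value (F 0) 1" by (rule op0) simp
  define R' where "R' = fps_value (fps_tails (F 0)) 1"
  have R': "op_series_deriv_1 R = R'"
    unfolding R'_def fps_value_tails_1[OF FM[OF zero]] by (simp add: op_series_deriv_1_def F_def Rt_0)
  have near0: "\<forall>\<^sub>F t in at 0. t \<in> {-\<alpha>..\<alpha>}"
    unfolding eventually_at using \<alpha>_pos by (intro exI[of _ \<alpha>]) (auto simp: dist_real_def)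
  have moment_lim: "((\<lambda>t. moment (F t - F 0)) \<longlongrightarrow> 0) (at 0)"
  proof -
    let ?a = "\<lambda>n t. real n * norm (fps_nth (F t - F 0) n)"
    have "?a n \<midarrow>0\<rightarrow> 0" for n
    proof (cases "n = 0")
      case False
      have "Rt n \<midarrow>0\<rightarrow> Rt n 0"
        using Rt_cont[of n] False \<alpha>_pos by (simp add: continuous_within at_within_Icc_at)
      then have "(\<lambda>t. norm (Rt n t - Rt n 0)) \<midarrow>0\<rightarrow> 0" by (intro tendsto_norm_zero LIM_zero)
      then show ?thesis using False tendsto_mult_right_zero[of _ "at 0" "real n"] by (simp add: F_def)
    qed (simp add: F_def)
    moreover have "\<forall>\<^sub>F (n, t) in at_top \<times>\<^sub>F at 0. norm (?a n t) \<le> 2 * (C * (real n * r n))"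
    proof -
      have "norm (?a n t) \<le> 2 * (C * (real n * r n))" if "t \<in> {-\<alpha>..\<alpha>}" for n t
      proof -
        have "?a n t \<le> real n * (norm (fps_nth (F t) n) + norm (fps_nth (F 0) n))"
          by (intro mult_left_mono) (auto simp: norm_triangle_ineq4)
        also have "\<dots> \<le> 2 * (C * (real n * r n))"
          using F_le[OF that, of n] F_le[OF zero, of n] by (simp add: distrib_left)
        finally show ?thesis by simp
      qed
      then show ?thesis
        unfolding eventually_prod_filter using near0
        by (intro exI[of _ "\<lambda>_. True"] exI[of _ "\<lambda>t. t \<in> {-\<alpha>..\<alpha>}"]) auto
    qed
    moreover have "summable (\<lambda>n. 2 * (C * (real n * r n)))" by (intro summable_mult nr)
    ultimately have "((\<lambda>t. suminf (\<lambda>n. ?a n t)) \<longlongrightarrow> suminf (\<lambda>n. 0)) (at 0)"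
      using tannerys_theorem[of ?a "\<lambda>_. 0" "at 0" "\<lambda>n. 2 * (C * (real n * r n))"] by simp
    then show ?thesis by (simp add: moment_def)
  qed
  have Fdiff: "l1_fps (F t - F 0)" "l1norm (F t - F 0) \<le> moment (F t - F 0)"
    "l1_fps (fps_tails (F t) - fps_tails (F 0))" "l1norm (fps_tails (F t) - fps_tails (F 0)) \<le> moment (F t - F 0)"
    if t: "t \<in> {-\<alpha>..\<alpha>}" for t
    using finite_moment_imp_l1[OF finite_moment_diff[OF FM[OF t] FM[OF zero]]]
      l1_tails[OF finite_moment_diff[OF FM[OF t] FM[OF zero]]] fps_tails_diff[OF l1F[OF t] l1F[OF zero]]
    by simp_all
  define m where "m t = M \<bar>t\<bar>" for t
  have m0: "m 0 = 0" using M_zero_iff[of 0] by (simp add: m_def)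
  have m_lim: "(m \<longlongrightarrow> 0) (at 0)"
  proof -
    have "((\<lambda>t. M \<bar>t\<bar>) \<longlongrightarrow> M 0) (at 0)"
      by (rule continuous_on_tendsto_compose[OF M_cont]) (auto intro!: tendsto_rabs_zero)
    then show ?thesis using m0 unfolding m_def[abs_def] by simp
  qed
  have m_pos: "\<forall>\<^sub>F t in at 0. m t > 0"
  proof (rule eventually_mono[OF eventually_neq_at_within])
    show "t \<noteq> 0 \<Longrightarrow> m t > 0" for t
      using M_nonneg[of "\<bar>t\<bar>"] M_zero_iff[of "\<bar>t\<bar>"] by (auto simp: m_def less_le)
  qed
  define lam where "lam = \<Lambda> 1"
  have lam_eq: "\<forall>\<^sub>F t in at 0. lam t = 1 - (c + h t) * of_real (m t)"
    using \<Lambda>_expansion by (simp add: lam_def m_def)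
  have "((\<lambda>t. 1 - (c + h t) * of_real (m t)) \<longlongrightarrow> 1 - (c + 0) * of_real 0) (at 0)"
    by (intro tendsto_intros h_lim m_lim)
  then have lam_lim: "(lam \<longlongrightarrow> 1) (at 0)"
    using lam_eq by (simp add: tendsto_cong)
  have "((\<lambda>t. fps_value (F t) 1 - fps_value (F 0) 1) \<longlongrightarrow> 0) (at 0)"
  proof (rule Lim_null_comparison[OF _ moment_lim], rule eventually_mono[OF near0])
    fix t assume t: "t \<in> {-\<alpha>..\<alpha>}"
    have "fps_value (F t) 1 - fps_value (F 0) 1 = fps_value (F t - F 0) 1"
      by (rule fps_value_diff[symmetric]) (auto intro!: l1_imp_abs_conv l1F t zero)
    then show "norm (fps_value (F t) 1 - fps_value (F 0) 1) \<le> moment (F t - F 0)"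
      using norm_fps_value_le[OF Fdiff(1)[OF t], of 1] Fdiff(2)[OF t] by simp
  qed
  then have "((\<lambda>t. fps_value (F t) 1) \<longlongrightarrow> ?T0) (at 0)" unfolding T0 by (rule LIM_zero_cancel)
  moreover have "\<forall>\<^sub>F t in at 0. fps_value (F t) 1 = op_series (\<lambda>n. Rt n t) 1"
    using near0 by (rule eventually_mono) (simp add: op)
  ultimately have "((\<lambda>t. op_series (\<lambda>n. Rt n t) 1) \<longlongrightarrow> ?T0) (at 0)" by (rule Lim_transform_eventually)
  then obtain E1 where E1: "\<forall>\<^sub>F t in at 0. op_series (\<lambda>n. Rt n t) 1 * E1 t = \<Lambda> 1 t *\<^sub>C E1 t"
    and E1_lim: "(E1 \<longlongrightarrow> P) (at 0)"
    by (rule perturbed_eigenvalue_operators[OF P_nz PP AP PA AS SA PS SP compr \<Lambda> _ lam_lim[unfolded lam_def]]) auto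
  \<comment> \<open>The value at \<open>0\<close> makes \<open>H 0\<close> and \<open>J 0\<close> below the factors of the unperturbed problem.\<close>
  define E where "E t = (if t = 0 then P else E1 t)" for t
  have nonzero: "\<forall>\<^sub>F t in at (0 :: real). t \<noteq> 0" by (rule eventually_neq_at_within)
  then have "\<forall>\<^sub>F t in at 0. E1 t = E t" by (rule eventually_mono) (simp add: E_def)
  then have E_lim: "(E \<longlongrightarrow> P) (at 0)" by (rule Lim_transform_eventually[OF E1_lim])
  have E_eig: "\<forall>\<^sub>F t in at 0. fps_value (F t) 1 * E t = lam t *\<^sub>C E t"
    using E1 near0 nonzero
    by eventually_elim (simp add: E_def lam_def op)
  define Y where "Y = S * R'"
  define H where "H t = (fps_tails (F t) - (1 - F t) * fps_const Y) * fps_const (E t)" for t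
  define q where "q t = 1 - c / of_real \<mu> * of_real (m t)" for t
  define J where "J t = one_minus_X (q t) * fps_const (1 - P) + fps_const (E t) - one_minus_X 1 * fps_const (Y * E t)" for t
  define B0 where "B0 = (1 - F 0) * fps_const (1 - P) + H 0"
  have q0: "q 0 = 1" and E0: "E 0 = P" by (simp_all add: q_def m0 E_def)
  have inv': "cbop_invertible (1 - fps_value (F 0) z)" if "cmod z \<le> 1" "z \<noteq> 1" for z
    using invertible[OF that] op0[OF that(1)] by simp
  note unp = unperturbed_renewal_inverse[OF FM[OF zero], folded T0 R'_def, OF PP AP PA AS SA PS SP \<mu>_pos
      \<mu>[unfolded R'] inv', folded Y_def]
  have l1H0: "l1_fps (H 0)" and H0_1: "fps_value (H 0) 1 = of_real \<mu> *\<^sub>C P"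
    and l1J0: "l1_fps (J 0)" and AJ0: "(1 - F 0) * J 0 = one_minus_X 1 * B0"
    using unp(1-4) by (simp_all add: H_def J_def B0_def q0 E0)
  obtain g where l1g: "l1_fps g" and B0g: "B0 * g = 1"
    and J0g1: "fps_value (J 0 * g) 1 = (1 / of_real \<mu>) *\<^sub>C P"
    using unp(5) by (auto simp: H_def J_def B0_def q0 E0)
  define D0 where "D0 = J 0 * g"
  have l1D0: "l1_fps D0" unfolding D0_def by (rule l1_mult(1)[OF l1J0 l1g])
  have "\<exists>T. (1 - F t) * T = 1 \<and> T * (1 - F t) = 1" for t
    by (rule formal_inverse[where b = 1]) (simp_all add: F_def)
  then obtain T where AT: "\<And>t. (1 - F t) * T t = 1" and TA: "\<And>t. T t * (1 - F t) = 1" by metis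
  define D where "D t = one_minus_X (q t) * T t" for t
  have D_0: "D 0 = D0"
  proof -
    have "D0 = (T 0 * (1 - F 0)) * J 0 * g" by (simp add: D0_def TA fps_one_mult)
    also have "\<dots> = (T 0 * one_minus_X 1) * (B0 * g)" unfolding mult.assoc AJ0[unfolded mult.assoc] by (simp only: mult.assoc[symmetric] AJ0)
    also have "\<dots> = D 0" unfolding B0g D_def q0 scalar_commute by (simp add: fps_one_mult)
    finally show ?thesis by simp
  qed
  have E_norm: "((\<lambda>t. norm (E t - P)) \<longlongrightarrow> 0) (at 0)" using E_lim by (intro tendsto_norm_zero LIM_zero)
  have q_lim: "(q \<longlongrightarrow> 1) (at 0)"
  proof -
    have "(q \<longlongrightarrow> 1 - c / of_real \<mu> * of_real 0) (at 0)"
      unfolding q_def by (intro tendsto_intros m_lim) (use \<mu>_pos in auto)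
    then show ?thesis by simp
  qed
  have l1A: "l1_fps (1 - F t)" and l1U: "l1_fps (fps_tails (F t))" and l1H: "l1_fps (H t)" and l1J: "l1_fps (J t)"
    if t: "t \<in> {-\<alpha>..\<alpha>}" for t
  proof -
    show A: "l1_fps (1 - F t)" by (intro l1_diff l1F t) simp
    show U: "l1_fps (fps_tails (F t))" by (rule l1_tails(1)[OF FM[OF t]])
    show "l1_fps (H t)" unfolding H_def by (intro l1_mult l1_diff A U l1_const)
    show "l1_fps (J t)" unfolding J_def by (intro l1_add l1_diff l1_one_minus_X_mult l1_const)
  qed
  have H_lim: "((\<lambda>t. l1norm (H t - H 0)) \<longlongrightarrow> 0) (at 0)"
  proof -
    let ?N = "\<lambda>t. moment (F t - F 0)"
    let ?G = "fps_tails (F 0) - (1 - F 0) * fps_const Y"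
    let ?b = "\<lambda>t. (?N t + ?N t * norm Y) * norm (E t) + l1norm ?G * norm (E t - P)"
    have "(?b \<longlongrightarrow> (0 + 0 * norm Y) * norm P + l1norm ?G * 0) (at 0)"
      by (intro tendsto_intros moment_lim E_lim E_norm)
    then have b: "(?b \<longlongrightarrow> 0) (at 0)" by simp
    show ?thesis
    proof (rule Lim_null_comparison[OF _ b], rule eventually_mono[OF near0])
      fix t assume t: "t \<in> {-\<alpha>..\<alpha>}"
      let ?X = "(fps_tails (F t) - fps_tails (F 0)) + (F t - F 0) * fps_const Y"
      have eq: "H t - H 0 = ?X * fps_const (E t) + ?G * fps_const (E t - P)"
      proof -
        have ring: "(u - a * y) * e - (u0 - a0 * y) * p = (u - u0 + (a0 - a) * y) * e + (u0 - a0 * y) * (e - p)"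
          for u u0 a a0 y e p :: "'a cbop fps" by (simp add: algebra_simps)
        have "F t - F 0 = (1 - F 0) - (1 - F t)" by simp
        then show ?thesis unfolding H_def E0 fps_const_sub[symmetric] by (simp only: ring)
      qed
      have FY: "l1_fps ((F t - F 0) * fps_const Y)" "l1norm ((F t - F 0) * fps_const Y) \<le> ?N t * norm Y"
        using l1_mult[OF Fdiff(1)[OF t] l1_const(1)[of Y]] mult_right_mono[OF Fdiff(2)[OF t], of "norm Y"] by auto
      have X: "l1_fps ?X" by (intro l1_add Fdiff t FY)
      have "l1norm ?X \<le> ?N t + ?N t * norm Y"
        using l1_add(2)[OF Fdiff(3)[OF t] FY(1)] Fdiff(4)[OF t] FY(2) by linarith
      then have "l1norm (?X * fps_const (E t)) \<le> (?N t + ?N t * norm Y) * norm (E t)"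
        using l1_mult(2)[OF X l1_const(1)[of "E t"]] mult_right_mono[of "l1norm ?X" _ "norm (E t)"] by fastforce
      moreover have G: "l1_fps ?G" by (intro l1_diff l1_mult l1A l1U zero l1_const)
      moreover have "l1norm (?G * fps_const (E t - P)) \<le> l1norm ?G * norm (E t - P)"
        using l1_mult(2)[OF G l1_const(1)[of "E t - P"]] by simp
      moreover have "l1norm (H t - H 0) \<le> l1norm (?X * fps_const (E t)) + l1norm (?G * fps_const (E t - P))"
        unfolding eq by (intro l1_add l1_mult X G l1_const)
      moreover have "l1norm (H t - H 0) \<ge> 0" by (intro l1norm_nonneg l1_diff l1H t zero)
      ultimately show "norm (l1norm (H t - H 0)) \<le> ?b t" by simp
    qed
  qed
  have J_lim: "((\<lambda>t. l1norm (J t - J 0)) \<longlongrightarrow> 0) (at 0)"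
  proof -
    let ?b = "\<lambda>t. cmod (1 - q t) * norm (1 - P) + norm (E t - P) + 2 * (norm Y * norm (E t - P))"
    have "(?b \<longlongrightarrow> cmod (1 - 1) * norm (1 - P) + 0 + 2 * (norm Y * 0)) (at 0)"
      by (intro tendsto_intros q_lim E_norm)
    then have b: "(?b \<longlongrightarrow> 0) (at 0)" by simp
    show ?thesis
    proof (rule Lim_null_comparison[OF _ b], rule eventually_mono[OF near0])
      fix t assume t: "t \<in> {-\<alpha>..\<alpha>}"
      let ?x = "fps_const ((1 - q t) *\<^sub>C 1) * (fps_X * fps_const (1 - P))"
      let ?y = "fps_const (E t - P)" and ?z = "one_minus_X 1 * fps_const (Y * (E t - P))"
      have eq: "J t - J 0 = ?x + ?y - ?z"
      proof -
        have group: "(a + e - b) - (a0 + p - b0) = (a - a0) + (e - p) - (b - b0)"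
          for a e b a0 p b0 :: "'a cbop fps" by simp
        have "one_minus_X (q t) * fps_const (1 - P) - one_minus_X 1 * fps_const (1 - P) = ?x"
          unfolding one_minus_X_mult scaleC_diff_left fps_const_sub[symmetric] left_diff_distrib by simp
        moreover have "one_minus_X 1 * fps_const (Y * E t) - one_minus_X 1 * fps_const (Y * P) = ?z"
          by (simp only: right_diff_distrib fps_const_sub[symmetric])
        ultimately show ?thesis unfolding J_def q0 E0 group fps_const_sub by (simp only:)
      qed
      have x: "l1_fps (fps_X * fps_const (1 - P))" by (intro l1_X_mult l1_const)
      have nx: "l1norm ?x = cmod (1 - q t) * norm (1 - P)"
        using l1_X_mult(2)[OF l1_const(1)[of "1 - P"]] by (simp add: l1_scaleC_const_mult[OF x])
      have "l1norm ?z \<le> (1 + cmod 1) * l1norm (fps_const (Y * (E t - P)))"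
        by (rule l1_one_minus_X_mult(2)[OF l1_const(1)])
      also have "\<dots> \<le> 2 * (norm Y * norm (E t - P))" by (simp add: norm_mult_ineq)
      finally have nz: "l1norm ?z \<le> 2 * (norm Y * norm (E t - P))" .
      have lx: "l1_fps ?x" by (rule l1_const_mult(1)[OF x])
      have lz: "l1_fps ?z" by (rule l1_one_minus_X_mult(1)[OF l1_const(1)])
      have "l1norm (J t - J 0) \<le> l1norm ?x + l1norm ?y + l1norm ?z"
        unfolding eq using l1_diff(2)[OF l1_add(1)[OF lx l1_const(1)] lz] l1_add(2)[OF lx l1_const(1)]
        by (rule order.trans[OF _ add_right_mono])
      moreover have "l1norm (J t - J 0) \<ge> 0" by (intro l1norm_nonneg l1_diff l1J t zero)
      ultimately show "norm (l1norm (J t - J 0)) \<le> ?b t" using nx nz by simp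
    qed
  qed
  define \<Delta> where "\<Delta> t = scalar (geometric_fps (q t)) * (fps_const ((1 - lam t) *\<^sub>C E t) + one_minus_X 1 * H t) - H 0" for t
  have l1H_ev: "\<forall>\<^sub>F t in at 0. l1_fps (H t)" using near0 by (rule eventually_mono) (rule l1H)
  note quot = geometric_quotient_tendsto[OF \<mu>_pos c_pos m_lim m_pos h_lim lam_eq E_lim l1H_ev H_lim l1H0 H0_1,
      folded q_def, folded \<Delta>_def]
  \<comment> \<open>The factor \<open>X t\<close> is \<open>(B\<^sub>t - B0) B0\<^sup>-\<^sup>1\<close>.\<close>
  define X where "X t = ((F 0 - F t) * fps_const (1 - P) + \<Delta> t) * g" for t
  have X_le: "\<forall>\<^sub>F t in at 0. l1_fps (X t) \<and>
      l1norm (X t) \<le> (moment (F t - F 0) * norm (1 - P) + l1norm (\<Delta> t)) * l1norm g"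
    using near0 quot(1)
  proof eventually_elim
    case (elim t)
    let ?m = "moment (F t - F 0) * norm (1 - P)"
    let ?x = "(F 0 - F t) * fps_const (1 - P)"
    have d: "l1_fps (F 0 - F t)" "l1norm (F 0 - F t) \<le> moment (F t - F 0)"
      using Fdiff(1,2)[OF elim(1)] l1_minus[of "F t - F 0"] by simp_all
    have x: "l1_fps ?x" "l1norm ?x \<le> ?m"
      using l1_mult[OF d(1) l1_const(1)[of "1 - P"]] mult_right_mono[OF d(2), of "norm (1 - P)"] by auto
    have s: "l1_fps (?x + \<Delta> t)" "l1norm (?x + \<Delta> t) \<le> ?m + l1norm (\<Delta> t)"
      using l1_add[OF x(1) elim(2)] x(2) by auto
    have "l1norm (X t) \<le> l1norm (?x + \<Delta> t) * l1norm g"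
      unfolding X_def by (rule l1_mult(2)[OF s(1) l1g])
    also have "\<dots> \<le> (?m + l1norm (\<Delta> t)) * l1norm g"
      by (intro mult_right_mono s l1norm_nonneg l1g)
    finally show ?case using l1_mult(1)[OF s(1) l1g] by (simp add: X_def)
  qed
  have X_lim: "((\<lambda>t. l1norm (X t)) \<longlongrightarrow> 0) (at 0)"
  proof -
    let ?b = "\<lambda>t. (moment (F t - F 0) * norm (1 - P) + l1norm (\<Delta> t)) * l1norm g"
    have "(?b \<longlongrightarrow> (0 * norm (1 - P) + 0) * l1norm g) (at 0)" by (intro tendsto_intros moment_lim quot(2))
    then have b: "(?b \<longlongrightarrow> 0) (at 0)" by simp
    show ?thesis
      by (rule Lim_null_comparison[OF _ b]) (use X_le in \<open>rule eventually_mono, simp add: l1norm_nonneg\<close>)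
  qed
  then have X_small: "\<forall>\<^sub>F t in at 0. l1norm (X t) < 1 / 2" by (rule order_tendstoD) simp
  \<comment> \<open>The norm of \<open>J t\<close> is bounded by those of \<open>J 0\<close> and \<open>J t - J 0\<close>.\<close>
  let ?bd = "\<lambda>t. 2 * l1norm (X t) * ((l1norm (J 0) + l1norm (J t - J 0)) * l1norm g) + l1norm (J t - J 0) * l1norm g"
  have D_le: "\<forall>\<^sub>F t in at 0. l1_fps (D t) \<and> l1norm (D t - D0) \<le> ?bd t"
    using near0 X_le X_small E_eig
  proof eventually_elim
    case (elim t)
    let ?j = "(l1norm (J 0) + l1norm (J t - J 0)) * l1norm g"
    have "(1 - F t) * J t = one_minus_X (q t) * ((1 - F t) * fps_const (1 - P) + (\<Delta> t + H 0))"
      using renewal_factorization[OF l1F[OF elim(1)] _ elim(4), of "q t" "1 - P" Y]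
      by (simp add: F_def[of t] J_def[of t] H_def[of t] \<Delta>_def[of t])
    also have "(1 - F t) * fps_const (1 - P) + (\<Delta> t + H 0) = B0 + ((F 0 - F t) * fps_const (1 - P) + \<Delta> t)"
      by (simp add: B0_def left_diff_distrib)
    finally have AJ: "(1 - F t) * J t = one_minus_X (q t) * (B0 + ((F 0 - F t) * fps_const (1 - P) + \<Delta> t))" .
    have Jg: "l1_fps (J t * g)" by (intro l1_mult l1J elim l1g)
    have dJ: "l1_fps (J t - J 0)" by (intro l1_diff l1J elim zero)
    have dJg: "l1_fps ((J t - J 0) * g)" by (rule l1_mult(1)[OF dJ l1g])
    note inv = approximate_factor_inverse[OF TA B0g AJ Jg, folded X_def D_def]
    have D: "l1_fps (D t)" "l1norm (D t - J t * g) \<le> 2 * l1norm (X t) * l1norm (J t * g)"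
      using inv elim by auto
    have "l1norm (J t) \<le> l1norm (J 0) + l1norm (J t - J 0)"
      using l1_add(2)[OF l1J0 dJ] by simp
    then have "l1norm (J t * g) \<le> ?j"
      by (intro order.trans[OF l1_mult(2)[OF l1J[OF elim(1)] l1g]] mult_right_mono l1norm_nonneg l1g)
    then have "l1norm (D t - J t * g) \<le> 2 * l1norm (X t) * ?j"
      using elim by (intro order.trans[OF D(2)] mult_left_mono) (auto simp: l1norm_nonneg)
    moreover have "l1norm ((J t - J 0) * g) \<le> l1norm (J t - J 0) * l1norm g" by (rule l1_mult(2)[OF dJ l1g])
    moreover have "D t - D0 = (D t - J t * g) + (J t - J 0) * g" by (simp add: D0_def left_diff_distrib)
    then have "l1norm (D t - D0) \<le> l1norm (D t - J t * g) + l1norm ((J t - J 0) * g)"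
      by (simp only: l1_add(2)[OF l1_diff(1)[OF D(1) Jg] dJg])
    ultimately show ?case using D(1) by auto
  qed
  have D_lim: "((\<lambda>t. l1norm (D t - D0)) \<longlongrightarrow> 0) (at 0)"
  proof -
    have "(?bd \<longlongrightarrow> 2 * 0 * ((l1norm (J 0) + 0) * l1norm g) + 0 * l1norm g) (at 0)"
      by (intro tendsto_intros X_lim J_lim)
    then have b: "(?bd \<longlongrightarrow> 0) (at 0)" by simp
    show ?thesis
      by (rule Lim_null_comparison[OF _ b])
        (use D_le in \<open>rule eventually_mono, simp add: l1norm_nonneg l1_diff l1D0\<close>)
  qed
  have q_le: "\<forall>\<^sub>F t in at 0. cmod (q t) \<le> 1"
  proof -
    have "Re (c / of_real \<mu>) > 0" using c_pos \<mu>_pos by simp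
    from eventually_cmod_one_minus_le[OF this m_lim m_pos] show ?thesis
      by (rule eventually_mono) (simp add: q_def)
  qed
  have "\<forall>\<^sub>F t in at 0. t \<in> {-\<alpha>..\<alpha>} \<and> cmod (q t) \<le> 1 \<and> l1_fps (D t)"
    using near0 q_le D_le by eventually_elim auto
  then obtain d where d: "d > 0" "\<And>t. t \<noteq> 0 \<Longrightarrow> \<bar>t\<bar> < d \<Longrightarrow> t \<in> {-\<alpha>..\<alpha>} \<and> cmod (q t) \<le> 1 \<and> l1_fps (D t)"
    unfolding eventually_at by (auto simp: dist_real_def)
  have good: "t \<in> {-\<alpha>..\<alpha>} \<and> cmod (q t) \<le> 1 \<and> l1_fps (D t)" if "\<bar>t\<bar> < d" for t
    using d(2)[of t] that zero q0 D_0 l1D0 by (cases "t = 0") auto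
  have T_eq: "T t = scalar (geometric_fps (q t)) * D t" for t
    by (simp add: D_def scalar_geometric_fps_mult)
  define \<epsilon> where "\<epsilon> t = l1norm (D t - D0) + (\<Sum>k. cmod (1 - q t ^ k) * norm (fps_nth D0 k))" for t
  define \<delta> where "\<delta> n = (\<Sum>k. norm (fps_nth D0 (k + Suc n)))" for n
  have s: "summable (\<lambda>k. norm (fps_nth D0 k))" using l1D0 by (simp add: l1_fps_def)
  have \<epsilon>_lim: "(\<epsilon> \<longlongrightarrow> 0) (at 0)"
  proof -
    let ?a = "\<lambda>k t. cmod (1 - q t ^ k) * norm (fps_nth D0 k)"
    have "?a k \<midarrow>0\<rightarrow> 0" for k
    proof -
      have "?a k \<midarrow>0\<rightarrow> cmod (1 - 1 ^ k) * norm (fps_nth D0 k)" by (intro tendsto_intros q_lim)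
      then show ?thesis by simp
    qed
    moreover have "\<forall>\<^sub>F (k, t) in at_top \<times>\<^sub>F at 0. norm (?a k t) \<le> 2 * norm (fps_nth D0 k)"
    proof -
      have "norm (?a k t) \<le> 2 * norm (fps_nth D0 k)" if "cmod (q t) \<le> 1" for k t
      proof -
        have "cmod (1 - q t ^ k) \<le> 1 + cmod (q t) ^ k"
          using norm_triangle_ineq4[of 1 "q t ^ k"] by (simp add: norm_power)
        also have "\<dots> \<le> 2" using that by (simp add: power_le_one)
        finally show ?thesis by (simp add: mult_right_mono)
      qed
      then show ?thesis
        unfolding eventually_prod_filter using q_le
        by (intro exI[of _ "\<lambda>_. True"] exI[of _ "\<lambda>t. cmod (q t) \<le> 1"]) auto
    qed
    moreover have "summable (\<lambda>k. 2 * norm (fps_nth D0 k))" by (intro summable_mult s)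
    ultimately have "((\<lambda>t. suminf (\<lambda>k. ?a k t)) \<longlongrightarrow> suminf (\<lambda>k. 0)) (at 0)"
      using tannerys_theorem[of ?a "\<lambda>_. 0" "at 0" "\<lambda>k. 2 * norm (fps_nth D0 k)"] by simp
    then have "((\<lambda>t. suminf (\<lambda>k. ?a k t)) \<longlongrightarrow> 0) (at 0)" by simp
    from tendsto_add_zero[OF D_lim this] show ?thesis by (simp add: \<epsilon>_def[abs_def])
  qed
  have \<delta>_lim: "\<delta> \<longlonglongrightarrow> 0"
  proof (rule LIMSEQ_I)
    fix e :: real assume "e > 0"
    then obtain N where N: "\<And>n. n \<ge> N \<Longrightarrow> norm (\<Sum>i. norm (fps_nth D0 (i + n))) < e"
      using suminf_exist_split[OF _ s] by blast
    show "\<exists>N. \<forall>n\<ge>N. norm (\<delta> n - 0) < e"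
      using N[of "Suc n" for n] by (intro exI[of _ N]) (simp add: \<delta>_def)
  qed
  have part1: "cbop_invertible (1 - op_series (\<lambda>n. Rt n t) z) \<and>
      (\<lambda>n. z ^ n *\<^sub>C fps_nth (T t) n) sums cbop_inv (1 - op_series (\<lambda>n. Rt n t) z)"
    if t: "\<bar>t\<bar> < d" and z: "cmod z < 1" for t z
  proof -
    note g = good[OF t]
    \<comment> \<open>The asymptotics with \<open>D0 = 0\<close> bound the coefficients uniformly.\<close>
    have "norm (fps_nth (T t) n) \<le> l1norm (D t)" for n
      using geometric_convolution_asymptotics[of "q t" "D t" "fps_const 0" n] g
      by (simp add: T_eq scaleC_zero_right del: fps_const_0_eq_0) simp
    from formal_inverse_in_disc[OF l1F AT TA this z] g show ?thesis using op[of t z] z by simp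
  qed
  have part2: "norm (fps_nth (T t) n - (1 / of_real \<mu> *
      (1 - c / of_real \<mu> * of_real (M \<bar>t\<bar>)) ^ n) *\<^sub>C P) \<le> \<epsilon> t + \<delta> n"
    if t: "\<bar>t\<bar> < d" for t n
  proof -
    have "(1 / of_real \<mu> * (1 - c / of_real \<mu> * of_real (M \<bar>t\<bar>)) ^ n) *\<^sub>C P
        = q t ^ n *\<^sub>C fps_value D0 1"
      unfolding D0_def J0g1 scaleC_scaleC q_def m_def by (simp only: mult.commute)
    then show ?thesis
      using geometric_convolution_asymptotics[of "q t" "D t" D0 n] good[OF t] l1D0
      by (simp add: T_eq \<epsilon>_def \<delta>_def)
  qed
  show ?thesis
  proof (intro exI conjI)
    show "min d \<alpha> > 0" "min d \<alpha> \<le> \<alpha>" using d(1) \<alpha>_pos by auto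
    show "\<forall>t z. \<bar>t\<bar> < min d \<alpha> \<and> cmod z < 1 \<longrightarrow> cbop_invertible (1 - op_series (\<lambda>n. Rt n t) z) \<and>
        (\<lambda>n. z ^ n *\<^sub>C (\<lambda>n t. fps_nth (T t) n) n t) sums cbop_inv (1 - op_series (\<lambda>n. Rt n t) z)"
      using part1 by simp
    show "\<forall>t n. \<bar>t\<bar> < min d \<alpha> \<and> n \<ge> 1 \<longrightarrow>
        norm ((\<lambda>n t. fps_nth (T t) n) n t - (1 / of_real \<mu> *
          (1 - c / of_real \<mu> * of_real (M \<bar>t\<bar>)) ^ n) *\<^sub>C P) \<le> \<epsilon> t + \<delta> n"
      using part2 by simp
  qed (rule \<epsilon>_lim \<delta>_lim)+
qed

end
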